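(* Let $\mathbf{E}$ be a topos. In the categorical semantics of $\mathbf{E}$: if there is a model of $\mathrm{(I)NF(U)}_{\mathsf{Set}}$, then there is a model of $\mathrm{(I)ML(U)}_{\mathsf{Class}}$. That is: if there is a model of $\mathrm{INFU}_{\mathsf{Set}}$ (respectively $\mathrm{INF}_{\mathsf{Set}}$) in $\mathbf{E}$, then there is a model of $\mathrm{IMLU}_{\mathsf{Class}}$ (respectively $\mathrm{IML}_{\mathsf{Class}}$) in $\mathbf{E}$; and, for Boolean $\mathbf{E}$, if there is a model of $\mathrm{NFU}_{\mathsf{Set}}$ (respectively $\mathrm{NF}_{\mathsf{Set}}$) in $\mathbf{E}$, then there is a model of $\mathrm{MLU}_{\mathsf{Class}}$ (respectively $\mathrm{ML}_{\mathsf{Class}}$) in $\mathbf{E}$.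
   Context: Categorical semantics is the usual interpretation of (one- or many-sorted) first-order logic in a Heyting category: sorts are objects, relation symbols are subobjects of products, function symbols are morphisms, formulae in context are interpreted as subobjects, and a sentence holds if its interpretation is the maximal subobject of the terminal object. Every topos is a Heyting category. The theories prefixed by $\mathrm{I}$ are based on intuitionistic logic, the others have the same axioms in classical logic. Stratification. Let $\mathcal{L}_{\mathsf{Set}}=\{\in,S,\langle-,-\rangle\}$, with $S$ a unary predicate (sethood) and $\langle-,-\rangle$ a binary function symbol. A formula $\phi$ is stratified if there is $s$ assigning a natural number to each term occurring in $\phi$ such that: $s(\langle v,w\rangle)=s(v)=s(w)$; $s(u)=s(v)$ for each atomic subformula $u=v$; $s(u)+1=s(v)$ for each atomic subformula $u\in v$. $\mathrm{(I)NFU}_{\mathsf{Set}}$ has as axioms the universal closures of: $(S(x)\wedge S(y)\wedge\forall z(z\in x\leftrightarrow z\in y))\to x=y$; $\exists x(S(x)\wedge\forall z(z\in x\leftrightarrow\phi(z)))$ for each stratified $\phi$ in which $x$ is not free; $\langle x,y\rangle=\langle x',y'\rangle\to(x=x'\wedge y=y')$; $z\in x\to S(x)$. $\mathrm{(I)NF}_{\mathsf{Set}}$ adds $\forall x\,S(x)$. $\mathcal{L}_{\mathsf{Class}}$ adds to $\mathcal{L}_{\mathsf{Set}}$ unary predicates $C$ (classhood) and $\mathrm{Setom}$ (sets and atoms); pairing is a partial function, formally a ternary relation symbol, defined on pairs of setoms with setom values. $\mathrm{(I)MLU}_{\mathsf{Class}}$ has as axioms (universal closures of): $z\in x\to C(x)$;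 $z\in x\to\mathrm{Setom}(z)$; $(C(x)\wedge C(y)\wedge\forall z(z\in x\leftrightarrow z\in y))\to x=y$; for all $\phi$ (with $x$ not free), $\exists x(C(x)\wedge\forall z\in\mathrm{Setom}(z\in x\leftrightarrow\phi(z)))$; for all stratified $\phi(z,\vec{y})$ with only $z,\vec{y}$ free and all quantifiers bounded to $\mathrm{Setom}$, $\forall\vec{y}\in\mathrm{Setom}\,\exists x(S(x)\wedge\forall z\in\mathrm{Setom}(z\in x\leftrightarrow\phi(z,\vec{y})))$; $\forall x,y,x',y'\in\mathrm{Setom}\,(\langle x,y\rangle=\langle x',y'\rangle\leftrightarrow(x=x'\wedge y=y'))$; $S(x)\leftrightarrow(\mathrm{Setom}(x)\wedge C(x))$. $\mathrm{(I)ML}_{\mathsf{Class}}$ adds $\forall x\in\mathrm{Setom}\,.\,S(x)$. *)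

theory Defs
  imports Main
begin

section \<open>Elementary toposes\<close>

record ('o, 'm) cat =
  Ob :: "'o set"
  Ar :: "'m set"
  Dom :: "'m \<Rightarrow> 'o"
  Cod :: "'m \<Rightarrow> 'o"
  Idm :: "'o \<Rightarrow> 'm"
  Comp :: "'m \<Rightarrow> 'm \<Rightarrow> 'm"  (* Comp E g f is g after f *)

definition hom :: "('o, 'm) cat \<Rightarrow> 'o \<Rightarrow> 'o \<Rightarrow> 'm set" where
  "hom E A B = {f \<in> Ar E. Dom E f = A \<and> Cod E f = B}"

definition category :: "('o, 'm) cat \<Rightarrow> bool" where
  "category E \<longleftrightarrow>
     (\<forall>f \<in> Ar E. Dom E f \<in> Ob E \<and> Cod E f \<in> Ob E) \<and>
     (\<forall>A \<in> Ob E. Idm E A \<in> hom E A A) \<and>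
     (\<forall>f \<in> Ar E. \<forall>g \<in> Ar E. Dom E g = Cod E f \<longrightarrow>
        Comp E g f \<in> hom E (Dom E f) (Cod E g)) \<and>
     (\<forall>f \<in> Ar E. Comp E f (Idm E (Dom E f)) = f \<and> Comp E (Idm E (Cod E f)) f = f) \<and>
     (\<forall>f \<in> Ar E. \<forall>g \<in> Ar E. \<forall>h \<in> Ar E. Dom E g = Cod E f \<longrightarrow> Dom E h = Cod E g \<longrightarrow>
        Comp E h (Comp E g f) = Comp E (Comp E h g) f)"

definition is_mono :: "('o, 'm) cat \<Rightarrow> 'm \<Rightarrow> bool" where
  "is_mono E m \<longleftrightarrow> m \<in> Ar E \<and>
     (\<forall>X \<in> Ob E. \<forall>f \<in> hom E X (Dom E m). \<forall>g \<in> hom E X (Dom E m).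
        Comp E m f = Comp E m g \<longrightarrow> f = g)"

definition is_terminal :: "('o, 'm) cat \<Rightarrow> 'o \<Rightarrow> bool" where
  "is_terminal E T \<longleftrightarrow> T \<in> Ob E \<and> (\<forall>X \<in> Ob E. \<exists>!f. f \<in> hom E X T)"

definition is_product :: "('o, 'm) cat \<Rightarrow> 'o \<Rightarrow> 'o \<Rightarrow> 'o \<Rightarrow> 'm \<Rightarrow> 'm \<Rightarrow> bool" where
  "is_product E A B P p q \<longleftrightarrow>
     P \<in> Ob E \<and> p \<in> hom E P A \<and> q \<in> hom E P B \<and>
     (\<forall>X \<in> Ob E. \<forall>f \<in> hom E X A. \<forall>g \<in> hom E X B.
        \<exists>!h. h \<in> hom E X P \<and> Comp E p h = f \<and> Comp E q h = g)"

definition is_equalizer :: "('o, 'm) cat \<Rightarrow> 'm \<Rightarrow> 'm \<Rightarrow> 'm \<Rightarrow> bool" where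
  "is_equalizer E f g e \<longleftrightarrow>
     e \<in> Ar E \<and> Cod E e = Dom E f \<and> Comp E f e = Comp E g e \<and>
     (\<forall>X \<in> Ob E. \<forall>h \<in> hom E X (Dom E f). Comp E f h = Comp E g h \<longrightarrow>
        (\<exists>!k. k \<in> hom E X (Dom E e) \<and> Comp E e k = h))"

(* p and q are the projections of a pullback of the cospan f, g:
   f after p = g after q *)
definition is_pullback :: "('o, 'm) cat \<Rightarrow> 'm \<Rightarrow> 'm \<Rightarrow> 'm \<Rightarrow> 'm \<Rightarrow> bool" where
  "is_pullback E f g p q \<longleftrightarrow>
     f \<in> Ar E \<and> g \<in> Ar E \<and> Cod E f = Cod E g \<and>
     p \<in> Ar E \<and> q \<in> Ar E \<and> Dom E p = Dom E q \<and>
     Cod E p = Dom E f \<and> Cod E q = Dom E g \<and> Comp E f p = Comp E g q \<and>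
     (\<forall>X \<in> Ob E. \<forall>h \<in> hom E X (Dom E f). \<forall>k \<in> hom E X (Dom E g).
        Comp E f h = Comp E g k \<longrightarrow>
        (\<exists>!u. u \<in> hom E X (Dom E p) \<and> Comp E p u = h \<and> Comp E q u = k))"

text \<open>Terminal object and products are chosen once and for all.\<close>

definition term_ob :: "('o, 'm) cat \<Rightarrow> 'o" where
  "term_ob E = (SOME T. is_terminal E T)"

definition bang :: "('o, 'm) cat \<Rightarrow> 'o \<Rightarrow> 'm" where
  "bang E X = (THE f. f \<in> hom E X (term_ob E))"

definition prod_cone :: "('o, 'm) cat \<Rightarrow> 'o \<Rightarrow> 'o \<Rightarrow> 'o \<times> 'm \<times> 'm" where
  "prod_cone E A B = (SOME (P, p, q). is_product E A B P p q)"

definition prd :: "('o, 'm) cat \<Rightarrow> 'o \<Rightarrow> 'o \<Rightarrow> 'o" where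
  "prd E A B = fst (prod_cone E A B)"

definition pr1 :: "('o, 'm) cat \<Rightarrow> 'o \<Rightarrow> 'o \<Rightarrow> 'm" where
  "pr1 E A B = fst (snd (prod_cone E A B))"

definition pr2 :: "('o, 'm) cat \<Rightarrow> 'o \<Rightarrow> 'o \<Rightarrow> 'm" where
  "pr2 E A B = snd (snd (prod_cone E A B))"

definition pairing :: "('o, 'm) cat \<Rightarrow> 'm \<Rightarrow> 'm \<Rightarrow> 'm" where
  "pairing E f g = (THE h. h \<in> hom E (Dom E f) (prd E (Cod E f) (Cod E g)) \<and>
     Comp E (pr1 E (Cod E f) (Cod E g)) h = f \<and> Comp E (pr2 E (Cod E f) (Cod E g)) h = g)"

definition is_exponential :: "('o, 'm) cat \<Rightarrow> 'o \<Rightarrow> 'o \<Rightarrow> 'o \<Rightarrow> 'm \<Rightarrow> bool" where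
  "is_exponential E A B X ev \<longleftrightarrow>
     X \<in> Ob E \<and> ev \<in> hom E (prd E X A) B \<and>
     (\<forall>Z \<in> Ob E. \<forall>g \<in> hom E (prd E Z A) B.
        \<exists>!h. h \<in> hom E Z X \<and>
          Comp E ev (pairing E (Comp E h (pr1 E Z A)) (pr2 E Z A)) = g)"

definition is_subobject_classifier :: "('o, 'm) cat \<Rightarrow> 'm \<Rightarrow> bool" where
  "is_subobject_classifier E true \<longleftrightarrow>
     true \<in> Ar E \<and> is_terminal E (Dom E true) \<and>
     (\<forall>m. is_mono E m \<longrightarrow>
        (\<exists>!\<chi>. \<chi> \<in> hom E (Cod E m) (Cod E true) \<and> (\<exists>u. is_pullback E \<chi> true m u)))"

text \<open>Finite limits are given by a terminal object, binary products and equalizers.\<close>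

definition topos :: "('o, 'm) cat \<Rightarrow> bool" where
  "topos E \<longleftrightarrow>
     category E \<and>
     (\<exists>T. is_terminal E T) \<and>
     (\<forall>A \<in> Ob E. \<forall>B \<in> Ob E. \<exists>P p q. is_product E A B P p q) \<and>
     (\<forall>f \<in> Ar E. \<forall>g \<in> hom E (Dom E f) (Cod E f). \<exists>e. is_equalizer E f g e) \<and>
     (\<forall>A \<in> Ob E. \<forall>B \<in> Ob E. \<exists>X ev. is_exponential E A B X ev) \<and>
     (\<exists>true. is_subobject_classifier E true)"


section \<open>Subobjects\<close>

definition factors :: "('o, 'm) cat \<Rightarrow> 'm \<Rightarrow> 'm \<Rightarrow> bool" where
  "factors E m n \<longleftrightarrow> (\<exists>k \<in> hom E (Dom E m) (Dom E n). Comp E n k = m)"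

definition sub_class :: "('o, 'm) cat \<Rightarrow> 'm \<Rightarrow> 'm set" where
  "sub_class E m = {n. is_mono E n \<and> Cod E n = Cod E m \<and> factors E m n \<and> factors E n m}"

text \<open>A subobject is an equivalence class of monomorphisms.\<close>

definition Sub :: "('o, 'm) cat \<Rightarrow> 'o \<Rightarrow> 'm set set" where
  "Sub E A = {sub_class E m | m. is_mono E m \<and> Cod E m = A}"

definition sub_le :: "('o, 'm) cat \<Rightarrow> 'm set \<Rightarrow> 'm set \<Rightarrow> bool" where
  "sub_le E U V \<longleftrightarrow> (\<exists>m \<in> U. \<exists>n \<in> V. factors E m n)"

definition greatest_sub :: "('o, 'm) cat \<Rightarrow> 'o \<Rightarrow> ('m set \<Rightarrow> bool) \<Rightarrow> 'm set" where
  "greatest_sub E A P = (THE U. U \<in> Sub E A \<and> P U \<and> (\<forall>V \<in> Sub E A. P V \<longrightarrow> sub_le E V U))"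

definition least_sub :: "('o, 'm) cat \<Rightarrow> 'o \<Rightarrow> ('m set \<Rightarrow> bool) \<Rightarrow> 'm set" where
  "least_sub E A P = (THE U. U \<in> Sub E A \<and> P U \<and> (\<forall>V \<in> Sub E A. P V \<longrightarrow> sub_le E U V))"

definition sub_top :: "('o, 'm) cat \<Rightarrow> 'o \<Rightarrow> 'm set" where
  "sub_top E A = greatest_sub E A (\<lambda>U. True)"

definition sub_bot :: "('o, 'm) cat \<Rightarrow> 'o \<Rightarrow> 'm set" where
  "sub_bot E A = least_sub E A (\<lambda>U. True)"

definition sub_meet :: "('o, 'm) cat \<Rightarrow> 'o \<Rightarrow> 'm set \<Rightarrow> 'm set \<Rightarrow> 'm set" where
  "sub_meet E A U V = greatest_sub E A (\<lambda>W. sub_le E W U \<and> sub_le E W V)"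

definition sub_join :: "('o, 'm) cat \<Rightarrow> 'o \<Rightarrow> 'm set \<Rightarrow> 'm set \<Rightarrow> 'm set" where
  "sub_join E A U V = least_sub E A (\<lambda>W. sub_le E U W \<and> sub_le E V W)"

definition sub_imp :: "('o, 'm) cat \<Rightarrow> 'o \<Rightarrow> 'm set \<Rightarrow> 'm set \<Rightarrow> 'm set" where
  "sub_imp E A U V = greatest_sub E A (\<lambda>W. sub_le E (sub_meet E A W U) V)"

(* The pullbacks along f of the members of a subobject, and likewise the
   equalizers of f and g, form a whole equivalence class of monomorphisms. *)
definition sub_pullback :: "('o, 'm) cat \<Rightarrow> 'm \<Rightarrow> 'm set \<Rightarrow> 'm set" where
  "sub_pullback E f U = {n. \<exists>m \<in> U. \<exists>u. is_pullback E f m n u}"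

definition sub_equalizer :: "('o, 'm) cat \<Rightarrow> 'm \<Rightarrow> 'm \<Rightarrow> 'm set" where
  "sub_equalizer E f g = {e. is_equalizer E f g e}"

definition sub_exists :: "('o, 'm) cat \<Rightarrow> 'm \<Rightarrow> 'm set \<Rightarrow> 'm set" where
  "sub_exists E f U = least_sub E (Cod E f) (\<lambda>V. sub_le E U (sub_pullback E f V))"

definition sub_forall :: "('o, 'm) cat \<Rightarrow> 'm \<Rightarrow> 'm set \<Rightarrow> 'm set" where
  "sub_forall E f U = greatest_sub E (Cod E f) (\<lambda>V. sub_le E (sub_pullback E f V) U)"

definition boolean :: "('o, 'm) cat \<Rightarrow> bool" where
  "boolean E \<longleftrightarrow> (\<forall>A \<in> Ob E. \<forall>U \<in> Sub E A. \<exists>V \<in> Sub E A.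
     sub_meet E A U V = sub_bot E A \<and> sub_join E A U V = sub_top E A)"


section \<open>One-sorted first-order logic\<close>

text \<open>A signature maps each of its symbols to its arity.  Variables are de Bruijn indices;
  index 0 refers to the innermost quantifier.\<close>

record ('f, 'r) sgn =
  fun_ar :: "'f \<Rightarrow> nat option"
  rel_ar :: "'r \<Rightarrow> nat option"

datatype 'f tm = Var nat | Fun 'f "'f tm list"

datatype ('f, 'r) fm =
    Equal "'f tm" "'f tm"
  | Rel 'r "'f tm list"
  | Falsum
  | Conj "('f, 'r) fm" "('f, 'r) fm"
  | Disj "('f, 'r) fm" "('f, 'r) fm"
  | Impl "('f, 'r) fm" "('f, 'r) fm"
  | Forall "('f, 'r) fm"
  | Exists "('f, 'r) fm"

definition Iff :: "('f, 'r) fm \<Rightarrow> ('f, 'r) fm \<Rightarrow> ('f, 'r) fm" where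
  "Iff \<phi> \<psi> = Conj (Impl \<phi> \<psi>) (Impl \<psi> \<phi>)"

definition Neg :: "('f, 'r) fm \<Rightarrow> ('f, 'r) fm" where
  "Neg \<phi> = Impl \<phi> Falsum"

fun fv_tm :: "'f tm \<Rightarrow> nat set" where
  "fv_tm (Var i) = {i}"
| "fv_tm (Fun f ts) = (\<Union>t \<in> set ts. fv_tm t)"

fun fv :: "('f, 'r) fm \<Rightarrow> nat set" where
  "fv (Equal t u) = fv_tm t \<union> fv_tm u"
| "fv (Rel r ts) = (\<Union>t \<in> set ts. fv_tm t)"
| "fv Falsum = {}"
| "fv (Conj \<phi> \<psi>) = fv \<phi> \<union> fv \<psi>"
| "fv (Disj \<phi> \<psi>) = fv \<phi> \<union> fv \<psi>"
| "fv (Impl \<phi> \<psi>) = fv \<phi> \<union> fv \<psi>"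
| "fv (Forall \<phi>) = {i. Suc i \<in> fv \<phi>}"
| "fv (Exists \<phi>) = {i. Suc i \<in> fv \<phi>}"

text \<open>Well-formed terms and formulas in the context of the variables \<open>0, \<dots>, n - 1\<close>.\<close>

fun wf_tm :: "('f, 'r) sgn \<Rightarrow> nat \<Rightarrow> 'f tm \<Rightarrow> bool" where
  "wf_tm L n (Var i) \<longleftrightarrow> i < n"
| "wf_tm L n (Fun f ts) \<longleftrightarrow> fun_ar L f = Some (length ts) \<and> (\<forall>t \<in> set ts. wf_tm L n t)"

fun wf_fm :: "('f, 'r) sgn \<Rightarrow> nat \<Rightarrow> ('f, 'r) fm \<Rightarrow> bool" where
  "wf_fm L n (Equal t u) \<longleftrightarrow> wf_tm L n t \<and> wf_tm L n u"
| "wf_fm L n (Rel r ts) \<longleftrightarrow> rel_ar L r = Some (length ts) \<and> (\<forall>t \<in> set ts. wf_tm L n t)"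
| "wf_fm L n Falsum \<longleftrightarrow> True"
| "wf_fm L n (Conj \<phi> \<psi>) \<longleftrightarrow> wf_fm L n \<phi> \<and> wf_fm L n \<psi>"
| "wf_fm L n (Disj \<phi> \<psi>) \<longleftrightarrow> wf_fm L n \<phi> \<and> wf_fm L n \<psi>"
| "wf_fm L n (Impl \<phi> \<psi>) \<longleftrightarrow> wf_fm L n \<phi> \<and> wf_fm L n \<psi>"
| "wf_fm L n (Forall \<phi>) \<longleftrightarrow> wf_fm L (Suc n) \<phi>"
| "wf_fm L n (Exists \<phi>) \<longleftrightarrow> wf_fm L (Suc n) \<phi>"

definition univ_closure :: "nat \<Rightarrow> ('f, 'r) fm \<Rightarrow> ('f, 'r) fm" where
  "univ_closure n \<phi> = (Forall ^^ n) \<phi>"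


section \<open>Categorical semantics\<close>

record ('o, 'm, 'f, 'r) struc =
  carrier :: "'o"
  fun_int :: "'f \<Rightarrow> 'm"
  rel_int :: "'r \<Rightarrow> 'm set"

primrec obj_pow :: "('o, 'm) cat \<Rightarrow> 'o \<Rightarrow> nat \<Rightarrow> 'o" where
  "obj_pow E A 0 = term_ob E"
| "obj_pow E A (Suc n) = prd E (obj_pow E A n) A"

(* Variable 0 is the last factor of the power. *)
fun var_proj :: "('o, 'm) cat \<Rightarrow> 'o \<Rightarrow> nat \<Rightarrow> nat \<Rightarrow> 'm" where
  "var_proj E A (Suc n) 0 = pr2 E (obj_pow E A n) A"
| "var_proj E A (Suc n) (Suc i) = Comp E (var_proj E A n i) (pr1 E (obj_pow E A n) A)"
| "var_proj E A 0 i = undefined"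

definition tuple :: "('o, 'm) cat \<Rightarrow> 'o \<Rightarrow> 'm list \<Rightarrow> 'm" where
  "tuple E X fs = foldl (pairing E) (bang E X) fs"

definition is_struc :: "('o, 'm) cat \<Rightarrow> ('f, 'r) sgn \<Rightarrow> ('o, 'm, 'f, 'r) struc \<Rightarrow> bool" where
  "is_struc E L M \<longleftrightarrow>
     carrier M \<in> Ob E \<and>
     (\<forall>f k. fun_ar L f = Some k \<longrightarrow> fun_int M f \<in> hom E (obj_pow E (carrier M) k) (carrier M)) \<and>
     (\<forall>r k. rel_ar L r = Some k \<longrightarrow> rel_int M r \<in> Sub E (obj_pow E (carrier M) k))"

fun tm_sem :: "('o, 'm) cat \<Rightarrow> ('o, 'm, 'f, 'r) struc \<Rightarrow> nat \<Rightarrow> 'f tm \<Rightarrow> 'm" where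
  "tm_sem E M n (Var i) = var_proj E (carrier M) n i"
| "tm_sem E M n (Fun f ts) =
     Comp E (fun_int M f) (tuple E (obj_pow E (carrier M) n) (map (tm_sem E M n) ts))"

fun fm_sem :: "('o, 'm) cat \<Rightarrow> ('o, 'm, 'f, 'r) struc \<Rightarrow> nat \<Rightarrow> ('f, 'r) fm \<Rightarrow> 'm set" where
  "fm_sem E M n (Equal t u) = sub_equalizer E (tm_sem E M n t) (tm_sem E M n u)"
| "fm_sem E M n (Rel r ts) =
     sub_pullback E (tuple E (obj_pow E (carrier M) n) (map (tm_sem E M n) ts)) (rel_int M r)"
| "fm_sem E M n Falsum = sub_bot E (obj_pow E (carrier M) n)"
| "fm_sem E M n (Conj \<phi> \<psi>) =
     sub_meet E (obj_pow E (carrier M) n) (fm_sem E M n \<phi>) (fm_sem E M n \<psi>)"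
| "fm_sem E M n (Disj \<phi> \<psi>) =
     sub_join E (obj_pow E (carrier M) n) (fm_sem E M n \<phi>) (fm_sem E M n \<psi>)"
| "fm_sem E M n (Impl \<phi> \<psi>) =
     sub_imp E (obj_pow E (carrier M) n) (fm_sem E M n \<phi>) (fm_sem E M n \<psi>)"
| "fm_sem E M n (Forall \<phi>) =
     sub_forall E (pr1 E (obj_pow E (carrier M) n) (carrier M)) (fm_sem E M (Suc n) \<phi>)"
| "fm_sem E M n (Exists \<phi>) =
     sub_exists E (pr1 E (obj_pow E (carrier M) n) (carrier M)) (fm_sem E M (Suc n) \<phi>)"

definition holds :: "('o, 'm) cat \<Rightarrow> ('o, 'm, 'f, 'r) struc \<Rightarrow> ('f, 'r) fm \<Rightarrow> bool" where
  "holds E M \<phi> \<longleftrightarrow> fm_sem E M 0 \<phi> = sub_top E (term_ob E)"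

definition model :: "('o, 'm) cat \<Rightarrow> ('f, 'r) sgn \<Rightarrow> ('f, 'r) fm set \<Rightarrow>
    ('o, 'm, 'f, 'r) struc \<Rightarrow> bool" where
  "model E L T M \<longleftrightarrow> is_struc E L M \<and> (\<forall>\<phi> \<in> T. holds E M \<phi>)"

text \<open>A theory in classical logic is rendered as the intuitionistic theory with
  the law of excluded middle added for all formulas of the language.\<close>

definition classical :: "('f, 'r) sgn \<Rightarrow> ('f, 'r) fm set \<Rightarrow> ('f, 'r) fm set" where
  "classical L T = T \<union> {univ_closure n (Disj \<phi> (Neg \<phi>)) | n \<phi>. wf_fm L n \<phi>}"


section \<open>Stratification\<close>

text \<open>\<open>has_type s t k\<close>: the term \<open>t\<close> receives type \<open>k\<close> when its variables are typed by \<open>s\<close>;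
  a term built by a function symbol has the same type as all its arguments.  The parameter \<open>R\<close>
  of \<open>strat\<close> constrains the types of the arguments of each relation symbol.  Every variable
  binding gets a type of its own.\<close>

fun has_type :: "(nat \<Rightarrow> nat) \<Rightarrow> 'f tm \<Rightarrow> nat \<Rightarrow> bool" where
  "has_type s (Var i) k \<longleftrightarrow> s i = k"
| "has_type s (Fun f ts) k \<longleftrightarrow> (\<forall>t \<in> set ts. has_type s t k)"

fun strat :: "('r \<Rightarrow> nat list \<Rightarrow> bool) \<Rightarrow> (nat \<Rightarrow> nat) \<Rightarrow> ('f, 'r) fm \<Rightarrow> bool" where
  "strat R s (Equal t u) \<longleftrightarrow> (\<exists>k. has_type s t k \<and> has_type s u k)"
| "strat R s (Rel r ts) \<longleftrightarrow> (\<exists>ks. list_all2 (has_type s) ts ks \<and> R r ks)"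
| "strat R s Falsum \<longleftrightarrow> True"
| "strat R s (Conj \<phi> \<psi>) \<longleftrightarrow> strat R s \<phi> \<and> strat R s \<psi>"
| "strat R s (Disj \<phi> \<psi>) \<longleftrightarrow> strat R s \<phi> \<and> strat R s \<psi>"
| "strat R s (Impl \<phi> \<psi>) \<longleftrightarrow> strat R s \<phi> \<and> strat R s \<psi>"
| "strat R s (Forall \<phi>) \<longleftrightarrow> (\<exists>k. strat R (case_nat k s) \<phi>)"
| "strat R s (Exists \<phi>) \<longleftrightarrow> (\<exists>k. strat R (case_nat k s) \<phi>)"


section \<open>Set theories\<close>

datatype set_fun = SPair
datatype set_rel = SMem | SSet

definition L_Set :: "(set_fun, set_rel) sgn" where
  "L_Set = \<lparr> fun_ar = (\<lambda>_. Some 2),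
             rel_ar = (\<lambda>r. case r of SMem \<Rightarrow> Some 2 | SSet \<Rightarrow> Some 1) \<rparr>"

type_synonym set_fm = "(set_fun, set_rel) fm"

abbreviation s_mem :: "set_fun tm \<Rightarrow> set_fun tm \<Rightarrow> set_fm" where
  "s_mem t u \<equiv> Rel SMem [t, u]"

abbreviation s_set :: "set_fun tm \<Rightarrow> set_fm" where
  "s_set t \<equiv> Rel SSet [t]"

abbreviation s_pair :: "set_fun tm \<Rightarrow> set_fun tm \<Rightarrow> set_fun tm" where
  "s_pair t u \<equiv> Fun SPair [t, u]"

fun set_typing :: "set_rel \<Rightarrow> nat list \<Rightarrow> bool" where
  "set_typing SMem ks \<longleftrightarrow> (\<exists>k. ks = [k, k + 1])"
| "set_typing SSet ks \<longleftrightarrow> True"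

definition set_stratified :: "set_fm \<Rightarrow> bool" where
  "set_stratified \<phi> \<longleftrightarrow> (\<exists>s. strat set_typing s \<phi>)"

definition set_ext :: set_fm where
  "set_ext = univ_closure 2 (Impl
     (Conj (s_set (Var 1)) (Conj (s_set (Var 0))
       (Forall (Iff (s_mem (Var 0) (Var 2)) (s_mem (Var 0) (Var 1))))))
     (Equal (Var 1) (Var 0)))"

(* In the matrix of the comprehension formulas, 0 is z, 1 is x, and 2, 3, ... are the
   parameters; so the requirement that x is not free in \<phi> reads 1 \<notin> fv \<phi>. *)
definition set_comprehension :: "set_fm \<Rightarrow> set_fm" where
  "set_comprehension \<phi> =
     Exists (Conj (s_set (Var 0)) (Forall (Iff (s_mem (Var 0) (Var 1)) \<phi>)))"

definition set_pair_inj :: set_fm where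
  "set_pair_inj = univ_closure 4 (Impl
     (Equal (s_pair (Var 3) (Var 2)) (s_pair (Var 1) (Var 0)))
     (Conj (Equal (Var 3) (Var 1)) (Equal (Var 2) (Var 0))))"

definition set_sethood :: set_fm where
  "set_sethood = univ_closure 2 (Impl (s_mem (Var 1) (Var 0)) (s_set (Var 0)))"

definition Set_INFU :: "set_fm set" where
  "Set_INFU = {set_ext, set_pair_inj, set_sethood} \<union>
     {univ_closure n (set_comprehension \<phi>) | n \<phi>.
        wf_fm L_Set (n + 2) \<phi> \<and> 1 \<notin> fv \<phi> \<and> set_stratified \<phi>}"

definition Set_INF :: "set_fm set" where
  "Set_INF = Set_INFU \<union> {Forall (s_set (Var 0))}"

definition Set_NFU :: "set_fm set" where
  "Set_NFU = classical L_Set Set_INFU"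

definition Set_NF :: "set_fm set" where
  "Set_NF = classical L_Set Set_INF"


section \<open>Class theories\<close>

text \<open>Pairing is the ternary relation \<open>CPair\<close>, with \<open>CPair x y p\<close> for \<open>\<langle>x, y\<rangle> = p\<close>.
  The language has no function symbols, so the type of these is irrelevant.\<close>

datatype class_rel = CMem | CSet | CClass | CSetom | CPair

definition L_Class :: "(unit, class_rel) sgn" where
  "L_Class = \<lparr> fun_ar = (\<lambda>_. None),
     rel_ar = (\<lambda>r. case r of CMem \<Rightarrow> Some 2 | CSet \<Rightarrow> Some 1 | CClass \<Rightarrow> Some 1
                    | CSetom \<Rightarrow> Some 1 | CPair \<Rightarrow> Some 3) \<rparr>"

type_synonym class_fm = "(unit, class_rel) fm"

abbreviation c_mem :: "unit tm \<Rightarrow> unit tm \<Rightarrow> class_fm" where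
  "c_mem t u \<equiv> Rel CMem [t, u]"

abbreviation c_set :: "unit tm \<Rightarrow> class_fm" where
  "c_set t \<equiv> Rel CSet [t]"

abbreviation c_class :: "unit tm \<Rightarrow> class_fm" where
  "c_class t \<equiv> Rel CClass [t]"

abbreviation c_setom :: "unit tm \<Rightarrow> class_fm" where
  "c_setom t \<equiv> Rel CSetom [t]"

abbreviation c_pair :: "unit tm \<Rightarrow> unit tm \<Rightarrow> unit tm \<Rightarrow> class_fm" where
  "c_pair t u v \<equiv> Rel CPair [t, u, v]"

definition Forall_setom :: "class_fm \<Rightarrow> class_fm" where
  "Forall_setom \<phi> = Forall (Impl (c_setom (Var 0)) \<phi>)"

definition Exists_setom :: "class_fm \<Rightarrow> class_fm" where
  "Exists_setom \<phi> = Exists (Conj (c_setom (Var 0)) \<phi>)"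

definition closure_setom :: "nat \<Rightarrow> class_fm \<Rightarrow> class_fm" where
  "closure_setom n \<phi> = (Forall_setom ^^ n) \<phi>"

inductive setom_bounded :: "class_fm \<Rightarrow> bool" where
  "setom_bounded (Equal t u)"
| "setom_bounded (Rel r ts)"
| "setom_bounded Falsum"
| "setom_bounded \<phi> \<Longrightarrow> setom_bounded \<psi> \<Longrightarrow> setom_bounded (Conj \<phi> \<psi>)"
| "setom_bounded \<phi> \<Longrightarrow> setom_bounded \<psi> \<Longrightarrow> setom_bounded (Disj \<phi> \<psi>)"
| "setom_bounded \<phi> \<Longrightarrow> setom_bounded \<psi> \<Longrightarrow> setom_bounded (Impl \<phi> \<psi>)"
| "setom_bounded \<phi> \<Longrightarrow> setom_bounded (Forall_setom \<phi>)"
| "setom_bounded \<phi> \<Longrightarrow> setom_bounded (Exists_setom \<phi>)"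

fun class_typing :: "class_rel \<Rightarrow> nat list \<Rightarrow> bool" where
  "class_typing CMem ks \<longleftrightarrow> (\<exists>k. ks = [k, k + 1])"
| "class_typing CPair ks \<longleftrightarrow> (\<exists>k. ks = [k, k, k])"
| "class_typing CSet ks \<longleftrightarrow> True"
| "class_typing CClass ks \<longleftrightarrow> True"
| "class_typing CSetom ks \<longleftrightarrow> True"

definition class_stratified :: "class_fm \<Rightarrow> bool" where
  "class_stratified \<phi> \<longleftrightarrow> (\<exists>s. strat class_typing s \<phi>)"

definition class_mem_class :: class_fm where
  "class_mem_class = univ_closure 2 (Impl (c_mem (Var 1) (Var 0)) (c_class (Var 0)))"

definition class_mem_setom :: class_fm where
  "class_mem_setom = univ_closure 2 (Impl (c_mem (Var 1) (Var 0)) (c_setom (Var 1)))"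

definition class_ext :: class_fm where
  "class_ext = univ_closure 2 (Impl
     (Conj (c_class (Var 1)) (Conj (c_class (Var 0))
       (Forall (Iff (c_mem (Var 0) (Var 2)) (c_mem (Var 0) (Var 1))))))
     (Equal (Var 1) (Var 0)))"

definition class_comprehension :: "class_fm \<Rightarrow> class_fm" where
  "class_comprehension \<phi> =
     Exists (Conj (c_class (Var 0)) (Forall_setom (Iff (c_mem (Var 0) (Var 1)) \<phi>)))"

definition class_set_comprehension :: "class_fm \<Rightarrow> class_fm" where
  "class_set_comprehension \<phi> =
     Exists (Conj (c_set (Var 0)) (Forall_setom (Iff (c_mem (Var 0) (Var 1)) \<phi>)))"

text \<open>Pairing is a partial function, defined exactly on pairs of setoms and with setom values.\<close>

definition class_pair_sort :: class_fm where
  "class_pair_sort = univ_closure 3 (Impl (c_pair (Var 2) (Var 1) (Var 0))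
     (Conj (c_setom (Var 2)) (Conj (c_setom (Var 1)) (c_setom (Var 0)))))"

definition class_pair_total :: class_fm where
  "class_pair_total = closure_setom 2 (Exists (c_pair (Var 2) (Var 1) (Var 0)))"

definition class_pair_functional :: class_fm where
  "class_pair_functional = univ_closure 4 (Impl
     (Conj (c_pair (Var 3) (Var 2) (Var 1)) (c_pair (Var 3) (Var 2) (Var 0)))
     (Equal (Var 1) (Var 0)))"

definition class_pair_inj :: class_fm where
  "class_pair_inj = closure_setom 4 (Iff
     (Exists (Conj (c_pair (Var 4) (Var 3) (Var 0)) (c_pair (Var 2) (Var 1) (Var 0))))
     (Conj (Equal (Var 3) (Var 1)) (Equal (Var 2) (Var 0))))"

definition class_sethood :: class_fm where
  "class_sethood = univ_closure 1 (Iff (c_set (Var 0)) (Conj (c_setom (Var 0)) (c_class (Var 0))))"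

definition Class_IMLU :: "class_fm set" where
  "Class_IMLU =
     {class_mem_class, class_mem_setom, class_ext, class_pair_sort, class_pair_total,
      class_pair_functional, class_pair_inj, class_sethood} \<union>
     {univ_closure n (class_comprehension \<phi>) | n \<phi>. wf_fm L_Class (n + 2) \<phi> \<and> 1 \<notin> fv \<phi>} \<union>
     {closure_setom n (class_set_comprehension \<phi>) | n \<phi>.
        wf_fm L_Class (n + 2) \<phi> \<and> 1 \<notin> fv \<phi> \<and> class_stratified \<phi> \<and> setom_bounded \<phi>}"

definition Class_IML :: "class_fm set" where
  "Class_IML = Class_IMLU \<union> {Forall_setom (c_set (Var 0))}"

definition Class_MLU :: "class_fm set" where
  "Class_MLU = classical L_Class Class_IMLU"

definition Class_ML :: "class_fm set" where
  "Class_ML = classical L_Class Class_IML"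

end

theory Submission
  imports Defs
begin

text \<open>
  Let \<open>N\<close> be a model of the set theory, \<open>U\<close> its underlying object and \<open>S\<close> its subobject of sets.
  Taking extensions maps \<open>S\<close> into the power object \<open>P(U)\<close>, injectively by extensionality.  In a
  model of the class theory, setoms should be the elements of \<open>U\<close>, classes the elements of \<open>P(U)\<close>,
  and a set should be the same thing as its extension.  Hence any object will do as a carrier
  into which \<open>U\<close> and \<open>P(U)\<close> embed so that their intersection is \<open>S\<close>.  The product
  \<open>P(U) \<times> P(U)\<close> is such an object, with the embeddings
  \<open>\<iota> x = (ext x, {x})\<close> and \<open>\<kappa> X = (X, {s \<in> S. ext s = X})\<close>:
  if \<open>\<iota> x = \<kappa> X\<close> then \<open>x\<close> belongs to \<open>{s \<in> S. ext s = X}\<close>, and conversely a set with extension \<open>X\<close>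
  is the only one (\<open>iota_eq_kappa_iff\<close>).

  Comprehension for classes is then comprehension in \<open>P(U)\<close>, whatever the formula
  (\<open>holds_class_comprehension\<close>).  A formula whose quantifiers are bounded to setoms says the
  same about setoms as a formula of the language of sets says about the elements of \<open>N\<close>, and
  this translation preserves stratification (\<open>forces_set_fm_of\<close>, \<open>strat_set_fm_of\<close>); so
  comprehension for sets is an axiom of \<open>N\<close> (\<open>holds_stratified_comprehension\<close>).  The
  argument is intuitionistic.  For the classical theories only excluded middle has to be added, and
  every structure in a Boolean topos satisfies it (\<open>boolean_excluded_middle\<close>).

  The interpretation of formulas by subobjects is made tractable by generalized elements.  A
  subobject of \<open>A\<close> is a predicate on the maps into \<open>A\<close>, namely one that is decided by a
  map from \<open>A\<close> to the subobject classifier.  Such \<^emph>\<open>definable\<close> predicates are closed under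
  equations, conjunction, implication and universal quantification over the elements of an object, all of
  which are equalizers in disguise; falsity, disjunction and existence reduce to these by
  quantifying over truth values.  The result is a Kripke-Joyal forcing relation, a recursion
  over formulas that mentions nothing but hom-sets and truth values (\<open>fm_sem_forces\<close>), in which
  the axioms can be checked almost as in naive set theory.
\<close>

section \<open>Generalized elements and truth values\<close>

locale elementary_topos =
  fixes E :: "('o, 'm) cat"
  assumes topos: "topos E"
begin

abbreviation comp (infixr "\<cdot>" 70) where
  "g \<cdot> f \<equiv> Comp E g f"

abbreviation into :: "'o \<Rightarrow> 'm set" where
  "into A \<equiv> {h \<in> Ar E. Cod E h = A}"

lemma category: "category E"
  using topos by (simp add: topos_def)

lemma Dom_Cod_Ob [simp]:
  assumes "f \<in> Ar E"
  shows "Dom E f \<in> Ob E" "Cod E f \<in> Ob E"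
  using category assms unfolding category_def by blast+

lemma Idm_simps [simp]:
  assumes "A \<in> Ob E"
  shows "Idm E A \<in> Ar E" "Dom E (Idm E A) = A" "Cod E (Idm E A) = A"
  using category assms unfolding category_def hom_def by blast+

text \<open>
  Typing premises are stated with domains and codomains rather than hom-sets.  Then they contain
  no variables beyond those of the conclusion, and the simplifier types composites by itself.
\<close>

lemma comp_simps [simp]:
  assumes "f \<in> Ar E" "g \<in> Ar E" "Dom E g = Cod E f"
  shows "g \<cdot> f \<in> Ar E" "Dom E (g \<cdot> f) = Dom E f" "Cod E (g \<cdot> f) = Cod E g"
  using category assms unfolding category_def hom_def by blast+

lemma comp_Idm [simp]:
  assumes "f \<in> Ar E"
  shows "Dom E f = A \<Longrightarrow> f \<cdot> Idm E A = f" "Cod E f = A \<Longrightarrow> Idm E A \<cdot> f = f"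
  using category assms unfolding category_def by blast+

lemma comp_assoc [simp]:
  assumes "f \<in> Ar E" "g \<in> Ar E" "h \<in> Ar E" "Dom E g = Cod E f" "Dom E h = Cod E g"
  shows "(h \<cdot> g) \<cdot> f = h \<cdot> g \<cdot> f"
  using category assms unfolding category_def by metis

lemma hom_Ob: "f \<in> hom E A B \<Longrightarrow> A \<in> Ob E \<and> B \<in> Ob E"
  by (auto simp: hom_def)

lemma Idm_hom: "Y \<in> Ob E \<Longrightarrow> Idm E Y \<in> hom E Y Y"
  by (simp add: hom_def)

lemma comp_hom: "f \<in> hom E A B \<Longrightarrow> g \<in> hom E B C \<Longrightarrow> g \<cdot> f \<in> hom E A C"
  by (auto simp: hom_def)

lemma term_ob: "is_terminal E (term_ob E)"
  using topos unfolding term_ob_def topos_def by (metis someI_ex)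

lemma term_ob_Ob [simp]: "term_ob E \<in> Ob E"
  using term_ob by (simp add: is_terminal_def)

lemma bang_hom: "X \<in> Ob E \<Longrightarrow> bang E X \<in> hom E X (term_ob E)"
  unfolding bang_def by (rule theI') (use term_ob in \<open>simp add: is_terminal_def\<close>)

lemma bang_simps [simp]:
  assumes "X \<in> Ob E"
  shows "bang E X \<in> Ar E" "Dom E (bang E X) = X" "Cod E (bang E X) = term_ob E"
  using bang_hom[OF assms] by (auto simp: hom_def)

lemma bang_unique: "f \<in> Ar E \<Longrightarrow> Cod E f = term_ob E \<Longrightarrow> f = bang E (Dom E f)"
  using term_ob bang_hom[of "Dom E f"] unfolding is_terminal_def hom_def
  by (metis (mono_tags, lifting) Dom_Cod_Ob(1) mem_Collect_eq)

lemma bang_comp [simp]: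
  "X \<in> Ob E \<Longrightarrow> g \<in> Ar E \<Longrightarrow> Cod E g = X \<Longrightarrow> bang E X \<cdot> g = bang E (Dom E g)"
  using bang_unique[of "bang E X \<cdot> g"] by simp

lemma prod_cone:
  assumes "A \<in> Ob E" "B \<in> Ob E"
  shows "is_product E A B (prd E A B) (pr1 E A B) (pr2 E A B)"
proof -
  have "\<exists>c. case c of (P, p, q) \<Rightarrow> is_product E A B P p q"
    using topos assms unfolding topos_def by fast
  then have "case prod_cone E A B of (P, p, q) \<Rightarrow> is_product E A B P p q"
    unfolding prod_cone_def by (rule someI_ex)
  then show ?thesis
    by (simp add: prd_def pr1_def pr2_def case_prod_beta)
qed

lemma prd_simps [simp]:
  assumes "A \<in> Ob E" "B \<in> Ob E"
  shows "prd E A B \<in> Ob E"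
    "pr1 E A B \<in> Ar E" "Dom E (pr1 E A B) = prd E A B" "Cod E (pr1 E A B) = A"
    "pr2 E A B \<in> Ar E" "Dom E (pr2 E A B) = prd E A B" "Cod E (pr2 E A B) = B"
  using prod_cone[OF assms] by (auto simp: is_product_def hom_def)

lemma pairing_props:
  assumes "f \<in> Ar E" "g \<in> Ar E" "Dom E f = Dom E g"
  shows "pairing E f g \<in> hom E (Dom E f) (prd E (Cod E f) (Cod E g)) \<and>
     pr1 E (Cod E f) (Cod E g) \<cdot> pairing E f g = f \<and> pr2 E (Cod E f) (Cod E g) \<cdot> pairing E f g = g"
proof -
  have "f \<in> hom E (Dom E f) (Cod E f)" "g \<in> hom E (Dom E f) (Cod E g)"
    using assms by (auto simp: hom_def)
  then have "\<exists>!h. h \<in> hom E (Dom E f) (prd E (Cod E f) (Cod E g)) \<and>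
     pr1 E (Cod E f) (Cod E g) \<cdot> h = f \<and> pr2 E (Cod E f) (Cod E g) \<cdot> h = g"
    using prod_cone[of "Cod E f" "Cod E g"] assms unfolding is_product_def by simp
  then show ?thesis
    unfolding pairing_def by (rule theI')
qed

lemma pairing_simps [simp]:
  assumes "f \<in> Ar E" "g \<in> Ar E" "Dom E f = Dom E g"
  shows "pairing E f g \<in> Ar E" "Dom E (pairing E f g) = Dom E g"
    "Cod E (pairing E f g) = prd E (Cod E f) (Cod E g)"
    "Cod E f = A \<Longrightarrow> Cod E g = B \<Longrightarrow> pr1 E A B \<cdot> pairing E f g = f"
    "Cod E f = A \<Longrightarrow> Cod E g = B \<Longrightarrow> pr2 E A B \<cdot> pairing E f g = g"
  using pairing_props[OF assms] assms by (auto simp: hom_def)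

lemma prd_ext:
  assumes "h \<in> Ar E" "k \<in> Ar E" "Dom E h = Dom E k" "Cod E h = prd E A B" "Cod E k = prd E A B"
    and "A \<in> Ob E" "B \<in> Ob E"
    and "pr1 E A B \<cdot> h = pr1 E A B \<cdot> k" "pr2 E A B \<cdot> h = pr2 E A B \<cdot> k"
  shows "h = k"
proof -
  have "pr1 E A B \<cdot> h \<in> hom E (Dom E h) A" "pr2 E A B \<cdot> h \<in> hom E (Dom E h) B"
    using assms(1-7) by (auto simp: hom_def)
  then have "\<exists>!l. l \<in> hom E (Dom E h) (prd E A B) \<and>
      pr1 E A B \<cdot> l = pr1 E A B \<cdot> h \<and> pr2 E A B \<cdot> l = pr2 E A B \<cdot> h"
    using prod_cone[OF assms(6,7)] assms(1) unfolding is_product_def by simp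
  then show ?thesis
    using assms unfolding hom_def by (metis (mono_tags, lifting) mem_Collect_eq)
qed

lemma pr_hom:
  "A \<in> Ob E \<Longrightarrow> B \<in> Ob E \<Longrightarrow> pr1 E A B \<in> hom E (prd E A B) A"
  "A \<in> Ob E \<Longrightarrow> B \<in> Ob E \<Longrightarrow> pr2 E A B \<in> hom E (prd E A B) B"
  by (simp_all add: hom_def)

lemma prd_hom_ext:
  assumes "f \<in> hom E X (prd E A B)" "g \<in> hom E X (prd E A B)" "A \<in> Ob E" "B \<in> Ob E"
    "pr1 E A B \<cdot> f = pr1 E A B \<cdot> g" "pr2 E A B \<cdot> f = pr2 E A B \<cdot> g"
  shows "f = g"
  by (rule prd_ext[OF _ _ _ _ _ assms(3-6)]) (use assms(1,2) in \<open>simp_all add: hom_def\<close>)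

lemma pairing_comp [simp]:
  assumes "f \<in> Ar E" "g \<in> Ar E" "Dom E f = Dom E g" "h \<in> Ar E" "Cod E h = Dom E g"
  shows "pairing E f g \<cdot> h = pairing E (f \<cdot> h) (g \<cdot> h)"
proof (rule prd_ext)
  have "pr1 E (Cod E f) (Cod E g) \<cdot> pairing E f g \<cdot> h = (pr1 E (Cod E f) (Cod E g) \<cdot> pairing E f g) \<cdot> h"
    using assms by (subst comp_assoc) auto
  then show "pr1 E (Cod E f) (Cod E g) \<cdot> pairing E f g \<cdot> h = pr1 E (Cod E f) (Cod E g) \<cdot> pairing E (f \<cdot> h) (g \<cdot> h)"
    using assms by simp
  have "pr2 E (Cod E f) (Cod E g) \<cdot> pairing E f g \<cdot> h = (pr2 E (Cod E f) (Cod E g) \<cdot> pairing E f g) \<cdot> h"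
    using assms by (subst comp_assoc) auto
  then show "pr2 E (Cod E f) (Cod E g) \<cdot> pairing E f g \<cdot> h = pr2 E (Cod E f) (Cod E g) \<cdot> pairing E (f \<cdot> h) (g \<cdot> h)"
    using assms by simp
qed (use assms in auto)

lemma pairing_eta:
  assumes "h \<in> Ar E" "Cod E h = prd E A B" "A \<in> Ob E" "B \<in> Ob E"
  shows "pairing E (pr1 E A B \<cdot> h) (pr2 E A B \<cdot> h) = h"
  by (rule prd_ext[of _ _ A B]) (use assms in auto)

lemma pairing_hom:
  "f \<in> hom E Z A \<Longrightarrow> g \<in> hom E Z B \<Longrightarrow> pairing E f g \<in> hom E Z (prd E A B)"
  by (auto simp: hom_def)

lemma pairing_eq_iff [simp]:
  assumes "f \<in> Ar E" "g \<in> Ar E" "Dom E f = Dom E g"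
    and "f' \<in> Ar E" "g' \<in> Ar E" "Dom E f' = Dom E g'"
    and "Cod E f' = Cod E f" "Cod E g' = Cod E g"
  shows "pairing E f g = pairing E f' g' \<longleftrightarrow> f = f' \<and> g = g'"
proof
  assume eq: "pairing E f g = pairing E f' g'"
  have "pr1 E (Cod E f) (Cod E g) \<cdot> pairing E f g = f" "pr2 E (Cod E f) (Cod E g) \<cdot> pairing E f g = g"
    using assms by simp_all
  moreover have "pr1 E (Cod E f) (Cod E g) \<cdot> pairing E f' g' = f'" "pr2 E (Cod E f) (Cod E g) \<cdot> pairing E f' g' = g'"
    using assms by simp_all
  ultimately show "f = f' \<and> g = g'"
    unfolding eq by simp
qed simp

lemma factors_iff:
  assumes "n \<in> Ar E"
  shows "factors E h n \<longleftrightarrow> (\<exists>k \<in> Ar E. Dom E k = Dom E h \<and> Cod E k = Dom E n \<and> n \<cdot> k = h)"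
  unfolding factors_def hom_def by auto

lemma mono_cancel:
  assumes "is_mono E m" "f \<in> Ar E" "g \<in> Ar E" "Cod E f = Dom E m" "Cod E g = Dom E m"
    and eq: "m \<cdot> f = m \<cdot> g"
  shows "f = g"
proof -
  have "m \<in> Ar E"
    using assms(1) by (simp add: is_mono_def)
  then have "Dom E f = Dom E g"
    using eq assms comp_simps(2)[of f m] comp_simps(2)[of g m] by metis
  then have "f \<in> hom E (Dom E f) (Dom E m)" "g \<in> hom E (Dom E f) (Dom E m)"
    using assms by (auto simp: hom_def)
  with assms(1,2) eq show ?thesis
    unfolding is_mono_def by (meson Dom_Cod_Ob)
qed

lemma mono_Ar: "is_mono E m \<Longrightarrow> m \<in> Ar E"
  by (simp add: is_mono_def)

text \<open>
  \<open>true_at X\<close> is the truth value true at stage \<open>X\<close>.  A generalized element \<open>h\<close> of \<open>A\<close> satisfies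
  \<open>\<chi> : A \<rightarrow> \<Omega>\<close> if \<open>\<chi> \<cdot> h\<close> is true at the stage of \<open>h\<close>.
\<close>

definition "truth = (SOME t. is_subobject_classifier E t)"

definition "Omega = Cod E truth"

definition "true_at X = truth \<cdot> (THE f. f \<in> hom E X (Dom E truth))"

lemma truth: "is_subobject_classifier E truth"
  using topos unfolding truth_def topos_def by (metis someI_ex)

lemma truth_Ar [simp]: "truth \<in> Ar E"
  using truth by (simp add: is_subobject_classifier_def)

lemma Omega_Ob [simp]: "Omega \<in> Ob E"
  by (simp add: Omega_def)

lemma true_at_factor:
  assumes "u \<in> Ar E" "Cod E u = Dom E truth"
  shows "truth \<cdot> u = true_at (Dom E u)"
proof -
  have "\<exists>!f. f \<in> hom E (Dom E u) (Dom E truth)"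
    using truth assms unfolding is_subobject_classifier_def is_terminal_def by simp
  moreover have "u \<in> hom E (Dom E u) (Dom E truth)"
    using assms by (simp add: hom_def)
  ultimately have "(THE f. f \<in> hom E (Dom E u) (Dom E truth)) = u"
    by (rule the1_equality)
  then show ?thesis by (simp add: true_at_def)
qed

lemma true_at_ex:
  assumes "X \<in> Ob E"
  shows "\<exists>u \<in> Ar E. Dom E u = X \<and> Cod E u = Dom E truth \<and> truth \<cdot> u = true_at X"
proof -
  have "\<exists>!f. f \<in> hom E X (Dom E truth)"
    using truth assms unfolding is_subobject_classifier_def is_terminal_def by simp
  then obtain u where "u \<in> hom E X (Dom E truth)" by blast
  then show ?thesis
    using true_at_factor[of u] by (auto simp: hom_def)
qed

lemma true_at_simps [simp]:
  assumes "X \<in> Ob E"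
  shows "true_at X \<in> Ar E" "Dom E (true_at X) = X" "Cod E (true_at X) = Omega"
proof -
  obtain u where u: "u \<in> Ar E" "Dom E u = X" "Cod E u = Dom E truth" "truth \<cdot> u = true_at X"
    using true_at_ex[OF assms] by blast
  show "true_at X \<in> Ar E" "Dom E (true_at X) = X" "Cod E (true_at X) = Omega"
    unfolding u(4)[symmetric] using u(1-3) by (simp_all add: Omega_def)
qed

lemma true_at_comp [simp]:
  assumes "X \<in> Ob E" "g \<in> Ar E" "Cod E g = X"
  shows "true_at X \<cdot> g = true_at (Dom E g)"
proof -
  obtain u where u: "u \<in> Ar E" "Dom E u = X" "Cod E u = Dom E truth" "truth \<cdot> u = true_at X"
    using true_at_ex[OF assms(1)] by blast
  have "true_at X \<cdot> g = truth \<cdot> (u \<cdot> g)"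
    unfolding u(4)[symmetric] using u(1-3) assms by simp
  then show ?thesis
    using true_at_factor[of "u \<cdot> g"] u assms by simp
qed

lemma truth_dom_unique:
  assumes "u \<in> Ar E" "v \<in> Ar E" "Dom E u = Dom E v" "Cod E u = Dom E truth" "Cod E v = Dom E truth"
  shows "u = v"
proof -
  have "\<exists>!f. f \<in> hom E (Dom E u) (Dom E truth)"
    using truth assms unfolding is_subobject_classifier_def is_terminal_def by simp
  then show ?thesis using assms by (auto simp: hom_def)
qed

text \<open>
  The pullback condition in terms of elements: \<open>\<chi>\<close> classifies \<open>m\<close> if exactly the elements that
  factor through \<open>m\<close> satisfy \<open>\<chi>\<close>, because elements of a terminal object exist and are unique.
\<close>

lemma pullback_truth_iff:
  assumes "is_mono E m" "\<chi> \<in> hom E (Cod E m) Omega"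
  shows "(\<exists>u. is_pullback E \<chi> truth m u) \<longleftrightarrow>
    (\<forall>h \<in> into (Cod E m). factors E h m \<longleftrightarrow> \<chi> \<cdot> h = true_at (Dom E h))"
proof
  have m: "m \<in> Ar E" using assms(1) by (rule mono_Ar)
  have chi: "\<chi> \<in> Ar E" "Dom E \<chi> = Cod E m" "Cod E \<chi> = Omega"
    using assms(2) by (auto simp: hom_def)
  {
    assume "\<exists>u. is_pullback E \<chi> truth m u"
    then obtain u where u: "is_pullback E \<chi> truth m u" by blast
    show "\<forall>h \<in> into (Cod E m). factors E h m \<longleftrightarrow> \<chi> \<cdot> h = true_at (Dom E h)"
    proof safe
      fix h assume h: "h \<in> Ar E" "Cod E h = Cod E m"
      {
        assume "factors E h m"
        then obtain k where k: "k \<in> Ar E" "Dom E k = Dom E h" "Cod E k = Dom E m" "m \<cdot> k = h"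
          using m by (auto simp: factors_iff)
        have u': "u \<in> Ar E" "Dom E u = Dom E m" "Cod E u = Dom E truth" "\<chi> \<cdot> m = truth \<cdot> u"
          using u unfolding is_pullback_def by auto
        have "\<chi> \<cdot> h = (\<chi> \<cdot> m) \<cdot> k"
          unfolding k(4)[symmetric] using k(1-3) chi m by simp
        also have "\<dots> = truth \<cdot> (u \<cdot> k)"
          using u' k(1-3) by simp
        finally show "\<chi> \<cdot> h = true_at (Dom E h)"
          using true_at_factor[of "u \<cdot> k"] u' k by simp
      next
        assume eq: "\<chi> \<cdot> h = true_at (Dom E h)"
        obtain v where v: "v \<in> Ar E" "Dom E v = Dom E h" "Cod E v = Dom E truth" "truth \<cdot> v = true_at (Dom E h)"
          using true_at_ex[of "Dom E h"] h by auto
        have "\<exists>!k. k \<in> hom E (Dom E h) (Dom E m) \<and> m \<cdot> k = h \<and> u \<cdot> k = v"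
        proof -
          have "h \<in> hom E (Dom E h) (Dom E \<chi>)" "v \<in> hom E (Dom E h) (Dom E truth)" "\<chi> \<cdot> h = truth \<cdot> v" "Dom E h \<in> Ob E"
            using h v chi eq by (auto simp: hom_def)
          then show ?thesis using u unfolding is_pullback_def by blast
        qed
        then show "factors E h m" by (auto simp: factors_def)
      }
    qed
  next
    assume R: "\<forall>h \<in> into (Cod E m). factors E h m \<longleftrightarrow> \<chi> \<cdot> h = true_at (Dom E h)"
    obtain u where u: "u \<in> Ar E" "Dom E u = Dom E m" "Cod E u = Dom E truth" "truth \<cdot> u = true_at (Dom E m)"
      using true_at_ex[of "Dom E m"] m by auto
    have "factors E m m"
      using m by (auto simp: factors_iff intro!: bexI[of _ "Idm E (Dom E m)"])
    then have "\<chi> \<cdot> m = truth \<cdot> u"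
      using R m u by auto
    moreover have "\<exists>!k. k \<in> hom E X (Dom E m) \<and> m \<cdot> k = h \<and> u \<cdot> k = v"
      if "X \<in> Ob E" and h: "h \<in> hom E X (Dom E \<chi>)" and v: "v \<in> hom E X (Dom E truth)"
        and eq: "\<chi> \<cdot> h = truth \<cdot> v" for X h v
    proof -
      have "\<chi> \<cdot> h = true_at (Dom E h)"
        using eq v h true_at_factor[of v] by (auto simp: hom_def)
      then have "factors E h m"
        using R h chi by (auto simp: hom_def)
      then obtain k where k: "k \<in> Ar E" "Dom E k = Dom E h" "Cod E k = Dom E m" "m \<cdot> k = h"
        using m by (auto simp: factors_iff)
      have "u \<cdot> k = v"
        by (rule truth_dom_unique) (use u k h v in \<open>auto simp: hom_def\<close>)
      with k h show ?thesis
        using mono_cancel[OF assms(1)] by (intro ex1I[of _ k]) (auto simp: hom_def)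
    qed
    ultimately have "is_pullback E \<chi> truth m u"
      unfolding is_pullback_def using m u chi by (auto simp: Omega_def)
    then show "\<exists>u. is_pullback E \<chi> truth m u" by blast
  }
qed

lemma equalizer_ex:
  assumes "f \<in> hom E A B" "g \<in> hom E A B"
  shows "\<exists>e. is_equalizer E f g e"
  using topos assms unfolding topos_def hom_def by fastforce

lemma equalizer_mono:
  assumes "is_equalizer E f g e" "f \<in> hom E A B" "g \<in> hom E A B"
  shows "is_mono E e \<and> Cod E e = A \<and> (\<forall>h \<in> into A. factors E h e \<longleftrightarrow> f \<cdot> h = g \<cdot> h)"
proof -
  have e: "e \<in> Ar E" "Cod E e = Dom E f" "f \<cdot> e = g \<cdot> e"
    and U: "\<And>X h. X \<in> Ob E \<Longrightarrow> h \<in> hom E X (Dom E f) \<Longrightarrow> f \<cdot> h = g \<cdot> h \<Longrightarrow>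
        (\<exists>!k. k \<in> hom E X (Dom E e) \<and> e \<cdot> k = h)"
    using assms(1) unfolding is_equalizer_def by blast+
  have fg: "f \<in> Ar E" "g \<in> Ar E" "Dom E f = A" "Dom E g = A"
    using assms by (auto simp: hom_def)
  have eqk: "f \<cdot> (e \<cdot> k) = g \<cdot> (e \<cdot> k)" if "k \<in> Ar E" "Cod E k = Dom E e" for k
  proof -
    have "f \<cdot> (e \<cdot> k) = (f \<cdot> e) \<cdot> k" using that e(1,2) fg by simp
    also have "\<dots> = g \<cdot> (e \<cdot> k)" unfolding e(3) using that e(1,2) fg by simp
    finally show ?thesis .
  qed
  have "is_mono E e"
    unfolding is_mono_def
  proof (intro conjI ballI impI)
    fix X k l assume "X \<in> Ob E" "k \<in> hom E X (Dom E e)" "l \<in> hom E X (Dom E e)" "e \<cdot> k = e \<cdot> l"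
    then show "k = l"
      using U[of X "e \<cdot> k"] eqk[of k] e by (auto simp: hom_def)
  qed (fact e)
  moreover have "factors E h e \<longleftrightarrow> f \<cdot> h = g \<cdot> h" if "h \<in> into A" for h
    using that U[of "Dom E h" h] eqk e fg by (auto simp: factors_def hom_def)
  ultimately show ?thesis using e fg by simp
qed

lemma chi_ex:
  assumes "is_mono E m"
  shows "\<exists>\<chi> \<in> hom E (Cod E m) Omega. \<forall>h \<in> into (Cod E m). factors E h m \<longleftrightarrow> \<chi> \<cdot> h = true_at (Dom E h)"
  using truth assms pullback_truth_iff[OF assms] unfolding is_subobject_classifier_def Omega_def by meson

text \<open>
  The monomorphism classified by \<open>\<chi>\<close> is the equalizer of \<open>\<chi>\<close> and the constant true.
\<close>

lemma chi_mono:
  assumes "\<chi> \<in> hom E A Omega"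
  shows "\<exists>m. is_mono E m \<and> Cod E m = A \<and> (\<forall>h \<in> into A. factors E h m \<longleftrightarrow> \<chi> \<cdot> h = true_at (Dom E h))"
proof -
  have "A \<in> Ob E" using assms hom_Ob by blast
  then have t: "true_at A \<in> hom E A Omega" by (simp add: hom_def)
  obtain e where "is_equalizer E \<chi> (true_at A) e"
    using equalizer_ex[OF assms t] by blast
  from equalizer_mono[OF this assms t] \<open>A \<in> Ob E\<close> show ?thesis
    by (intro exI[of _ e]) auto
qed

text \<open>
  Two maps to \<open>\<Omega>\<close> satisfied by the same elements classify the same monomorphism.
\<close>

lemma chi_unique:
  assumes "\<chi> \<in> hom E A Omega" "\<chi>' \<in> hom E A Omega"
    and "\<And>h. h \<in> into A \<Longrightarrow> \<chi> \<cdot> h = true_at (Dom E h) \<longleftrightarrow> \<chi>' \<cdot> h = true_at (Dom E h)"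
  shows "\<chi> = \<chi>'"
proof -
  obtain m where m: "is_mono E m" "Cod E m = A" "\<forall>h \<in> into A. factors E h m \<longleftrightarrow> \<chi> \<cdot> h = true_at (Dom E h)"
    using chi_mono[OF assms(1)] by blast
  then have "\<exists>u. is_pullback E \<chi> truth m u" "\<exists>u. is_pullback E \<chi>' truth m u"
    using assms by (simp_all add: pullback_truth_iff)
  moreover have "\<exists>!\<chi>. \<chi> \<in> hom E A Omega \<and> (\<exists>u. is_pullback E \<chi> truth m u)"
    using truth m(1) unfolding is_subobject_classifier_def m(2)[symmetric] Omega_def by blast
  ultimately show ?thesis
    using assms(1,2) by blast
qed

section \<open>Definable predicates and power objects\<close>

definition classifies :: "'m \<Rightarrow> 'o \<Rightarrow> ('m \<Rightarrow> bool) \<Rightarrow> bool" where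
  "classifies \<chi> A P \<longleftrightarrow> \<chi> \<in> hom E A Omega \<and> (\<forall>h \<in> into A. P h \<longleftrightarrow> \<chi> \<cdot> h = true_at (Dom E h))"

text \<open>
  The definable predicates on the elements of \<open>A\<close> are the subobjects of \<open>A\<close> in another guise, but
  can be written down without choosing representatives.
\<close>

definition definable :: "'o \<Rightarrow> ('m \<Rightarrow> bool) \<Rightarrow> bool" where
  "definable A P \<longleftrightarrow> (\<exists>\<chi>. classifies \<chi> A P)"

lemma classifiesD:
  assumes "classifies \<chi> A P"
  shows "\<chi> \<in> Ar E" "Dom E \<chi> = A" "Cod E \<chi> = Omega" "A \<in> Ob E"
    "h \<in> Ar E \<Longrightarrow> Cod E h = A \<Longrightarrow> P h \<longleftrightarrow> \<chi> \<cdot> h = true_at (Dom E h)"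
  using assms unfolding classifies_def hom_def by auto

lemma definable_cong:
  "definable A P \<Longrightarrow> (\<And>h. h \<in> Ar E \<Longrightarrow> Cod E h = A \<Longrightarrow> P h \<longleftrightarrow> Q h) \<Longrightarrow> definable A Q"
  by (auto simp: definable_def classifies_def)

lemma definable_factors: "is_mono E m \<Longrightarrow> definable (Cod E m) (\<lambda>h. factors E h m)"
  using chi_ex unfolding definable_def classifies_def by blast

lemma definable_eq:
  assumes "f \<in> hom E A B" "g \<in> hom E A B"
  shows "definable A (\<lambda>h. f \<cdot> h = g \<cdot> h)"
proof -
  obtain e where "is_equalizer E f g e"
    using equalizer_ex[OF assms] by blast
  then have e: "is_mono E e" "Cod E e = A" "\<forall>h \<in> into A. factors E h e \<longleftrightarrow> f \<cdot> h = g \<cdot> h"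
    using equalizer_mono assms by blast+
  have "definable A (\<lambda>h. factors E h e)"
    using definable_factors[OF e(1)] e(2) by simp
  then show ?thesis
    by (rule definable_cong) (use e(3) in blast)
qed

lemma definable_True: "A \<in> Ob E \<Longrightarrow> definable A (\<lambda>h. True)"
  using definable_eq[of "Idm E A" A A "Idm E A"] by (simp add: hom_def)

lemma definable_classified: "\<chi> \<in> hom E A Omega \<Longrightarrow> definable A (\<lambda>h. \<chi> \<cdot> h = true_at (Dom E h))"
  unfolding definable_def classifies_def by blast

lemma definable_comp:
  assumes "definable A P" "f \<in> hom E B A"
  shows "definable B (\<lambda>h. P (f \<cdot> h))"
proof -
  from assms(1) obtain \<chi> where "classifies \<chi> A P"
    unfolding definable_def by blast
  note \<chi> = classifiesD[OF this]
  show ?thesis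
    unfolding definable_def classifies_def using \<chi> assms(2)
    by (intro exI[of _ "\<chi> \<cdot> f"]) (auto simp: hom_def)
qed

text \<open>
  Both predicates hold of \<open>h\<close> iff \<open>\<langle>\<chi>, \<psi>\<rangle>\<close> and \<open>\<langle>true, true\<rangle>\<close> agree on \<open>h\<close>.
\<close>

lemma definable_conj:
  assumes "definable A P" "definable A Q"
  shows "definable A (\<lambda>h. P h \<and> Q h)"
proof -
  from assms(1) obtain \<chi> where "classifies \<chi> A P"
    unfolding definable_def by blast
  note \<chi> = classifiesD[OF this]
  from assms(2) obtain \<psi> where "classifies \<psi> A Q"
    unfolding definable_def by blast
  note \<psi> = classifiesD[OF this]
  have "definable A (\<lambda>h. pairing E \<chi> \<psi> \<cdot> h = pairing E (true_at A) (true_at A) \<cdot> h)"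
    by (rule definable_eq[of _ _ "prd E Omega Omega"]) (use \<chi>(1-4) \<psi>(1-4) in \<open>auto simp: hom_def\<close>)
  then show ?thesis
    by (rule definable_cong) (use \<chi> \<psi> in simp)
qed

text \<open>
  What is true at a stage remains true at all later ones.
\<close>

lemma definable_persistent:
  assumes "definable A P" "P h" "h \<in> Ar E" "Cod E h = A" "g \<in> Ar E" "Cod E g = Dom E h"
  shows "P (h \<cdot> g)"
proof -
  from assms(1) obtain \<chi> where "classifies \<chi> A P"
    unfolding definable_def by blast
  note \<chi> = classifiesD[OF this]
  have "\<chi> \<cdot> h \<cdot> g = (\<chi> \<cdot> h) \<cdot> g" using \<chi>(1-4) assms by simp
  also have "\<dots> = true_at (Dom E h) \<cdot> g" using \<chi>(5)[of h] assms by simp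
  also have "\<dots> = true_at (Dom E (h \<cdot> g))" using assms by simp
  finally show ?thesis using \<chi>(5)[of "h \<cdot> g"] assms by simp
qed

text \<open>
  \<open>P\<close> implies \<open>Q\<close> from stage \<open>h\<close> on iff the truth values of \<open>P \<and> Q\<close> and of \<open>P\<close> at \<open>h\<close> are equal;
  so implication is an equation between maps to \<open>\<Omega>\<close>.
\<close>

lemma definable_imp:
  assumes "definable A P" "definable A Q"
  shows "definable A (\<lambda>h. \<forall>g \<in> into (Dom E h). P (h \<cdot> g) \<longrightarrow> Q (h \<cdot> g))"
proof -
  from assms(1) obtain \<chi> where "classifies \<chi> A P"
    unfolding definable_def by blast
  note \<chi> = classifiesD[OF this]
  from definable_conj[OF assms] obtain \<psi> where "classifies \<psi> A (\<lambda>h. P h \<and> Q h)"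
    unfolding definable_def by blast
  note \<psi> = classifiesD[OF this]
  have "definable A (\<lambda>h. \<chi> \<cdot> h = \<psi> \<cdot> h)"
    by (rule definable_eq[of _ _ Omega]) (use \<chi>(1-4) \<psi>(1-4) in \<open>auto simp: hom_def\<close>)
  then show ?thesis
  proof (rule definable_cong)
    fix h assume h: "h \<in> Ar E" "Cod E h = A"
    have *: "(P (h \<cdot> g) \<longleftrightarrow> (\<chi> \<cdot> h) \<cdot> g = true_at (Dom E g)) \<and> (P (h \<cdot> g) \<and> Q (h \<cdot> g) \<longleftrightarrow> (\<psi> \<cdot> h) \<cdot> g = true_at (Dom E g))"
      if "g \<in> into (Dom E h)" for g
      using \<chi>(1-4) \<psi>(1-4) \<chi>(5)[of "h \<cdot> g"] \<psi>(5)[of "h \<cdot> g"] that h by simp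
    have "\<chi> \<cdot> h \<in> hom E (Dom E h) Omega" "\<psi> \<cdot> h \<in> hom E (Dom E h) Omega"
      using \<chi>(1-4) \<psi>(1-4) h by (auto simp: hom_def)
    note homs = this
    have "\<chi> \<cdot> h = \<psi> \<cdot> h \<longleftrightarrow> (\<forall>g \<in> into (Dom E h). (\<chi> \<cdot> h) \<cdot> g = true_at (Dom E g) \<longleftrightarrow> (\<psi> \<cdot> h) \<cdot> g = true_at (Dom E g))"
      by (rule iffI, simp, rule chi_unique[OF homs]) blast
    then show "\<chi> \<cdot> h = \<psi> \<cdot> h \<longleftrightarrow> (\<forall>g \<in> into (Dom E h). P (h \<cdot> g) \<longrightarrow> Q (h \<cdot> g))"
      using * by blast
  qed
qed

definition "power_cone B = (SOME c. is_exponential E B Omega (fst c) (snd c))"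
definition "pow_ob B = fst (power_cone B)"
definition "power_ev B = snd (power_cone B)"

definition isin :: "'o \<Rightarrow> 'm \<Rightarrow> 'm \<Rightarrow> bool" where
  "isin B b X \<longleftrightarrow> power_ev B \<cdot> pairing E X b = true_at (Dom E b)"

lemma power_exponential:
  assumes "B \<in> Ob E"
  shows "is_exponential E B Omega (pow_ob B) (power_ev B)"
proof -
  have "\<exists>c. is_exponential E B Omega (fst c) (snd c)"
    using topos assms unfolding topos_def by (metis Omega_Ob fst_conv snd_conv)
  then show ?thesis
    unfolding pow_ob_def power_ev_def power_cone_def by (rule someI_ex)
qed

lemma pow_ob_simps [simp]:
  assumes "B \<in> Ob E"
  shows "pow_ob B \<in> Ob E" "power_ev B \<in> Ar E" "Dom E (power_ev B) = prd E (pow_ob B) B" "Cod E (power_ev B) = Omega"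
  using power_exponential[OF assms] by (auto simp: is_exponential_def hom_def)

lemma isin_definable:
  assumes "X \<in> hom E Y (pow_ob B)" "b \<in> hom E Y B"
  shows "definable Y (\<lambda>h. isin B (b \<cdot> h) (X \<cdot> h))"
proof -
  have "B \<in> Ob E" using assms(2) hom_Ob by blast
  then have "definable Y (\<lambda>h. (power_ev B \<cdot> pairing E X b) \<cdot> h = true_at (Dom E h))"
    by (intro definable_classified) (use assms in \<open>auto simp: hom_def\<close>)
  then show ?thesis
    by (rule definable_cong) (use assms \<open>B \<in> Ob E\<close> in \<open>auto simp: hom_def isin_def\<close>)
qed

text \<open>
  Transposition is injective, and by \<open>chi_unique\<close> the transposes are determined by the
  elements that satisfy them.
\<close>

lemma power_ext:
  assumes "X \<in> hom E Y (pow_ob B)" "X' \<in> hom E Y (pow_ob B)" "B \<in> Ob E"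
    and "\<And>Z g b. g \<in> hom E Z Y \<Longrightarrow> b \<in> hom E Z B \<Longrightarrow> isin B b (X \<cdot> g) \<longleftrightarrow> isin B b (X' \<cdot> g)"
  shows "X = X'"
proof -
  have Y: "Y \<in> Ob E" using assms(1) hom_Ob by blast
  note tp = assms(1,2)[unfolded hom_def, simplified]
  have *: "power_ev B \<cdot> pairing E (V \<cdot> pr1 E Y B) (pr2 E Y B) \<in> hom E (prd E Y B) Omega"
    if "V \<in> hom E Y (pow_ob B)" for V
    using that assms(3) Y by (auto simp: hom_def)
  have "power_ev B \<cdot> pairing E (X \<cdot> pr1 E Y B) (pr2 E Y B) = power_ev B \<cdot> pairing E (X' \<cdot> pr1 E Y B) (pr2 E Y B)"
  proof (rule chi_unique)
    fix h assume h: "h \<in> into (prd E Y B)"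
    then have "pr1 E Y B \<cdot> h \<in> hom E (Dom E h) Y" "pr2 E Y B \<cdot> h \<in> hom E (Dom E h) B"
      using Y assms(3) by (auto simp: hom_def)
    from assms(4)[OF this]
    show "(power_ev B \<cdot> pairing E (X \<cdot> pr1 E Y B) (pr2 E Y B)) \<cdot> h = true_at (Dom E h) \<longleftrightarrow>
        (power_ev B \<cdot> pairing E (X' \<cdot> pr1 E Y B) (pr2 E Y B)) \<cdot> h = true_at (Dom E h)"
      using h Y assms(3) tp by (simp add: isin_def)
  qed (use * assms in blast)+
  moreover have "\<exists>!k. k \<in> hom E Y (pow_ob B) \<and> power_ev B \<cdot> pairing E (k \<cdot> pr1 E Y B) (pr2 E Y B)
      = power_ev B \<cdot> pairing E (X \<cdot> pr1 E Y B) (pr2 E Y B)"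
    using power_exponential[OF assms(3)] Y *[OF assms(1)] unfolding is_exponential_def by blast
  ultimately show ?thesis
    using assms(1,2) by (auto elim: ex1E)
qed

lemma power_comprehension:
  assumes "definable (prd E Y B) P" "Y \<in> Ob E" "B \<in> Ob E"
  obtains X where "X \<in> hom E Y (pow_ob B)"
    "\<And>Z g b. g \<in> hom E Z Y \<Longrightarrow> b \<in> hom E Z B \<Longrightarrow> isin B b (X \<cdot> g) \<longleftrightarrow> P (pairing E g b)"
proof -
  from assms(1) obtain \<chi> where "classifies \<chi> (prd E Y B) P"
    unfolding definable_def by blast
  note \<chi> = classifiesD[OF this]
  have "\<chi> \<in> hom E (prd E Y B) Omega" using \<chi> by (simp add: hom_def)
  then obtain X where X: "X \<in> hom E Y (pow_ob B)" "power_ev B \<cdot> pairing E (X \<cdot> pr1 E Y B) (pr2 E Y B) = \<chi>"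
    using power_exponential[OF assms(3)] assms(2) unfolding is_exponential_def by blast
  have "isin B b (X \<cdot> g) \<longleftrightarrow> P (pairing E g b)" if "g \<in> hom E Z Y" "b \<in> hom E Z B" for Z g b
  proof -
    have "\<chi> \<cdot> pairing E g b = power_ev B \<cdot> pairing E (X \<cdot> g) b"
      unfolding X(2)[symmetric] using that X(1) assms(2,3) by (simp add: hom_def)
    then show ?thesis
      using that assms(2,3) \<chi>(5)[of "pairing E g b"] by (simp add: isin_def hom_def)
  qed
  with X(1) show thesis by (rule that)
qed

text \<open>
  Comprehension turns \<open>P\<close> and \<open>P \<and> Q\<close> into maps \<open>X, X' : A \<rightarrow> P(B)\<close>, and by extensionality the
  quantified implication holds of \<open>h\<close> iff \<open>X \<cdot> h = X' \<cdot> h\<close>.  The quantifier is combined with an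
  implication because one passage to a later stage serves both.
\<close>

lemma definable_all_imp:
  assumes "definable (prd E A B) P" "definable (prd E A B) Q" "A \<in> Ob E" "B \<in> Ob E"
  shows "definable A (\<lambda>h. \<forall>g \<in> into (Dom E h). \<forall>b \<in> hom E (Dom E g) B.
    P (pairing E (h \<cdot> g) b) \<longrightarrow> Q (pairing E (h \<cdot> g) b))"
proof -
  obtain X where X: "X \<in> hom E A (pow_ob B)"
    "\<And>Z g b. g \<in> hom E Z A \<Longrightarrow> b \<in> hom E Z B \<Longrightarrow> isin B b (X \<cdot> g) \<longleftrightarrow> P (pairing E g b)"
    using power_comprehension[OF assms(1,3,4)] by blast
  obtain X' where X': "X' \<in> hom E A (pow_ob B)"
    "\<And>Z g b. g \<in> hom E Z A \<Longrightarrow> b \<in> hom E Z B \<Longrightarrow> isin B b (X' \<cdot> g) \<longleftrightarrow>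
      P (pairing E g b) \<and> Q (pairing E g b)"
    using power_comprehension[OF definable_conj[OF assms(1,2)] assms(3,4)] by blast
  from definable_eq[OF X(1) X'(1)] show ?thesis
  proof (rule definable_cong)
    fix h assume h: "h \<in> Ar E" "Cod E h = A"
    have *: "(isin B b ((X \<cdot> h) \<cdot> g) \<longleftrightarrow> P (pairing E (h \<cdot> g) b)) \<and>
       (isin B b ((X' \<cdot> h) \<cdot> g) \<longleftrightarrow> P (pairing E (h \<cdot> g) b) \<and> Q (pairing E (h \<cdot> g) b))"
      if "g \<in> hom E Z (Dom E h)" "b \<in> hom E Z B" for Z g b
      using X(1) X'(1) X(2)[of "h \<cdot> g" Z b] X'(2)[of "h \<cdot> g" Z b] h that by (auto simp: hom_def)
    have "X \<cdot> h \<in> hom E (Dom E h) (pow_ob B)" "X' \<cdot> h \<in> hom E (Dom E h) (pow_ob B)"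
      using X(1) X'(1) h by (auto simp: hom_def)
    note homs = this
    have "X \<cdot> h = X' \<cdot> h \<longleftrightarrow> (\<forall>Z. \<forall>g \<in> hom E Z (Dom E h). \<forall>b \<in> hom E Z B.
        isin B b ((X \<cdot> h) \<cdot> g) \<longleftrightarrow> isin B b ((X' \<cdot> h) \<cdot> g))"
      by (rule iffI, simp, rule power_ext[OF homs assms(4)]) blast
    also have "\<dots> \<longleftrightarrow> (\<forall>Z. \<forall>g \<in> hom E Z (Dom E h). \<forall>b \<in> hom E Z B.
        P (pairing E (h \<cdot> g) b) \<longrightarrow> Q (pairing E (h \<cdot> g) b))"
      using * by (intro all_cong1 ball_cong refl) blast
    also have "\<dots> \<longleftrightarrow> (\<forall>g \<in> into (Dom E h). \<forall>b \<in> hom E (Dom E g) B.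
        P (pairing E (h \<cdot> g) b) \<longrightarrow> Q (pairing E (h \<cdot> g) b))"
      by (auto simp: hom_def)
    finally show "X \<cdot> h = X' \<cdot> h \<longleftrightarrow> (\<forall>g \<in> into (Dom E h). \<forall>b \<in> hom E (Dom E g) B.
        P (pairing E (h \<cdot> g) b) \<longrightarrow> Q (pairing E (h \<cdot> g) b))" .
  qed
qed

text \<open>
  This form of quantification over truth values underlies the second-order encodings of
  falsity, disjunction and existence.
\<close>

lemma definable_all_omega:
  assumes "definable (prd E A Omega) P" "A \<in> Ob E"
  shows "definable A (\<lambda>h. \<forall>g \<in> into (Dom E h). \<forall>w \<in> hom E (Dom E g) Omega.
    P (pairing E (h \<cdot> g) w) \<longrightarrow> w = true_at (Dom E g))"
proof -
  have "definable (prd E A Omega) (\<lambda>h. pr2 E A Omega \<cdot> h = true_at (Dom E h))"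
    using assms by (intro definable_classified) (simp add: hom_def)
  from definable_all_imp[OF assms(1) this assms(2) Omega_Ob] show ?thesis
    by (rule definable_cong) (use assms in \<open>auto simp: hom_def\<close>)
qed

section \<open>The operations on subobjects in terms of elements\<close>

definition memb :: "'m \<Rightarrow> 'm set \<Rightarrow> bool" (infix "\<in>\<^sub>E" 50) where
  "h \<in>\<^sub>E U \<longleftrightarrow> (\<exists>m \<in> U. factors E h m)"

lemma factors_trans:
  assumes "factors E h m" "factors E m n" "m \<in> Ar E" "n \<in> Ar E"
  shows "factors E h n"
proof -
  obtain k l where "k \<in> Ar E" "Dom E k = Dom E h" "Cod E k = Dom E m" "m \<cdot> k = h"
    "l \<in> Ar E" "Dom E l = Dom E m" "Cod E l = Dom E n" "n \<cdot> l = m"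
    using assms by (auto simp: factors_iff)
  then show ?thesis
    using assms(3,4) unfolding factors_iff[OF assms(4)]
    by (intro bexI[of _ "l \<cdot> k"]) (auto simp flip: comp_assoc)
qed

lemma factors_refl: "m \<in> Ar E \<Longrightarrow> factors E m m"
  by (auto simp: factors_iff intro!: bexI[of _ "Idm E (Dom E m)"])

lemma sub_class_Sub: "is_mono E m \<Longrightarrow> sub_class E m \<in> Sub E (Cod E m)"
  by (auto simp: Sub_def)

lemma memb_sub_class:
  assumes "is_mono E m"
  shows "h \<in>\<^sub>E sub_class E m \<longleftrightarrow> factors E h m"
proof -
  have "m \<in> sub_class E m"
    using assms factors_refl mono_Ar by (simp add: sub_class_def)
  then show ?thesis
    unfolding memb_def sub_class_def using factors_trans mono_Ar assms by blast
qed

lemma SubE: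
  assumes "U \<in> Sub E A"
  obtains m where "is_mono E m" "Cod E m = A" "U = sub_class E m" "\<forall>h. h \<in>\<^sub>E U \<longleftrightarrow> factors E h m"
  using assms memb_sub_class by (auto simp: Sub_def)

lemma Sub_member:
  assumes "U \<in> Sub E A" "n \<in> U"
  shows "is_mono E n \<and> Cod E n = A \<and> (\<forall>h. h \<in>\<^sub>E U \<longleftrightarrow> factors E h n)"
proof -
  obtain m where m: "is_mono E m" "Cod E m = A" "U = sub_class E m" "\<forall>h. h \<in>\<^sub>E U \<longleftrightarrow> factors E h m"
    using assms(1) by (blast elim: SubE)
  then show ?thesis
    using assms(2) factors_trans mono_Ar unfolding sub_class_def by blast
qed

lemma Sub_Ob: "U \<in> Sub E A \<Longrightarrow> A \<in> Ob E"
  by (auto simp: Sub_def dest: mono_Ar)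

lemma Sub_definable: "U \<in> Sub E A \<Longrightarrow> definable A (\<lambda>h. h \<in>\<^sub>E U)"
  using definable_factors by (elim SubE) auto

lemma definable_Sub:
  assumes "definable A P"
  obtains U where "U \<in> Sub E A" "\<And>h. h \<in> into A \<Longrightarrow> h \<in>\<^sub>E U \<longleftrightarrow> P h"
proof -
  obtain \<chi> where \<chi>: "\<chi> \<in> hom E A Omega" "\<forall>h \<in> into A. P h \<longleftrightarrow> \<chi> \<cdot> h = true_at (Dom E h)"
    using assms unfolding definable_def classifies_def by blast
  then obtain m where m: "is_mono E m" "Cod E m = A" "\<forall>h \<in> into A. factors E h m \<longleftrightarrow> \<chi> \<cdot> h = true_at (Dom E h)"
    using chi_mono by blast
  show thesis
    by (rule that[of "sub_class E m"])
      (use m \<chi> sub_class_Sub[of m] memb_sub_class[of m] in auto)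
qed

lemma sub_le_iff:
  assumes "U \<in> Sub E A" "V \<in> Sub E A"
  shows "sub_le E U V \<longleftrightarrow> (\<forall>h \<in> into A. h \<in>\<^sub>E U \<longrightarrow> h \<in>\<^sub>E V)"
proof -
  obtain m where m: "is_mono E m" "Cod E m = A" "U = sub_class E m" "\<forall>h. h \<in>\<^sub>E U \<longleftrightarrow> factors E h m"
    using assms(1) by (blast elim: SubE)
  have "m \<in> U"
    using m factors_refl mono_Ar by (simp add: sub_class_def)
  show ?thesis
  proof
    assume "sub_le E U V"
    then obtain a b where ab: "a \<in> U" "b \<in> V" "factors E a b"
      unfolding sub_le_def by blast
    then show "\<forall>h \<in> into A. h \<in>\<^sub>E U \<longrightarrow> h \<in>\<^sub>E V"
      using Sub_member[OF assms(1) ab(1)] Sub_member[OF assms(2) ab(2)] factors_trans mono_Ar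
      by blast
  next
    assume "\<forall>h \<in> into A. h \<in>\<^sub>E U \<longrightarrow> h \<in>\<^sub>E V"
    then have "m \<in>\<^sub>E V"
      using m factors_refl mono_Ar by simp
    then show "sub_le E U V"
      unfolding sub_le_def memb_def using \<open>m \<in> U\<close> by blast
  qed
qed

lemma Sub_eqI:
  assumes "U \<in> Sub E A" "V \<in> Sub E A" "\<And>h. h \<in> into A \<Longrightarrow> h \<in>\<^sub>E U \<longleftrightarrow> h \<in>\<^sub>E V"
  shows "U = V"
proof -
  have *: "n \<in> V" if asm: "U \<in> Sub E A" "V \<in> Sub E A" "\<And>h. h \<in> into A \<Longrightarrow> h \<in>\<^sub>E U \<longleftrightarrow> h \<in>\<^sub>E V" "n \<in> U"
    for U V n
  proof -
    obtain m where m: "is_mono E m" "Cod E m = A" "V = sub_class E m" "\<forall>h. h \<in>\<^sub>E V \<longleftrightarrow> factors E h m"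
      using asm(2) by (blast elim: SubE)
    have n: "is_mono E n" "Cod E n = A" "\<And>h. h \<in>\<^sub>E U \<longleftrightarrow> factors E h n"
      using Sub_member[OF asm(1,4)] by auto
    have "factors E m n" "factors E n m"
      using m n asm(3)[of m] asm(3)[of n] factors_refl mono_Ar by auto
    then show "n \<in> V"
      using m n by (simp add: sub_class_def)
  qed
  show ?thesis
    using *[of U V] *[of V U] assms by blast
qed

text \<open>
  The operations on subobjects are defined by universal properties in the order of subobjects.
  To compute one of them, it is enough to find a definable predicate with the same property; this
  lemma and the next return the subobject from it.
\<close>

lemma greatest_sub_props:
  assumes "definable A Q" "\<And>V. V \<in> Sub E A \<Longrightarrow> P V \<longleftrightarrow> (\<forall>h \<in> into A. h \<in>\<^sub>E V \<longrightarrow> Q h)"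
  shows "greatest_sub E A P \<in> Sub E A"
    and "h \<in> Ar E \<Longrightarrow> Cod E h = A \<Longrightarrow> h \<in>\<^sub>E greatest_sub E A P \<longleftrightarrow> Q h"
proof -
  obtain U where U: "U \<in> Sub E A" "\<And>h. h \<in> into A \<Longrightarrow> h \<in>\<^sub>E U \<longleftrightarrow> Q h"
    using definable_Sub[OF assms(1)] by blast
  have "greatest_sub E A P = U"
    unfolding greatest_sub_def
  proof (rule the_equality)
    show UU: "U \<in> Sub E A \<and> P U \<and> (\<forall>V\<in>Sub E A. P V \<longrightarrow> sub_le E V U)"
      using U assms(2) by (simp add: sub_le_iff[of _ A])
    fix V assume V: "V \<in> Sub E A \<and> P V \<and> (\<forall>W\<in>Sub E A. P W \<longrightarrow> sub_le E W V)"
    show "V = U"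
      by (rule Sub_eqI[of _ A]) (use UU V sub_le_iff in blast)+
  qed
  with U show "greatest_sub E A P \<in> Sub E A"
    "h \<in> Ar E \<Longrightarrow> Cod E h = A \<Longrightarrow> h \<in>\<^sub>E greatest_sub E A P \<longleftrightarrow> Q h"
    by simp_all
qed

lemma least_sub_props:
  assumes "definable A Q" "\<And>V. V \<in> Sub E A \<Longrightarrow> P V \<longleftrightarrow> (\<forall>h \<in> into A. Q h \<longrightarrow> h \<in>\<^sub>E V)"
  shows "least_sub E A P \<in> Sub E A"
    and "h \<in> Ar E \<Longrightarrow> Cod E h = A \<Longrightarrow> h \<in>\<^sub>E least_sub E A P \<longleftrightarrow> Q h"
proof -
  obtain U where U: "U \<in> Sub E A" "\<And>h. h \<in> into A \<Longrightarrow> h \<in>\<^sub>E U \<longleftrightarrow> Q h"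
    using definable_Sub[OF assms(1)] by blast
  have "least_sub E A P = U"
    unfolding least_sub_def
  proof (rule the_equality)
    show UU: "U \<in> Sub E A \<and> P U \<and> (\<forall>V\<in>Sub E A. P V \<longrightarrow> sub_le E U V)"
      using U assms(2) by (simp add: sub_le_iff[of _ A])
    fix V assume V: "V \<in> Sub E A \<and> P V \<and> (\<forall>W\<in>Sub E A. P W \<longrightarrow> sub_le E V W)"
    show "V = U"
      by (rule Sub_eqI[of _ A]) (use UU V sub_le_iff in blast)+
  qed
  with U show "least_sub E A P \<in> Sub E A"
    "h \<in> Ar E \<Longrightarrow> Cod E h = A \<Longrightarrow> h \<in>\<^sub>E least_sub E A P \<longleftrightarrow> Q h"
    by simp_all
qed

lemma Sub_member_iff:
  assumes "V \<in> Sub E B"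
  shows "n \<in> V \<longleftrightarrow> is_mono E n \<and> Cod E n = B \<and> (\<forall>h \<in> into B. factors E h n \<longleftrightarrow> h \<in>\<^sub>E V)"
proof
  assume "n \<in> V"
  then show "is_mono E n \<and> Cod E n = B \<and> (\<forall>h \<in> into B. factors E h n \<longleftrightarrow> h \<in>\<^sub>E V)"
    using Sub_member[OF assms] by blast
next
  assume n: "is_mono E n \<and> Cod E n = B \<and> (\<forall>h \<in> into B. factors E h n \<longleftrightarrow> h \<in>\<^sub>E V)"
  obtain m where m: "is_mono E m" "Cod E m = B" "V = sub_class E m" "\<forall>h. h \<in>\<^sub>E V \<longleftrightarrow> factors E h m"
    using assms by (blast elim: SubE)
  have "factors E n m" "factors E m n"
    using m n factors_refl mono_Ar by auto
  then show "n \<in> V"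
    using m n by (simp add: sub_class_def)
qed

lemma memb_comp:
  assumes "U \<in> Sub E A" "h \<in>\<^sub>E U" "h \<in> Ar E" "Cod E h = A" "g \<in> Ar E" "Cod E g = Dom E h"
  shows "h \<cdot> g \<in>\<^sub>E U"
  using definable_persistent[OF Sub_definable[OF assms(1)]] assms by blast

text \<open>
  A monomorphism represents the predicate \<open>f \<cdot> h \<in> U\<close> iff it is a pullback along \<open>f\<close> of some member of \<open>U\<close>.
  Both directions are required, because the subobject is defined as the set of all these pullbacks.
\<close>

lemma sub_pullback_props:
  assumes f: "f \<in> hom E B A" and U: "U \<in> Sub E A"
  shows "sub_pullback E f U \<in> Sub E B"
    and "h \<in> Ar E \<Longrightarrow> Cod E h = B \<Longrightarrow> h \<in>\<^sub>E sub_pullback E f U \<longleftrightarrow> f \<cdot> h \<in>\<^sub>E U"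
proof -
  have f': "f \<in> Ar E" "Dom E f = B" "Cod E f = A"
    using f by (auto simp: hom_def)
  obtain V where V: "V \<in> Sub E B" "\<And>h. h \<in> into B \<Longrightarrow> h \<in>\<^sub>E V \<longleftrightarrow> f \<cdot> h \<in>\<^sub>E U"
    using definable_Sub[OF definable_comp[OF Sub_definable[OF U] f]] by blast
  have "sub_pullback E f U = V"
  proof (intro set_eqI iffI)
    fix n assume "n \<in> sub_pullback E f U"
    then obtain m u where m: "m \<in> U" and pb: "is_pullback E f m n u"
      unfolding sub_pullback_def by blast
    have m': "is_mono E m" "Cod E m = A" "\<And>h. h \<in>\<^sub>E U \<longleftrightarrow> factors E h m" "m \<in> Ar E"
      using Sub_member[OF U m] mono_Ar by auto
    have n: "n \<in> Ar E" "u \<in> Ar E" "Dom E n = Dom E u" "Cod E n = B" "Cod E u = Dom E m" "f \<cdot> n = m \<cdot> u"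
      and univ: "\<And>X h k. X \<in> Ob E \<Longrightarrow> h \<in> hom E X B \<Longrightarrow> k \<in> hom E X (Dom E m) \<Longrightarrow> f \<cdot> h = m \<cdot> k \<Longrightarrow>
        (\<exists>!v. v \<in> hom E X (Dom E n) \<and> n \<cdot> v = h \<and> u \<cdot> v = k)"
      using pb f' unfolding is_pullback_def by blast+
    have fn: "f \<cdot> n \<cdot> k = m \<cdot> u \<cdot> k" if "k \<in> Ar E" "Cod E k = Dom E n" for k
    proof -
      have "f \<cdot> n \<cdot> k = (f \<cdot> n) \<cdot> k" using that n(1-5) f' by simp
      also have "\<dots> = m \<cdot> u \<cdot> k" unfolding n(6) using that n(1-5) m' by simp
      finally show ?thesis .
    qed
    have "is_mono E n"
      unfolding is_mono_def
    proof (intro conjI ballI impI)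
      fix X k l assume kl: "X \<in> Ob E" "k \<in> hom E X (Dom E n)" "l \<in> hom E X (Dom E n)" "n \<cdot> k = n \<cdot> l"
      have tp: "k \<in> Ar E" "l \<in> Ar E" "Cod E k = Dom E n" "Cod E l = Dom E n" "Dom E k = X" "Dom E l = X"
        using kl by (auto simp: hom_def)
      have "m \<cdot> u \<cdot> k = m \<cdot> u \<cdot> l"
        using fn[of k] fn[of l] tp kl(4) by simp
      then have "u \<cdot> k = u \<cdot> l"
        by (rule mono_cancel[OF m'(1), rotated 4]) (use tp n in auto)
      moreover have "\<exists>!v. v \<in> hom E X (Dom E n) \<and> n \<cdot> v = n \<cdot> k \<and> u \<cdot> v = u \<cdot> k"
        by (rule univ) (use tp n(1-5) kl fn[of k] in \<open>auto simp: hom_def\<close>)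
      ultimately show "k = l"
        using kl by (auto elim: ex1E)
    qed (fact n)
    moreover have "factors E h n \<longleftrightarrow> h \<in>\<^sub>E V" if h: "h \<in> into B" for h
    proof -
      have "factors E h n \<longleftrightarrow> factors E (f \<cdot> h) m"
      proof
        assume "factors E h n"
        then obtain k where k: "k \<in> Ar E" "Dom E k = Dom E h" "Cod E k = Dom E n" "n \<cdot> k = h"
          using factors_iff[OF n(1)] by blast
        then show "factors E (f \<cdot> h) m"
          using factors_iff[OF m'(4)] fn[of k] n(1-5) f' h by (intro iffD2[OF factors_iff] bexI[of _ "u \<cdot> k"]) (auto simp: m'(4))
      next
        assume "factors E (f \<cdot> h) m"
        then obtain k where k: "k \<in> Ar E" "Dom E k = Dom E h" "Cod E k = Dom E m" "m \<cdot> k = f \<cdot> h"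
          using factors_iff[OF m'(4)] f' h by auto
        have "\<exists>!v. v \<in> hom E (Dom E h) (Dom E n) \<and> n \<cdot> v = h \<and> u \<cdot> v = k"
          by (rule univ) (use k h in \<open>auto simp: hom_def\<close>)
        then show "factors E h n"
          unfolding factors_def by blast
      qed
      then show ?thesis using V(2)[OF h] m'(3) by simp
    qed
    ultimately show "n \<in> V"
      using n by (simp add: Sub_member_iff[OF V(1)])
  next
    fix n assume "n \<in> V"
    then have n: "is_mono E n" "n \<in> Ar E" "Cod E n = B" "\<And>h. h \<in> into B \<Longrightarrow> factors E h n \<longleftrightarrow> h \<in>\<^sub>E V"
      using Sub_member_iff[OF V(1)] mono_Ar by auto
    obtain m where m: "is_mono E m" "Cod E m = A" "U = sub_class E m" "\<forall>h. h \<in>\<^sub>E U \<longleftrightarrow> factors E h m"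
      using U by (blast elim: SubE)
    have m': "m \<in> U" "m \<in> Ar E"
      using m factors_refl mono_Ar by (auto simp: sub_class_def)
    have "n \<in>\<^sub>E V" using n(4)[of n] n factors_refl by simp
    then have "factors E (f \<cdot> n) m"
      using V(2)[of n] n m(4) by simp
    then obtain u where u: "u \<in> Ar E" "Dom E u = Dom E n" "Cod E u = Dom E m" "m \<cdot> u = f \<cdot> n"
      using factors_iff[OF m'(2)] n(2,3) f' by auto
    have mu: "m \<cdot> u \<cdot> v = f \<cdot> n \<cdot> v" if "v \<in> Ar E" "Cod E v = Dom E n" for v
    proof -
      have "m \<cdot> u \<cdot> v = (m \<cdot> u) \<cdot> v" using u(1-3) m' that by simp
      also have "\<dots> = f \<cdot> n \<cdot> v" unfolding u(4) using n(2,3) f' that by simp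
      finally show ?thesis .
    qed
    have "is_pullback E f m n u"
      unfolding is_pullback_def
    proof (intro conjI ballI impI)
      fix X h k assume hk: "X \<in> Ob E" "h \<in> hom E X (Dom E f)" "k \<in> hom E X (Dom E m)" "f \<cdot> h = m \<cdot> k"
      have tp: "h \<in> Ar E" "k \<in> Ar E" "Cod E h = B" "Cod E k = Dom E m" "Dom E k = X" "Dom E h = X"
        using hk f' by (auto simp: hom_def)
      have "factors E (f \<cdot> h) m"
        unfolding hk(4) using tp m' by (auto simp: factors_iff intro!: bexI[of _ k])
      then have "factors E h n"
        using V(2)[of h] m(4) n(4)[of h] tp by simp
      then obtain v where v: "v \<in> Ar E" "Dom E v = Dom E h" "Cod E v = Dom E n" "n \<cdot> v = h"
        using factors_iff[OF n(2)] by auto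
      have "m \<cdot> u \<cdot> v = m \<cdot> k"
        using mu[of v] v hk(4) by simp
      then have "u \<cdot> v = k"
        by (rule mono_cancel[OF m(1), rotated 4]) (use tp u v in auto)
      with v tp show "\<exists>!v. v \<in> hom E X (Dom E n) \<and> n \<cdot> v = h \<and> u \<cdot> v = k"
        using mono_cancel[OF n(1)] by (intro ex1I[of _ v]) (auto simp: hom_def)
    qed (use f' m m' n u in auto)
    then show "n \<in> sub_pullback E f U"
      unfolding sub_pullback_def using m' by blast
  qed
  with V show "sub_pullback E f U \<in> Sub E B"
    "h \<in> Ar E \<Longrightarrow> Cod E h = B \<Longrightarrow> h \<in>\<^sub>E sub_pullback E f U \<longleftrightarrow> f \<cdot> h \<in>\<^sub>E U"
    by simp_all
qed

lemma sub_equalizer_props: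
  assumes f: "f \<in> hom E A B" and g: "g \<in> hom E A B"
  shows "sub_equalizer E f g \<in> Sub E A"
    and "h \<in> Ar E \<Longrightarrow> Cod E h = A \<Longrightarrow> h \<in>\<^sub>E sub_equalizer E f g \<longleftrightarrow> f \<cdot> h = g \<cdot> h"
proof -
  have tp: "f \<in> Ar E" "Dom E f = A" "Cod E f = B" "g \<in> Ar E" "Dom E g = A" "Cod E g = B"
    using f g by (auto simp: hom_def)
  obtain V where V: "V \<in> Sub E A" "\<And>h. h \<in> into A \<Longrightarrow> h \<in>\<^sub>E V \<longleftrightarrow> f \<cdot> h = g \<cdot> h"
    using definable_Sub[OF definable_eq[OF f g]] by blast
  have "sub_equalizer E f g = V"
  proof (intro set_eqI iffI)
    fix e assume "e \<in> sub_equalizer E f g"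
    then have "is_equalizer E f g e" by (simp add: sub_equalizer_def)
    from equalizer_mono[OF this f g] V(2) show "e \<in> V"
      by (simp add: Sub_member_iff[OF V(1)])
  next
    fix e assume "e \<in> V"
    then have e: "is_mono E e" "e \<in> Ar E" "Cod E e = A" "\<And>h. h \<in> into A \<Longrightarrow> factors E h e \<longleftrightarrow> f \<cdot> h = g \<cdot> h"
      using Sub_member_iff[OF V(1)] mono_Ar V(2) by auto
    have "is_equalizer E f g e"
      unfolding is_equalizer_def
    proof (intro conjI ballI impI)
      show "f \<cdot> e = g \<cdot> e" using e(4)[of e] e factors_refl by simp
      fix X h assume h: "X \<in> Ob E" "h \<in> hom E X (Dom E f)" "f \<cdot> h = g \<cdot> h"
      then have "factors E h e"
        using e(4)[of h] tp by (auto simp: hom_def)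
      then obtain k where "k \<in> Ar E" "Dom E k = Dom E h" "Cod E k = Dom E e" "e \<cdot> k = h"
        using factors_iff[OF e(2)] by auto
      then show "\<exists>!k. k \<in> hom E X (Dom E e) \<and> e \<cdot> k = h"
        using h mono_cancel[OF e(1)] by (intro ex1I[of _ k]) (auto simp: hom_def)
    qed (use e tp in auto)
    then show "e \<in> sub_equalizer E f g"
      by (simp add: sub_equalizer_def)
  qed
  with V show "sub_equalizer E f g \<in> Sub E A"
    "h \<in> Ar E \<Longrightarrow> Cod E h = A \<Longrightarrow> h \<in>\<^sub>E sub_equalizer E f g \<longleftrightarrow> f \<cdot> h = g \<cdot> h"
    by simp_all
qed

lemma sub_top_props:
  assumes "A \<in> Ob E"
  shows "sub_top E A \<in> Sub E A"
    and "h \<in> Ar E \<Longrightarrow> Cod E h = A \<Longrightarrow> h \<in>\<^sub>E sub_top E A"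
  unfolding sub_top_def using greatest_sub_props[OF definable_True[OF assms], of "\<lambda>_. True"]
  by blast+

lemma sub_meet_props:
  assumes "U \<in> Sub E A" "V \<in> Sub E A"
  shows "sub_meet E A U V \<in> Sub E A"
    and "h \<in> Ar E \<Longrightarrow> Cod E h = A \<Longrightarrow> h \<in>\<^sub>E sub_meet E A U V \<longleftrightarrow> h \<in>\<^sub>E U \<and> h \<in>\<^sub>E V"
proof -
  have *: "(sub_le E W U \<and> sub_le E W V) \<longleftrightarrow> (\<forall>h \<in> into A. h \<in>\<^sub>E W \<longrightarrow> h \<in>\<^sub>E U \<and> h \<in>\<^sub>E V)"
    if "W \<in> Sub E A" for W
    using that assms by (auto simp: sub_le_iff[of _ A])
  show "sub_meet E A U V \<in> Sub E A"
    "h \<in> Ar E \<Longrightarrow> Cod E h = A \<Longrightarrow> h \<in>\<^sub>E sub_meet E A U V \<longleftrightarrow> h \<in>\<^sub>E U \<and> h \<in>\<^sub>E V"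
    unfolding sub_meet_def
    using greatest_sub_props[OF definable_conj[OF assms[THEN Sub_definable]] *] by blast+
qed

lemma sub_imp_props:
  assumes "U \<in> Sub E A" "V \<in> Sub E A"
  shows "sub_imp E A U V \<in> Sub E A"
    and "h \<in> Ar E \<Longrightarrow> Cod E h = A \<Longrightarrow> h \<in>\<^sub>E sub_imp E A U V \<longleftrightarrow>
      (\<forall>g \<in> into (Dom E h). h \<cdot> g \<in>\<^sub>E U \<longrightarrow> h \<cdot> g \<in>\<^sub>E V)"
proof -
  have *: "sub_le E (sub_meet E A W U) V \<longleftrightarrow>
      (\<forall>h \<in> into A. h \<in>\<^sub>E W \<longrightarrow> (\<forall>g \<in> into (Dom E h). h \<cdot> g \<in>\<^sub>E U \<longrightarrow> h \<cdot> g \<in>\<^sub>E V))"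
    if W: "W \<in> Sub E A" for W
  proof -
    have "sub_le E (sub_meet E A W U) V \<longleftrightarrow> (\<forall>h \<in> into A. h \<in>\<^sub>E W \<longrightarrow> h \<in>\<^sub>E U \<longrightarrow> h \<in>\<^sub>E V)"
      using W assms by (auto simp: sub_le_iff[OF sub_meet_props(1)] sub_meet_props(2))
    also have "\<dots> \<longleftrightarrow> (\<forall>h \<in> into A. h \<in>\<^sub>E W \<longrightarrow> (\<forall>g \<in> into (Dom E h). h \<cdot> g \<in>\<^sub>E U \<longrightarrow> h \<cdot> g \<in>\<^sub>E V))"
    proof (intro iffI ballI impI)
      fix h g assume L: "\<forall>h \<in> into A. h \<in>\<^sub>E W \<longrightarrow> h \<in>\<^sub>E U \<longrightarrow> h \<in>\<^sub>E V"
        and "h \<in> into A" "h \<in>\<^sub>E W" "g \<in> into (Dom E h)" "h \<cdot> g \<in>\<^sub>E U"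
      then show "h \<cdot> g \<in>\<^sub>E V"
        using memb_comp[OF W, of h g] by auto
    next
      fix h assume R: "\<forall>h \<in> into A. h \<in>\<^sub>E W \<longrightarrow> (\<forall>g \<in> into (Dom E h). h \<cdot> g \<in>\<^sub>E U \<longrightarrow> h \<cdot> g \<in>\<^sub>E V)"
        and h: "h \<in> into A" "h \<in>\<^sub>E W" "h \<in>\<^sub>E U"
      then have "h \<cdot> Idm E (Dom E h) \<in>\<^sub>E U \<longrightarrow> h \<cdot> Idm E (Dom E h) \<in>\<^sub>E V"
        by (auto simp del: comp_Idm)
      with h show "h \<in>\<^sub>E V" by simp
    qed
    finally show ?thesis .
  qed
  show "sub_imp E A U V \<in> Sub E A"
    "h \<in> Ar E \<Longrightarrow> Cod E h = A \<Longrightarrow> h \<in>\<^sub>E sub_imp E A U V \<longleftrightarrow>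
      (\<forall>g \<in> into (Dom E h). h \<cdot> g \<in>\<^sub>E U \<longrightarrow> h \<cdot> g \<in>\<^sub>E V)"
    unfolding sub_imp_def
    using greatest_sub_props[OF definable_imp[OF assms[THEN Sub_definable]] *] by blast+
qed

lemma sub_forall_props:
  assumes f: "f \<in> hom E B A" and U: "U \<in> Sub E B"
  shows "sub_forall E f U \<in> Sub E A"
    and "h \<in> Ar E \<Longrightarrow> Cod E h = A \<Longrightarrow> h \<in>\<^sub>E sub_forall E f U \<longleftrightarrow>
      (\<forall>g \<in> into (Dom E h). \<forall>b \<in> hom E (Dom E g) B. f \<cdot> b = h \<cdot> g \<longrightarrow> b \<in>\<^sub>E U)"
proof -
  have f': "f \<in> Ar E" "Dom E f = B" "Cod E f = A"
    using f by (auto simp: hom_def)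
  have Ob: "A \<in> Ob E" "B \<in> Ob E" using f hom_Ob by blast+
  let ?Q = "\<lambda>h. \<forall>g \<in> into (Dom E h). \<forall>b \<in> hom E (Dom E g) B. f \<cdot> b = h \<cdot> g \<longrightarrow> b \<in>\<^sub>E U"
  have 1: "definable (prd E A B) (\<lambda>p. (f \<cdot> pr2 E A B) \<cdot> p = pr1 E A B \<cdot> p)"
    by (rule definable_eq[of _ _ A]) (use f' Ob in \<open>auto simp: hom_def\<close>)
  have 2: "definable (prd E A B) (\<lambda>p. pr2 E A B \<cdot> p \<in>\<^sub>E U)"
    by (rule definable_comp[OF Sub_definable[OF U]]) (use f' Ob in \<open>auto simp: hom_def\<close>)
  have def: "definable A ?Q"
    using definable_all_imp[OF 1 2 Ob]
    by (rule definable_cong) (use f' Ob in \<open>auto simp: hom_def\<close>)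
  have *: "sub_le E (sub_pullback E f V) U \<longleftrightarrow> (\<forall>h \<in> into A. h \<in>\<^sub>E V \<longrightarrow> ?Q h)" if V: "V \<in> Sub E A" for V
  proof -
    have "sub_le E (sub_pullback E f V) U \<longleftrightarrow> (\<forall>b \<in> into B. f \<cdot> b \<in>\<^sub>E V \<longrightarrow> b \<in>\<^sub>E U)"
      by (auto simp: sub_le_iff[OF sub_pullback_props(1)[OF f V] U] sub_pullback_props(2)[OF f V])
    also have "\<dots> \<longleftrightarrow> (\<forall>h \<in> into A. h \<in>\<^sub>E V \<longrightarrow> ?Q h)"
    proof (intro iffI ballI impI)
      fix h g b assume L: "\<forall>b \<in> into B. f \<cdot> b \<in>\<^sub>E V \<longrightarrow> b \<in>\<^sub>E U"
        and "h \<in> into A" "h \<in>\<^sub>E V" "g \<in> into (Dom E h)" "b \<in> hom E (Dom E g) B" "f \<cdot> b = h \<cdot> g"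
      then show "b \<in>\<^sub>E U"
        using memb_comp[OF V, of h g] by (auto simp: hom_def)
    next
      fix b assume R: "\<forall>h \<in> into A. h \<in>\<^sub>E V \<longrightarrow> ?Q h" and b: "b \<in> into B" "f \<cdot> b \<in>\<^sub>E V"
      moreover have "f \<cdot> b \<in> into A"
        using b f' by simp
      ultimately have "?Q (f \<cdot> b)"
        by blast
      from this[THEN bspec[of _ _ "Idm E (Dom E b)"], THEN bspec[of _ _ b]] show "b \<in>\<^sub>E U"
        using b f' by (simp add: hom_def)
    qed
    finally show ?thesis .
  qed
  show "sub_forall E f U \<in> Sub E A"
    "h \<in> Ar E \<Longrightarrow> Cod E h = A \<Longrightarrow> h \<in>\<^sub>E sub_forall E f U \<longleftrightarrow> ?Q h"
    unfolding sub_forall_def f'(3) using greatest_sub_props[OF def *] by blast+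
qed

text \<open>
  Falsity is the conjunction of all truth values.  It is below a subobject \<open>V\<close> because the truth value of
  \<open>h \<in> V\<close> is one of them; the same instance is used for disjunction and existence.
\<close>

lemma sub_bot_props:
  assumes "A \<in> Ob E"
  shows "sub_bot E A \<in> Sub E A"
    and "h \<in> Ar E \<Longrightarrow> Cod E h = A \<Longrightarrow> h \<in>\<^sub>E sub_bot E A \<longleftrightarrow>
      (\<forall>g \<in> into (Dom E h). \<forall>w \<in> hom E (Dom E g) Omega. w = true_at (Dom E g))"
proof -
  let ?Q = "\<lambda>h. \<forall>g \<in> into (Dom E h). \<forall>w \<in> hom E (Dom E g) Omega. w = true_at (Dom E g)"
  have def: "definable A ?Q"
    using definable_all_omega[OF definable_True] assms by simp
  have *: "True \<longleftrightarrow> (\<forall>h \<in> into A. ?Q h \<longrightarrow> h \<in>\<^sub>E V)" if V: "V \<in> Sub E A" for V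
  proof (intro iffI ballI impI TrueI)
    fix h assume h: "h \<in> into A" and Q: "?Q h"
    obtain \<chi> where "classifies \<chi> A (\<lambda>h. h \<in>\<^sub>E V)"
      using Sub_definable[OF V] unfolding definable_def by blast
    note \<chi> = classifiesD[OF this]
    have "\<chi> \<cdot> h = true_at (Dom E h)"
      using Q[THEN bspec[of _ _ "Idm E (Dom E h)"], THEN bspec[of _ _ "\<chi> \<cdot> h"]] h \<chi>(1-4) by (simp add: hom_def)
    then show "h \<in>\<^sub>E V" using \<chi>(5)[of h] h by simp
  qed
  show "sub_bot E A \<in> Sub E A"
    "h \<in> Ar E \<Longrightarrow> Cod E h = A \<Longrightarrow> h \<in>\<^sub>E sub_bot E A \<longleftrightarrow> ?Q h"
    unfolding sub_bot_def using least_sub_props[OF def *] by blast+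
qed

text \<open>
  The second-order encoding of disjunction: every truth value implied by both disjuncts is true.
\<close>

lemma sub_join_props:
  assumes U: "U \<in> Sub E A" and V: "V \<in> Sub E A"
  shows "sub_join E A U V \<in> Sub E A"
    and "h \<in> Ar E \<Longrightarrow> Cod E h = A \<Longrightarrow> h \<in>\<^sub>E sub_join E A U V \<longleftrightarrow>
      (\<forall>g \<in> into (Dom E h). \<forall>w \<in> hom E (Dom E g) Omega.
        (\<forall>k \<in> into (Dom E g). h \<cdot> g \<cdot> k \<in>\<^sub>E U \<or> h \<cdot> g \<cdot> k \<in>\<^sub>E V \<longrightarrow> w \<cdot> k = true_at (Dom E k)) \<longrightarrow>
        w = true_at (Dom E g))"
proof -
  have Ob: "A \<in> Ob E" using U Sub_Ob by blast
  let ?Q = "\<lambda>h. \<forall>g \<in> into (Dom E h). \<forall>w \<in> hom E (Dom E g) Omega.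
        (\<forall>k \<in> into (Dom E g). h \<cdot> g \<cdot> k \<in>\<^sub>E U \<or> h \<cdot> g \<cdot> k \<in>\<^sub>E V \<longrightarrow> w \<cdot> k = true_at (Dom E k)) \<longrightarrow>
        w = true_at (Dom E g)"
  let ?R = "\<lambda>W p. \<forall>k \<in> into (Dom E p). pr1 E A Omega \<cdot> p \<cdot> k \<in>\<^sub>E W \<longrightarrow> pr2 E A Omega \<cdot> p \<cdot> k = true_at (Dom E (p \<cdot> k))"
  have R: "definable (prd E A Omega) (?R W)" if "W \<in> Sub E A" for W
    by (rule definable_imp[OF definable_comp[OF Sub_definable[OF that]] definable_classified])
      (use Ob in \<open>auto simp: hom_def\<close>)
  have "definable A (\<lambda>h. \<forall>g \<in> into (Dom E h). \<forall>w \<in> hom E (Dom E g) Omega.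
      ?R U (pairing E (h \<cdot> g) w) \<and> ?R V (pairing E (h \<cdot> g) w) \<longrightarrow> w = true_at (Dom E g))"
    by (rule definable_all_omega[OF definable_conj[OF R[OF U] R[OF V]] Ob])
  then have def: "definable A ?Q"
  proof (rule definable_cong, intro ball_cong refl arg_cong2[where f = "(\<longrightarrow>)"])
    fix h g w assume tp: "h \<in> Ar E" "Cod E h = A" "g \<in> into (Dom E h)" "w \<in> hom E (Dom E g) Omega"
    have "?R W (pairing E (h \<cdot> g) w) \<longleftrightarrow> (\<forall>k \<in> into (Dom E g). h \<cdot> g \<cdot> k \<in>\<^sub>E W \<longrightarrow> w \<cdot> k = true_at (Dom E k))" for W
      using tp Ob by (simp add: hom_def)
    then show "(?R U (pairing E (h \<cdot> g) w) \<and> ?R V (pairing E (h \<cdot> g) w)) \<longleftrightarrow>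
       (\<forall>k \<in> into (Dom E g). h \<cdot> g \<cdot> k \<in>\<^sub>E U \<or> h \<cdot> g \<cdot> k \<in>\<^sub>E V \<longrightarrow> w \<cdot> k = true_at (Dom E k))"
      by blast
  qed
  have *: "(sub_le E U W \<and> sub_le E V W) \<longleftrightarrow> (\<forall>h \<in> into A. ?Q h \<longrightarrow> h \<in>\<^sub>E W)" if W: "W \<in> Sub E A" for W
  proof -
    obtain \<chi> where "classifies \<chi> A (\<lambda>h. h \<in>\<^sub>E W)"
      using Sub_definable[OF W] unfolding definable_def by blast
    note \<chi> = classifiesD[OF this]
    have "(sub_le E U W \<and> sub_le E V W) \<longleftrightarrow> (\<forall>h \<in> into A. h \<in>\<^sub>E U \<or> h \<in>\<^sub>E V \<longrightarrow> h \<in>\<^sub>E W)"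
      using U V W by (auto simp: sub_le_iff[of _ A])
    also have "\<dots> \<longleftrightarrow> (\<forall>h \<in> into A. ?Q h \<longrightarrow> h \<in>\<^sub>E W)"
    proof (intro iffI ballI impI)
      fix h assume L: "\<forall>h \<in> into A. h \<in>\<^sub>E U \<or> h \<in>\<^sub>E V \<longrightarrow> h \<in>\<^sub>E W" and h: "h \<in> into A" and Q: "?Q h"
      have "\<chi> \<cdot> h \<cdot> k = true_at (Dom E k)" if "h \<cdot> k \<in>\<^sub>E U \<or> h \<cdot> k \<in>\<^sub>E V" "k \<in> into (Dom E h)" for k
        using L[THEN bspec[of _ _ "h \<cdot> k"]] \<chi>(1-4) \<chi>(5)[of "h \<cdot> k"] h that by simp
      then have "\<chi> \<cdot> h = true_at (Dom E h)"
        using Q[THEN bspec[of _ _ "Idm E (Dom E h)"], THEN bspec[of _ _ "\<chi> \<cdot> h"]] h \<chi>(1-4)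
        by (simp add: hom_def)
      then show "h \<in>\<^sub>E W" using \<chi>(5)[of h] h by simp
    next
      fix h assume R: "\<forall>h \<in> into A. ?Q h \<longrightarrow> h \<in>\<^sub>E W" and h: "h \<in> into A" and UV: "h \<in>\<^sub>E U \<or> h \<in>\<^sub>E V"
      have "?Q h"
      proof (intro ballI impI)
        fix g w assume gw: "g \<in> into (Dom E h)" "w \<in> hom E (Dom E g) Omega"
          and *: "\<forall>k \<in> into (Dom E g). h \<cdot> g \<cdot> k \<in>\<^sub>E U \<or> h \<cdot> g \<cdot> k \<in>\<^sub>E V \<longrightarrow> w \<cdot> k = true_at (Dom E k)"
        have "h \<cdot> g \<in>\<^sub>E U \<or> h \<cdot> g \<in>\<^sub>E V"
          using UV memb_comp[OF U, of h g] memb_comp[OF V, of h g] h gw by auto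
        then show "w = true_at (Dom E g)"
          using *[THEN bspec[of _ _ "Idm E (Dom E g)"]] gw h by (auto simp: hom_def)
      qed
      with R h show "h \<in>\<^sub>E W" by blast
    qed
    finally show ?thesis .
  qed
  show "sub_join E A U V \<in> Sub E A"
    "h \<in> Ar E \<Longrightarrow> Cod E h = A \<Longrightarrow> h \<in>\<^sub>E sub_join E A U V \<longleftrightarrow> ?Q h"
    unfolding sub_join_def using least_sub_props[OF def *] by blast+
qed

text \<open>
  The second-order encoding of existence: every truth value implied by each instance is true.
\<close>

lemma sub_exists_props:
  assumes f: "f \<in> hom E B A" and U: "U \<in> Sub E B"
  shows "sub_exists E f U \<in> Sub E A"
    and "h \<in> Ar E \<Longrightarrow> Cod E h = A \<Longrightarrow> h \<in>\<^sub>E sub_exists E f U \<longleftrightarrow>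
      (\<forall>g \<in> into (Dom E h). \<forall>w \<in> hom E (Dom E g) Omega.
        (\<forall>k \<in> into (Dom E g). \<forall>b \<in> hom E (Dom E k) B.
          f \<cdot> b = h \<cdot> g \<cdot> k \<and> b \<in>\<^sub>E U \<longrightarrow> w \<cdot> k = true_at (Dom E k)) \<longrightarrow>
        w = true_at (Dom E g))"
proof -
  have f': "f \<in> Ar E" "Dom E f = B" "Cod E f = A"
    using f by (auto simp: hom_def)
  have Ob: "A \<in> Ob E" "B \<in> Ob E" using f hom_Ob by blast+
  let ?S = "\<lambda>h g w. \<forall>k \<in> into (Dom E g). \<forall>b \<in> hom E (Dom E k) B.
          f \<cdot> b = h \<cdot> g \<cdot> k \<and> b \<in>\<^sub>E U \<longrightarrow> w \<cdot> k = true_at (Dom E k)"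
  let ?Q = "\<lambda>h. \<forall>g \<in> into (Dom E h). \<forall>w \<in> hom E (Dom E g) Omega. ?S h g w \<longrightarrow> w = true_at (Dom E g)"
  let ?P = "prd E A Omega"
  let ?PB = "prd E ?P B"
  have 1: "definable ?PB (\<lambda>p. (f \<cdot> pr2 E ?P B) \<cdot> p = (pr1 E A Omega \<cdot> pr1 E ?P B) \<cdot> p)"
    by (rule definable_eq[of _ _ A]) (use f' Ob in \<open>auto simp: hom_def\<close>)
  have 2: "definable ?PB (\<lambda>p. pr2 E ?P B \<cdot> p \<in>\<^sub>E U)"
    by (rule definable_comp[OF Sub_definable[OF U]]) (use f' Ob in \<open>auto simp: hom_def\<close>)
  have 3: "definable ?PB (\<lambda>p. (pr2 E A Omega \<cdot> pr1 E ?P B) \<cdot> p = true_at (Dom E p))"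
    by (rule definable_classified) (use f' Ob in \<open>auto simp: hom_def\<close>)
  have PO: "?P \<in> Ob E" using Ob by simp
  have "definable ?P (\<lambda>h. \<forall>g \<in> into (Dom E h). \<forall>b \<in> hom E (Dom E g) B.
      f \<cdot> b = pr1 E A Omega \<cdot> h \<cdot> g \<and> b \<in>\<^sub>E U \<longrightarrow> pr2 E A Omega \<cdot> h \<cdot> g = true_at (Dom E g))"
    by (rule definable_cong[OF definable_all_imp[OF definable_conj[OF 1 2] 3 PO Ob(2)]])
      (use f' Ob in \<open>simp add: hom_def\<close>)
  from definable_all_omega[OF this Ob(1)] have def: "definable A ?Q"
    by (rule definable_cong) (use f' Ob in \<open>simp add: hom_def\<close>)
  have *: "sub_le E U (sub_pullback E f W) \<longleftrightarrow> (\<forall>h \<in> into A. ?Q h \<longrightarrow> h \<in>\<^sub>E W)" if W: "W \<in> Sub E A" for W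
  proof -
    obtain \<chi> where "classifies \<chi> A (\<lambda>h. h \<in>\<^sub>E W)"
      using Sub_definable[OF W] unfolding definable_def by blast
    note \<chi> = classifiesD[OF this]
    have "sub_le E U (sub_pullback E f W) \<longleftrightarrow> (\<forall>b \<in> into B. b \<in>\<^sub>E U \<longrightarrow> f \<cdot> b \<in>\<^sub>E W)"
      by (auto simp: sub_le_iff[OF U sub_pullback_props(1)[OF f W]] sub_pullback_props(2)[OF f W])
    also have "\<dots> \<longleftrightarrow> (\<forall>h \<in> into A. ?Q h \<longrightarrow> h \<in>\<^sub>E W)"
    proof (intro iffI ballI impI)
      fix h assume L: "\<forall>b \<in> into B. b \<in>\<^sub>E U \<longrightarrow> f \<cdot> b \<in>\<^sub>E W" and h: "h \<in> into A" and Q: "?Q h"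
      have "?S h (Idm E (Dom E h)) (\<chi> \<cdot> h)"
      proof (intro ballI impI)
        fix k b assume kb: "k \<in> into (Dom E (Idm E (Dom E h)))" "b \<in> hom E (Dom E k) B"
          "f \<cdot> b = h \<cdot> Idm E (Dom E h) \<cdot> k \<and> b \<in>\<^sub>E U"
        then have "h \<cdot> k \<in>\<^sub>E W"
          using L[THEN bspec[of _ _ b]] h by (auto simp: hom_def)
        then show "(\<chi> \<cdot> h) \<cdot> k = true_at (Dom E k)"
          using \<chi>(1-4) \<chi>(5)[of "h \<cdot> k"] kb h by simp
      qed
      then have "\<chi> \<cdot> h = true_at (Dom E h)"
        using Q[THEN bspec[of _ _ "Idm E (Dom E h)"], THEN bspec[of _ _ "\<chi> \<cdot> h"]] h \<chi>(1-4)
        by (simp add: hom_def)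
      then show "h \<in>\<^sub>E W" using \<chi>(5)[of h] h by simp
    next
      fix b assume R: "\<forall>h \<in> into A. ?Q h \<longrightarrow> h \<in>\<^sub>E W" and b: "b \<in> into B" and bU: "b \<in>\<^sub>E U"
      have "?Q (f \<cdot> b)"
      proof (intro ballI impI)
        fix g w assume gw: "g \<in> into (Dom E (f \<cdot> b))" "w \<in> hom E (Dom E g) Omega" and *: "?S (f \<cdot> b) g w"
        have "b \<cdot> g \<in>\<^sub>E U"
          using bU memb_comp[OF U, of b g] b gw f' by auto
        then show "w = true_at (Dom E g)"
          using *[THEN bspec[of _ _ "Idm E (Dom E g)"], THEN bspec[of _ _ "b \<cdot> g"]] gw b f'
          by (simp add: hom_def)
      qed
      with R b f' show "f \<cdot> b \<in>\<^sub>E W" by simp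
    qed
    finally show ?thesis .
  qed
  show "sub_exists E f U \<in> Sub E A"
    "h \<in> Ar E \<Longrightarrow> Cod E h = A \<Longrightarrow> h \<in>\<^sub>E sub_exists E f U \<longleftrightarrow> ?Q h"
    unfolding sub_exists_def f'(3) using least_sub_props[OF def *] by blast+
qed

section \<open>Forcing\<close>

text \<open>
  Environments are lists of elements of the carrier at a common stage, starting with the value of
  variable \<open>0\<close>.  They are the elements of a power of the carrier (\<open>env\<close>), with
  \<open>restr\<close> for the passage to a later stage.
\<close>

abbreviation restr :: "'m list \<Rightarrow> 'm \<Rightarrow> 'm list" where
  "restr es g \<equiv> map (\<lambda>e. e \<cdot> g) es"

definition env_in :: "'o \<Rightarrow> 'o \<Rightarrow> nat \<Rightarrow> 'm list \<Rightarrow> bool" where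
  "env_in A Y n es \<longleftrightarrow> A \<in> Ob E \<and> Y \<in> Ob E \<and> length es = n \<and> set es \<subseteq> hom E Y A"

definition env :: "'o \<Rightarrow> 'm list \<Rightarrow> 'm" where
  "env Y es = tuple E Y (rev es)"

lemma env_simps [simp]:
  "env Y [] = bang E Y"
  "env Y (e # es) = pairing E (env Y es) e"
  by (simp_all add: env_def tuple_def)

lemma tuple_env: "tuple E Y es = env Y (rev es)"
  by (simp add: env_def)

lemma env_in_Nil [simp]: "env_in A Y n [] \<longleftrightarrow> A \<in> Ob E \<and> Y \<in> Ob E \<and> n = 0"
  by (auto simp: env_in_def)

lemma env_in_Cons [simp]:
  "env_in A Y n (e # es) \<longleftrightarrow> e \<in> hom E Y A \<and> (\<exists>m. n = Suc m \<and> env_in A Y m es)"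
  by (auto simp: env_in_def)

lemma env_in_0: "env_in A Y 0 es \<longleftrightarrow> es = [] \<and> A \<in> Ob E \<and> Y \<in> Ob E"
  by (auto simp: env_in_def)

lemma env_in_Suc: "env_in A Y (Suc n) es \<longleftrightarrow> (\<exists>e es'. es = e # es' \<and> e \<in> hom E Y A \<and> env_in A Y n es')"
  by (cases es) auto

lemma env_in_rev [simp]: "env_in A Y n (rev es) \<longleftrightarrow> env_in A Y n es"
  by (simp add: env_in_def)

lemma env_in_nth: "env_in A Y n es \<Longrightarrow> i < n \<Longrightarrow> es ! i \<in> hom E Y A"
  by (auto simp: env_in_def)

lemma env_in_map:
  "env_in A Y n es \<Longrightarrow> B \<in> Ob E \<Longrightarrow> Z \<in> Ob E \<Longrightarrow> (\<And>e. e \<in> hom E Y A \<Longrightarrow> f e \<in> hom E Z B) \<Longrightarrow> env_in B Z n (map f es)"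
  by (auto simp: env_in_def)

lemma env_in_restr:
  assumes "env_in A Y n es" "g \<in> hom E Z Y"
  shows "env_in A Z n (restr es g)"
  using assms by (intro env_in_map[OF assms(1)]) (auto simp: env_in_def hom_def)

lemma restr_restr:
  assumes "env_in A Y n es" "g \<in> hom E Z Y" "k \<in> hom E V Z"
  shows "restr (restr es g) k = restr es (g \<cdot> k)"
  using assms by (auto simp: env_in_def hom_def)

lemma restr_Idm:
  assumes "env_in A Y n es"
  shows "restr es (Idm E Y) = es"
  using assms by (auto simp: env_in_def hom_def subset_iff intro: map_idI)

lemma obj_pow_Ob [simp]: "A \<in> Ob E \<Longrightarrow> obj_pow E A n \<in> Ob E"
  by (induction n) auto

lemma env_hom:
  assumes "env_in A Y n es"
  shows "env Y es \<in> hom E Y (obj_pow E A n)"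
  using assms by (induction es arbitrary: n) (auto simp: hom_def)

lemma env_Ar [simp]:
  assumes "env_in A Y n es"
  shows "env Y es \<in> Ar E" "Dom E (env Y es) = Y" "Cod E (env Y es) = obj_pow E A n"
  using env_hom[OF assms] by (auto simp: hom_def)

lemma env_restr:
  assumes "env_in A Y n es" "g \<in> hom E Z Y"
  shows "env Y es \<cdot> g = env Z (restr es g)"
  using assms
proof (induction es arbitrary: n)
  case (Cons e es)
  then obtain m where m: "env_in A Y m es" "e \<in> hom E Y A" by auto
  have "pairing E (env Y es) e \<cdot> g = pairing E (env Y es \<cdot> g) (e \<cdot> g)"
    by (rule pairing_comp) (use m Cons.prems env_Ar[OF m(1)] in \<open>auto simp: hom_def\<close>)
  with Cons.IH[OF m(1)] Cons.prems show ?case by simp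
qed (auto simp: hom_def)

lemma env_inject:
  assumes "env_in A Y n es" "env_in A Y n es'" "env Y es = env Y es'"
  shows "es = es'"
  using assms
proof (induction es arbitrary: n es')
  case Nil
  then show ?case by (simp add: env_in_0)
next
  case (Cons e es)
  then obtain m where m: "n = Suc m" "env_in A Y m es" "e \<in> hom E Y A" by auto
  then obtain e' es'' where e': "es' = e' # es''" "e' \<in> hom E Y A" "env_in A Y m es''"
    using Cons.prems(2) by (auto simp: env_in_Suc)
  have "env Y es = env Y es'' \<and> e = e'"
    using Cons.prems(3) e' m env_Ar[OF m(2)] env_Ar[OF e'(3)]
      pairing_eq_iff[of "env Y es" e "env Y es''" e'] by (simp add: hom_def)
  with Cons.IH[OF m(2) e'(3)] e' show ?case by simp
qed

lemma var_proj_hom: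
  assumes "A \<in> Ob E" "i < n"
  shows "var_proj E A n i \<in> hom E (obj_pow E A n) A"
  using assms(2)
proof (induction n arbitrary: i)
  case (Suc n)
  then show ?case using assms(1) by (cases i) (auto simp: hom_def)
qed simp

lemma var_proj_env:
  assumes "env_in A Y n es" "i < n"
  shows "var_proj E A n i \<cdot> env Y es = es ! i"
  using assms
proof (induction n arbitrary: i es)
  case (Suc n)
  then obtain e es' where es: "es = e # es'" "e \<in> hom E Y A" "env_in A Y n es'"
    by (auto simp: env_in_Suc)
  have A: "A \<in> Ob E" using es(3) by (simp add: env_in_def)
  show ?case
  proof (cases i)
    case 0
    then show ?thesis using es A env_Ar[OF es(3)] by (simp add: hom_def)
  next
    case (Suc j)
    then have "j < n" using Suc.prems by simp
    note vp = var_proj_hom[OF A this]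
    have "(var_proj E A n j \<cdot> pr1 E (obj_pow E A n) A) \<cdot> pairing E (env Y es') e = var_proj E A n j \<cdot> env Y es'"
      using es A env_Ar[OF es(3)] vp by (simp add: hom_def)
    then show ?thesis using Suc.IH[OF es(3) \<open>j < n\<close>] es Suc by simp
  qed
qed simp

fun tm_at :: "('o, 'm, 'f, 'r) struc \<Rightarrow> 'o \<Rightarrow> 'm list \<Rightarrow> 'f tm \<Rightarrow> 'm" where
  "tm_at M Y es (Var i) = es ! i"
| "tm_at M Y es (Fun f ts) = fun_int M f \<cdot> tuple E Y (map (tm_at M Y es) ts)"

text \<open>
  \<open>forces M \<phi> Y es\<close>: the formula is true at stage \<open>Y\<close> of the environment \<open>es\<close>.  Here \<open>w\<close> ranges over
  the truth values at later stages, and falsity, disjunction and existence have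
  their second-order encodings.
\<close>

primrec forces :: "('o, 'm, 'f, 'r) struc \<Rightarrow> ('f, 'r) fm \<Rightarrow> 'o \<Rightarrow> 'm list \<Rightarrow> bool" where
  "forces M (Equal t u) = (\<lambda>Y es. tm_at M Y es t = tm_at M Y es u)"
| "forces M (Rel r ts) = (\<lambda>Y es. tuple E Y (map (tm_at M Y es) ts) \<in>\<^sub>E rel_int M r)"
| "forces M Falsum = (\<lambda>Y es. \<forall>Z. \<forall>g \<in> hom E Z Y. \<forall>w \<in> hom E Z Omega. w = true_at Z)"
| "forces M (Conj \<phi> \<psi>) = (\<lambda>Y es. forces M \<phi> Y es \<and> forces M \<psi> Y es)"
| "forces M (Disj \<phi> \<psi>) = (\<lambda>Y es. \<forall>Z. \<forall>g \<in> hom E Z Y. \<forall>w \<in> hom E Z Omega.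
     (\<forall>V. \<forall>k \<in> hom E V Z. forces M \<phi> V (restr es (g \<cdot> k)) \<or> forces M \<psi> V (restr es (g \<cdot> k)) \<longrightarrow>
       w \<cdot> k = true_at V) \<longrightarrow> w = true_at Z)"
| "forces M (Impl \<phi> \<psi>) = (\<lambda>Y es. \<forall>Z. \<forall>g \<in> hom E Z Y.
     forces M \<phi> Z (restr es g) \<longrightarrow> forces M \<psi> Z (restr es g))"
| "forces M (Forall \<phi>) = (\<lambda>Y es. \<forall>Z. \<forall>g \<in> hom E Z Y. \<forall>b \<in> hom E Z (carrier M).
     forces M \<phi> Z (b # restr es g))"
| "forces M (Exists \<phi>) = (\<lambda>Y es. \<forall>Z. \<forall>g \<in> hom E Z Y. \<forall>w \<in> hom E Z Omega.
     (\<forall>V. \<forall>k \<in> hom E V Z. \<forall>b \<in> hom E V (carrier M). forces M \<phi> V (b # restr es (g \<cdot> k)) \<longrightarrow>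
       w \<cdot> k = true_at V) \<longrightarrow> w = true_at Z)"

lemma tms_at_correct_aux:
  assumes A: "carrier M \<in> Ob E"
    and ts: "\<forall>t \<in> set ts. tm_sem E M n t \<in> hom E (obj_pow E (carrier M) n) (carrier M) \<and>
      (\<forall>Y es. env_in (carrier M) Y n es \<longrightarrow> tm_sem E M n t \<cdot> env Y es = tm_at M Y es t)"
  shows "tuple E (obj_pow E (carrier M) n) (map (tm_sem E M n) ts)
      \<in> hom E (obj_pow E (carrier M) n) (obj_pow E (carrier M) (length ts))"
    and "env_in (carrier M) Y n es \<Longrightarrow>
      tuple E (obj_pow E (carrier M) n) (map (tm_sem E M n) ts) \<cdot> env Y es = tuple E Y (map (tm_at M Y es) ts)"
proof -
  let ?P = "obj_pow E (carrier M) n" let ?ss = "map (tm_sem E M n) ts"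
  have ss: "env_in (carrier M) ?P (length ts) (rev ?ss)"
    using ts A by (auto simp: env_in_def)
  show "tuple E ?P ?ss \<in> hom E ?P (obj_pow E (carrier M) (length ts))"
    using env_hom[OF ss] by (simp add: tuple_env)
  assume es: "env_in (carrier M) Y n es"
  have "env ?P (rev ?ss) \<cdot> env Y es = env Y (restr (rev ?ss) (env Y es))"
    by (rule env_restr[OF ss env_hom[OF es]])
  also have "restr (rev ?ss) (env Y es) = rev (map (tm_at M Y es) ts)"
    using ts es by (simp add: rev_map)
  finally show "tuple E ?P ?ss \<cdot> env Y es = tuple E Y (map (tm_at M Y es) ts)"
    by (simp add: tuple_env)
qed

lemma tm_at_correct:
  assumes M: "is_struc E L M" and wf: "wf_tm L n t"
  shows "tm_sem E M n t \<in> hom E (obj_pow E (carrier M) n) (carrier M) \<and>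
    (\<forall>Y es. env_in (carrier M) Y n es \<longrightarrow> tm_sem E M n t \<cdot> env Y es = tm_at M Y es t)"
  using wf
proof (induction t)
  case (Var i)
  have "carrier M \<in> Ob E" using M by (simp add: is_struc_def)
  with Var show ?case using var_proj_hom var_proj_env by auto
next
  case (Fun f ts)
  have A: "carrier M \<in> Ob E" using M by (simp add: is_struc_def)
  have f: "fun_int M f \<in> hom E (obj_pow E (carrier M) (length ts)) (carrier M)"
    using M Fun.prems by (auto simp: is_struc_def)
  have IH: "\<forall>t \<in> set ts. tm_sem E M n t \<in> hom E (obj_pow E (carrier M) n) (carrier M) \<and>
      (\<forall>Y es. env_in (carrier M) Y n es \<longrightarrow> tm_sem E M n t \<cdot> env Y es = tm_at M Y es t)"
    using Fun by simp
  note ts = tms_at_correct_aux[OF A IH]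
  have "(fun_int M f \<cdot> tuple E (obj_pow E (carrier M) n) (map (tm_sem E M n) ts)) \<cdot> env Y es
      = fun_int M f \<cdot> tuple E Y (map (tm_at M Y es) ts)" if es: "env_in (carrier M) Y n es" for Y es
    unfolding ts(2)[OF es, symmetric] using f ts(1) env_hom[OF es] by (simp add: hom_def)
  then show ?case
    using comp_hom[OF ts(1) f] by simp
qed

lemma tms_at_correct:
  assumes M: "is_struc E L M" and "\<forall>t \<in> set ts. wf_tm L n t"
  shows "tuple E (obj_pow E (carrier M) n) (map (tm_sem E M n) ts)
      \<in> hom E (obj_pow E (carrier M) n) (obj_pow E (carrier M) (length ts))"
    and "env_in (carrier M) Y n es \<Longrightarrow>
      tuple E (obj_pow E (carrier M) n) (map (tm_sem E M n) ts) \<cdot> env Y es = tuple E Y (map (tm_at M Y es) ts)"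
  using tms_at_correct_aux[of M ts n] tm_at_correct[OF M] assms by (auto simp: is_struc_def)

text \<open>
  The elements over \<open>x\<close> of the projection along which a quantifier is interpreted are
  extensions of the environment \<open>x\<close> by one value.
\<close>

lemma pr1_fibre:
  assumes "b \<in> hom E Z (prd E P A)" "P \<in> Ob E" "A \<in> Ob E" "x \<in> hom E Z P"
  shows "pr1 E P A \<cdot> b = x \<longleftrightarrow> (\<exists>c \<in> hom E Z A. b = pairing E x c)"
proof
  assume "pr1 E P A \<cdot> b = x"
  then show "\<exists>c \<in> hom E Z A. b = pairing E x c"
    using pairing_eta[of b P A] assms by (intro bexI[of _ "pr2 E P A \<cdot> b"]) (auto simp: hom_def)
next
  assume "\<exists>c \<in> hom E Z A. b = pairing E x c"
  then obtain c where c: "c \<in> hom E Z A" "b = pairing E x c" by blast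
  show "pr1 E P A \<cdot> b = x"
    unfolding c(2) using c(1) assms(4) by (simp add: hom_def)
qed

lemma into_hom: "(\<forall>g \<in> into Y. Q (Dom E g) g) \<longleftrightarrow> (\<forall>Z. \<forall>g \<in> hom E Z Y. Q Z g)"
  by (auto simp: hom_def)

text \<open>
  Every clause of \<open>forces\<close> is the description of the corresponding operation on subobjects,
  reindexed along the environment.
\<close>

lemma fm_sem_forces:
  assumes M: "is_struc E L M" and wf: "wf_fm L n \<phi>"
  shows "fm_sem E M n \<phi> \<in> Sub E (obj_pow E (carrier M) n) \<and>
    (\<forall>Y es. env_in (carrier M) Y n es \<longrightarrow> (env Y es \<in>\<^sub>E fm_sem E M n \<phi> \<longleftrightarrow> forces M \<phi> Y es))"
  using wf
proof (induction \<phi> arbitrary: n)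
  case (Equal t u)
  then have t: "wf_tm L n t" and u: "wf_tm L n u" by auto
  note t = tm_at_correct[OF M t] and u = tm_at_correct[OF M u]
  show ?case
    using t u sub_equalizer_props[OF t[THEN conjunct1] u[THEN conjunct1]] by auto
next
  case (Rel r ts)
  have r: "rel_int M r \<in> Sub E (obj_pow E (carrier M) (length ts))"
    using M Rel by (auto simp: is_struc_def)
  have wf: "\<forall>t \<in> set ts. wf_tm L n t" using Rel by simp
  note ts = tms_at_correct[OF M this]
  show ?case
    using sub_pullback_props[OF ts(1) r] ts(2) by simp
next
  case Falsum
  have A: "obj_pow E (carrier M) n \<in> Ob E" using M by (simp add: is_struc_def)
  show ?case
    using sub_bot_props[OF A] by (simp add: into_hom[where Q = "\<lambda>Z g. \<forall>w \<in> hom E Z Omega. w = true_at Z", simplified])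
next
  case (Conj \<phi> \<psi>)
  then have "wf_fm L n \<phi>" "wf_fm L n \<psi>" by auto
  note \<phi> = Conj.IH(1)[OF this(1)] and \<psi> = Conj.IH(2)[OF this(2)]
  show ?case
    using \<phi> \<psi> sub_meet_props[OF \<phi>[THEN conjunct1] \<psi>[THEN conjunct1]] by simp
next
  case (Disj \<phi> \<psi>)
  then have "wf_fm L n \<phi>" "wf_fm L n \<psi>" by auto
  note \<phi> = Disj.IH(1)[OF this(1)] and \<psi> = Disj.IH(2)[OF this(2)]
  note S = sub_join_props[OF \<phi>[THEN conjunct1] \<psi>[THEN conjunct1]]
  have "env Y es \<in>\<^sub>E fm_sem E M n (Disj \<phi> \<psi>) \<longleftrightarrow> forces M (Disj \<phi> \<psi>) Y es"
    if es: "env_in (carrier M) Y n es" for Y es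
  proof -
    note e = env_hom[OF es]
    have *: "(env Y es \<cdot> g \<cdot> k \<in>\<^sub>E fm_sem E M n \<phi> \<longleftrightarrow> forces M \<phi> V (restr es (g \<cdot> k))) \<and>
       (env Y es \<cdot> g \<cdot> k \<in>\<^sub>E fm_sem E M n \<psi> \<longleftrightarrow> forces M \<psi> V (restr es (g \<cdot> k)))"
      if "g \<in> hom E Z Y" "k \<in> hom E V Z" for g k Z V
    proof -
      have gk: "g \<cdot> k \<in> hom E V Y" using that by (auto simp: hom_def)
      show ?thesis
        using \<phi> \<psi> env_in_restr[OF es gk] env_restr[OF es gk] by simp
    qed
    have "env Y es \<in>\<^sub>E fm_sem E M n (Disj \<phi> \<psi>) \<longleftrightarrow> (\<forall>Z. \<forall>g \<in> hom E Z Y. \<forall>w \<in> hom E Z Omega.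
        (\<forall>V. \<forall>k \<in> hom E V Z. env Y es \<cdot> g \<cdot> k \<in>\<^sub>E fm_sem E M n \<phi> \<or> env Y es \<cdot> g \<cdot> k \<in>\<^sub>E fm_sem E M n \<psi> \<longrightarrow>
          w \<cdot> k = true_at V) \<longrightarrow> w = true_at Z)"
      using S(2)[of "env Y es"] e by (simp add: hom_def)
    also have "\<dots> \<longleftrightarrow> forces M (Disj \<phi> \<psi>) Y es"
      unfolding forces.simps
      by (intro all_cong1 ball_cong refl arg_cong2[where f = "(\<longrightarrow>)"]) (use * in blast)
    finally show ?thesis .
  qed
  with S(1) show ?case by simp
next
  case (Impl \<phi> \<psi>)
  then have "wf_fm L n \<phi>" "wf_fm L n \<psi>" by auto
  note \<phi> = Impl.IH(1)[OF this(1)] and \<psi> = Impl.IH(2)[OF this(2)]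
  note S = sub_imp_props[OF \<phi>[THEN conjunct1] \<psi>[THEN conjunct1]]
  have "env Y es \<in>\<^sub>E fm_sem E M n (Impl \<phi> \<psi>) \<longleftrightarrow> forces M (Impl \<phi> \<psi>) Y es"
    if es: "env_in (carrier M) Y n es" for Y es
  proof -
    have "(\<forall>g \<in> into Y. env Y es \<cdot> g \<in>\<^sub>E fm_sem E M n \<phi> \<longrightarrow> env Y es \<cdot> g \<in>\<^sub>E fm_sem E M n \<psi>) \<longleftrightarrow>
      (\<forall>Z. \<forall>g \<in> hom E Z Y. env Y es \<cdot> g \<in>\<^sub>E fm_sem E M n \<phi> \<longrightarrow> env Y es \<cdot> g \<in>\<^sub>E fm_sem E M n \<psi>)"
      by (auto simp: hom_def)
    also have "\<dots> \<longleftrightarrow> forces M (Impl \<phi> \<psi>) Y es"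
      unfolding forces.simps
      by (intro all_cong1 ball_cong refl) (use \<phi> \<psi> env_in_restr[OF es] env_restr[OF es] in simp)
    finally show ?thesis
      using S(2)[of "env Y es"] env_hom[OF es] by (simp add: hom_def)
  qed
  with S(1) show ?case by simp
next
  case (Forall \<phi>)
  let ?A = "carrier M" let ?P = "obj_pow E ?A n"
  have A: "?A \<in> Ob E" using M by (simp add: is_struc_def)
  have "wf_fm L (Suc n) \<phi>" using Forall by simp
  note \<phi> = Forall.IH[OF this, simplified]
  have pr: "pr1 E ?P ?A \<in> hom E (prd E ?P ?A) ?P" using A by (simp add: hom_def)
  note S = sub_forall_props[OF pr \<phi>[THEN conjunct1]]
  have "env Y es \<in>\<^sub>E fm_sem E M n (Forall \<phi>) \<longleftrightarrow> forces M (Forall \<phi>) Y es"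
    if es: "env_in (carrier M) Y n es" for Y es
  proof -
    have "env Y es \<in>\<^sub>E fm_sem E M n (Forall \<phi>) \<longleftrightarrow> (\<forall>Z. \<forall>g \<in> hom E Z Y. \<forall>b \<in> hom E Z (prd E ?P ?A).
        pr1 E ?P ?A \<cdot> b = env Y es \<cdot> g \<longrightarrow> b \<in>\<^sub>E fm_sem E M (Suc n) \<phi>)"
      using S(2)[of "env Y es"] env_hom[OF es] by (simp add: hom_def)
    also have "\<dots> \<longleftrightarrow> forces M (Forall \<phi>) Y es"
      unfolding forces.simps
    proof (rule all_cong1, rule ball_cong[OF refl])
      fix Z g assume g: "g \<in> hom E Z Y"
      note r = env_in_restr[OF es g]
      have "(\<forall>b \<in> hom E Z (prd E ?P ?A). pr1 E ?P ?A \<cdot> b = env Y es \<cdot> g \<longrightarrow> b \<in>\<^sub>E fm_sem E M (Suc n) \<phi>) \<longleftrightarrow>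
         (\<forall>b \<in> hom E Z (prd E ?P ?A). (\<exists>c \<in> hom E Z ?A. b = pairing E (env Z (restr es g)) c) \<longrightarrow> b \<in>\<^sub>E fm_sem E M (Suc n) \<phi>)"
        using pr1_fibre[OF _ obj_pow_Ob[OF A] A env_hom[OF r]] env_restr[OF es g] by simp
      also have "\<dots> \<longleftrightarrow> (\<forall>c \<in> hom E Z ?A. pairing E (env Z (restr es g)) c \<in>\<^sub>E fm_sem E M (Suc n) \<phi>)"
        using pairing_hom[OF env_hom[OF r]] by blast
      also have "\<dots> \<longleftrightarrow> (\<forall>c \<in> hom E Z ?A. forces M \<phi> Z (c # restr es g))"
        using \<phi>[THEN conjunct2, rule_format, of Z "c # restr es g" for c] r by simp
      finally show "(\<forall>b \<in> hom E Z (prd E ?P ?A). pr1 E ?P ?A \<cdot> b = env Y es \<cdot> g \<longrightarrow> b \<in>\<^sub>E fm_sem E M (Suc n) \<phi>) \<longleftrightarrow>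
         (\<forall>c \<in> hom E Z ?A. forces M \<phi> Z (c # restr es g))" .
    qed
    finally show ?thesis .
  qed
  with S(1) show ?case by simp
next
  case (Exists \<phi>)
  let ?A = "carrier M" let ?P = "obj_pow E ?A n"
  have A: "?A \<in> Ob E" using M by (simp add: is_struc_def)
  have "wf_fm L (Suc n) \<phi>" using Exists by simp
  note \<phi> = Exists.IH[OF this, simplified]
  have pr: "pr1 E ?P ?A \<in> hom E (prd E ?P ?A) ?P" using A by (simp add: hom_def)
  note S = sub_exists_props[OF pr \<phi>[THEN conjunct1]]
  have "env Y es \<in>\<^sub>E fm_sem E M n (Exists \<phi>) \<longleftrightarrow> forces M (Exists \<phi>) Y es"
    if es: "env_in (carrier M) Y n es" for Y es
  proof -
    have *: "(\<forall>b \<in> hom E V (prd E ?P ?A). pr1 E ?P ?A \<cdot> b = env Y es \<cdot> g \<cdot> k \<and> b \<in>\<^sub>E fm_sem E M (Suc n) \<phi> \<longrightarrow> R) \<longleftrightarrow>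
         (\<forall>c \<in> hom E V ?A. forces M \<phi> V (c # restr es (g \<cdot> k)) \<longrightarrow> R)"
      if "g \<in> hom E Z Y" "k \<in> hom E V Z" for Z V g k R
    proof -
      have gk: "g \<cdot> k \<in> hom E V Y" using that by (auto simp: hom_def)
      note r = env_in_restr[OF es gk]
      have "(\<forall>b \<in> hom E V (prd E ?P ?A). pr1 E ?P ?A \<cdot> b = env Y es \<cdot> g \<cdot> k \<and> b \<in>\<^sub>E fm_sem E M (Suc n) \<phi> \<longrightarrow> R) \<longleftrightarrow>
         (\<forall>b \<in> hom E V (prd E ?P ?A). (\<exists>c \<in> hom E V ?A. b = pairing E (env V (restr es (g \<cdot> k))) c) \<and> b \<in>\<^sub>E fm_sem E M (Suc n) \<phi> \<longrightarrow> R)"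
        using pr1_fibre[OF _ obj_pow_Ob[OF A] A env_hom[OF r]] env_restr[OF es gk] by simp
      also have "\<dots> \<longleftrightarrow> (\<forall>c \<in> hom E V ?A. pairing E (env V (restr es (g \<cdot> k))) c \<in>\<^sub>E fm_sem E M (Suc n) \<phi> \<longrightarrow> R)"
        using pairing_hom[OF env_hom[OF r]] by blast
      also have "\<dots> \<longleftrightarrow> (\<forall>c \<in> hom E V ?A. forces M \<phi> V (c # restr es (g \<cdot> k)) \<longrightarrow> R)"
        using \<phi>[THEN conjunct2, rule_format, of V "c # restr es (g \<cdot> k)" for c] r by simp
      finally show ?thesis .
    qed
    have "env Y es \<in>\<^sub>E fm_sem E M n (Exists \<phi>) \<longleftrightarrow> (\<forall>Z. \<forall>g \<in> hom E Z Y. \<forall>w \<in> hom E Z Omega.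
        (\<forall>V. \<forall>k \<in> hom E V Z. \<forall>b \<in> hom E V (prd E ?P ?A).
          pr1 E ?P ?A \<cdot> b = env Y es \<cdot> g \<cdot> k \<and> b \<in>\<^sub>E fm_sem E M (Suc n) \<phi> \<longrightarrow> w \<cdot> k = true_at V) \<longrightarrow> w = true_at Z)"
      using S(2)[of "env Y es"] env_hom[OF es] by (simp add: hom_def)
    also have "\<dots> \<longleftrightarrow> forces M (Exists \<phi>) Y es"
      unfolding forces.simps
      by (rule all_cong1, rule ball_cong[OF refl], rule ball_cong[OF refl], rule imp_cong[OF _ refl],
        rule all_cong1, rule ball_cong[OF refl], rule *)
    finally show ?thesis .
  qed
  with S(1) show ?case by simp
qed

end

section \<open>Rules for forcing\<close>

lemma wf_tm_fv: "wf_tm L n t \<Longrightarrow> fv_tm t \<subseteq> {..<n}"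
  by (induction t) auto

lemma wf_fm_fv: "wf_fm L n \<phi> \<Longrightarrow> fv \<phi> \<subseteq> {..<n}"
proof (induction \<phi> arbitrary: n)
  case (Rel r ts)
  then show ?case using wf_tm_fv[of L n] by force
qed (use wf_tm_fv in \<open>fastforce+\<close>)

lemma wf_univ_closure: "wf_fm L m (univ_closure n \<phi>) \<longleftrightarrow> wf_fm L (m + n) \<phi>"
  unfolding univ_closure_def by (induction n arbitrary: m) auto

context elementary_topos begin

definition valid :: "('o, 'm, 'f, 'r) struc \<Rightarrow> nat \<Rightarrow> ('f, 'r) fm \<Rightarrow> bool" where
  "valid M n \<phi> \<longleftrightarrow> (\<forall>Y es. env_in (carrier M) Y n es \<longrightarrow> forces M \<phi> Y es)"

lemma env_in_Ob: "env_in A Y n es \<Longrightarrow> Y \<in> Ob E" "env_in A Y n es \<Longrightarrow> A \<in> Ob E"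
  by (simp_all add: env_in_def)

text \<open>
  Elements of the terminal object exist uniquely at every stage, so a subobject of it is
  maximal iff it is true at every stage.
\<close>

lemma holds_iff_valid:
  assumes M: "is_struc E L M" and wf: "wf_fm L 0 \<phi>"
  shows "holds E M \<phi> \<longleftrightarrow> valid M 0 \<phi>"
proof -
  have A: "carrier M \<in> Ob E" using M by (simp add: is_struc_def)
  have S: "fm_sem E M 0 \<phi> \<in> Sub E (term_ob E)"
    and F: "\<And>Y. Y \<in> Ob E \<Longrightarrow> bang E Y \<in>\<^sub>E fm_sem E M 0 \<phi> \<longleftrightarrow> forces M \<phi> Y []"
    using fm_sem_forces[OF M wf] A by (force simp: env_in_0)+
  have T: "sub_top E (term_ob E) \<in> Sub E (term_ob E)"
    "\<And>h. h \<in> Ar E \<Longrightarrow> Cod E h = term_ob E \<Longrightarrow> h \<in>\<^sub>E sub_top E (term_ob E)"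
    by (rule sub_top_props; simp)+
  have "holds E M \<phi> \<longleftrightarrow> (\<forall>h \<in> into (term_ob E). h \<in>\<^sub>E fm_sem E M 0 \<phi>)"
    unfolding holds_def using Sub_eqI[OF S T(1)] T(2) by auto
  also have "\<dots> \<longleftrightarrow> (\<forall>Y \<in> Ob E. bang E Y \<in>\<^sub>E fm_sem E M 0 \<phi>)"
  proof (intro iffI ballI)
    fix h assume *: "\<forall>Y \<in> Ob E. bang E Y \<in>\<^sub>E fm_sem E M 0 \<phi>" and h: "h \<in> into (term_ob E)"
    then show "h \<in>\<^sub>E fm_sem E M 0 \<phi>"
      using bang_unique[of h] Dom_Cod_Ob(1)[of h] by (metis (mono_tags, lifting) mem_Collect_eq)
  qed auto
  also have "\<dots> \<longleftrightarrow> valid M 0 \<phi>"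
    using F A by (auto simp: valid_def env_in_0)
  finally show ?thesis .
qed

lemma valid_Forall: "valid M n (Forall \<phi>) \<longleftrightarrow> valid M (Suc n) \<phi>"
proof
  assume *: "valid M n (Forall \<phi>)"
  show "valid M (Suc n) \<phi>"
    unfolding valid_def
  proof (intro allI impI)
    fix Y es assume "env_in (carrier M) Y (Suc n) es"
    then obtain b es' where es: "es = b # es'" "b \<in> hom E Y (carrier M)" "env_in (carrier M) Y n es'"
      by (auto simp: env_in_Suc)
    then have "forces M \<phi> Y (b # restr es' (Idm E Y))"
      using * Idm_hom[OF env_in_Ob(1)[OF es(3)]] unfolding valid_def forces.simps by blast
    then show "forces M \<phi> Y es"
      using es restr_Idm[OF es(3)] by simp
  qed
next
  assume "valid M (Suc n) \<phi>"
  then show "valid M n (Forall \<phi>)"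
    using env_in_restr unfolding valid_def forces.simps by fastforce
qed

lemma valid_univ_closure: "valid M m (univ_closure n \<phi>) \<longleftrightarrow> valid M (m + n) \<phi>"
  unfolding univ_closure_def by (induction n arbitrary: m) (auto simp: valid_Forall)

lemma holds_univ_closure:
  assumes "is_struc E L M" "wf_fm L n \<phi>"
  shows "holds E M (univ_closure n \<phi>) \<longleftrightarrow> valid M n \<phi>"
  using holds_iff_valid[OF assms(1), of "univ_closure n \<phi>"] assms(2)
  by (simp add: wf_univ_closure valid_univ_closure)

lemma forces_memb:
  assumes "is_struc E L M" "wf_fm L n \<phi>" "env_in (carrier M) Y n es"
  shows "forces M \<phi> Y es \<longleftrightarrow> env Y es \<in>\<^sub>E fm_sem E M n \<phi>"
  using fm_sem_forces[OF assms(1,2)] assms(3) by blast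

lemma forces_definable:
  assumes "is_struc E L M" "wf_fm L n \<phi>" "env_in (carrier M) Y n es"
  shows "definable Y (\<lambda>g. forces M \<phi> (Dom E g) (restr es g))"
proof -
  have "definable Y (\<lambda>g. env Y es \<cdot> g \<in>\<^sub>E fm_sem E M n \<phi>)"
    using definable_comp[OF Sub_definable env_hom[OF assms(3)]] fm_sem_forces[OF assms(1,2)] by blast
  then show ?thesis
  proof (rule definable_cong)
    fix h assume h: "h \<in> Ar E" "Cod E h = Y"
    then have "h \<in> hom E (Dom E h) Y" by (simp add: hom_def)
    from env_restr[OF assms(3) this] forces_memb[OF assms(1,2) env_in_restr[OF assms(3) this]]
    show "env Y es \<cdot> h \<in>\<^sub>E fm_sem E M n \<phi> \<longleftrightarrow> forces M \<phi> (Dom E h) (restr es h)" by simp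
  qed
qed

lemma definable_memb_env:
  assumes "W \<in> Sub E (obj_pow E A n)" "env_in A Y n es"
  shows "definable Y (\<lambda>g. env (Dom E g) (restr es g) \<in>\<^sub>E W)"
proof -
  have "definable Y (\<lambda>g. env Y es \<cdot> g \<in>\<^sub>E W)"
    by (rule definable_comp[OF Sub_definable[OF assms(1)] env_hom[OF assms(2)]])
  then show ?thesis
  proof (rule definable_cong)
    fix g assume "g \<in> Ar E" "Cod E g = Y"
    then have "g \<in> hom E (Dom E g) Y" by (simp add: hom_def)
    from env_restr[OF assms(2) this] show "env Y es \<cdot> g \<in>\<^sub>E W \<longleftrightarrow> env (Dom E g) (restr es g) \<in>\<^sub>E W"
      by simp
  qed
qed

lemma forces_restr:
  assumes "is_struc E L M" "wf_fm L n \<phi>" "env_in (carrier M) Y n es"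
    and "g \<in> hom E Z Y" "forces M \<phi> Y es"
  shows "forces M \<phi> Z (restr es g)"
proof -
  have "Y \<in> Ob E" using assms(3) by (rule env_in_Ob)
  then show ?thesis
  using definable_persistent[OF forces_definable[OF assms(1-3)], of "Idm E Y" g] assms(4,5)
    restr_Idm[OF assms(3)] by (auto simp: hom_def)
qed

text \<open>
  At later stages the restriction of \<open>b\<close> remains a witness.
\<close>

lemma forces_ExistsI:
  assumes "is_struc E L M" "wf_fm L (Suc n) \<phi>" "env_in (carrier M) Y n es"
    and "b \<in> hom E Y (carrier M)" "forces M \<phi> Y (b # es)"
  shows "forces M (Exists \<phi>) Y es"
  unfolding forces.simps
proof (intro allI ballI impI)
  fix Z g w assume g: "g \<in> hom E Z Y" and w: "w \<in> hom E Z Omega"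
    and *: "\<forall>V. \<forall>k \<in> hom E V Z. \<forall>b \<in> hom E V (carrier M). forces M \<phi> V (b # restr es (g \<cdot> k)) \<longrightarrow> w \<cdot> k = true_at V"
  have be: "env_in (carrier M) Y (Suc n) (b # es)" using assms(3,4) by simp
  have "forces M \<phi> Z (b \<cdot> g # restr es g)"
    using forces_restr[OF assms(1,2) be g assms(5)] by simp
  moreover have "g \<cdot> Idm E Z = g" "w \<cdot> Idm E Z = w" "Z \<in> Ob E"
    using g w by (auto simp: hom_def)
  ultimately show "w = true_at Z"
    using *[THEN spec[of _ Z], THEN bspec[of _ _ "Idm E Z"], THEN bspec[of _ _ "b \<cdot> g"]]
      comp_hom[OF g assms(4)] Idm_hom by simp
qed

text \<open>
  An existential statement at \<open>Y\<close> may have witnesses only at later stages.  It can nevertheless be used to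
  prove a definable \<open>R\<close>, because the truth value of \<open>R\<close> at \<open>Y\<close> is one of the values over which the encoding
  of existence quantifies.
\<close>

lemma forces_ExistsE:
  assumes "forces M (Exists \<phi>) Y es" "definable Y R"
    and "\<And>Z g b. g \<in> hom E Z Y \<Longrightarrow> b \<in> hom E Z (carrier M) \<Longrightarrow> forces M \<phi> Z (b # restr es g) \<Longrightarrow> R g"
  shows "R (Idm E Y)"
proof -
  from assms(2) obtain \<chi> where "classifies \<chi> Y R"
    unfolding definable_def by blast
  note \<chi> = classifiesD[OF this]
  have "\<chi> \<cdot> k = true_at V" if k: "k \<in> hom E V Y" and b: "b \<in> hom E V (carrier M)"
    and f: "forces M \<phi> V (b # restr es (Idm E Y \<cdot> k))" for V k b
  proof -
    have "Idm E Y \<cdot> k = k" using k by (auto simp: hom_def)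
    with assms(3)[OF k b] f have "R k" by simp
    then show ?thesis using \<chi>(5)[of k] k by (auto simp: hom_def)
  qed
  moreover have "Idm E Y \<in> hom E Y Y" "\<chi> \<in> hom E Y Omega"
    using \<chi>(1-4) by (auto simp: hom_def)
  ultimately have "\<chi> = true_at Y"
    using assms(1) unfolding forces.simps by blast
  then show ?thesis
    using \<chi>(5)[of "Idm E Y"] \<chi>(1-4) by simp
qed

lemma forces_IffI:
  assumes "\<And>Z g. g \<in> hom E Z Y \<Longrightarrow> forces M \<phi> Z (restr es g) \<longleftrightarrow> forces M \<psi> Z (restr es g)"
  shows "forces M (Iff \<phi> \<psi>) Y es"
  using assms by (auto simp: Iff_def)

lemma forces_IffD:
  assumes "forces M (Iff \<phi> \<psi>) Y es" "env_in A Y n es"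
  shows "forces M \<phi> Y es \<longleftrightarrow> forces M \<psi> Y es"
proof -
  have "Idm E Y \<in> hom E Y Y" using assms(2) by (simp add: env_in_def Idm_hom)
  with assms(1) restr_Idm[OF assms(2)] show ?thesis
    unfolding Iff_def forces.simps by metis
qed

text \<open>
  A quantifier over the elements of \<open>B\<close>, mapped into the carrier by \<open>c\<close>, and a biconditional below it both
  pass to a later stage; one passage is enough.
\<close>

lemma forces_Iff_family:
  assumes es: "env_in A Y n es" and c: "c \<in> hom E B A"
  shows "(\<forall>Z. \<forall>g \<in> hom E Z Y. \<forall>b \<in> hom E Z B. forces M (Iff \<phi> \<psi>) Z (c \<cdot> b # restr es g)) \<longleftrightarrow>
    (\<forall>Z. \<forall>g \<in> hom E Z Y. \<forall>b \<in> hom E Z B.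
      forces M \<phi> Z (c \<cdot> b # restr es g) \<longleftrightarrow> forces M \<psi> Z (c \<cdot> b # restr es g))" (is "?L \<longleftrightarrow> ?R")
proof (rule iffI, intro allI ballI)
  fix Z g b assume ?L and gb: "g \<in> hom E Z Y" "b \<in> hom E Z B"
  then have "forces M (Iff \<phi> \<psi>) Z (c \<cdot> b # restr es g)" by blast
  moreover have "env_in A Z (Suc n) (c \<cdot> b # restr es g)"
    using gb c comp_hom env_in_restr[OF es] by simp
  ultimately show "forces M \<phi> Z (c \<cdot> b # restr es g) \<longleftrightarrow> forces M \<psi> Z (c \<cdot> b # restr es g)"
    by (rule forces_IffD)
next
  assume ?R
  have "forces M (Iff \<phi> \<psi>) Z (c \<cdot> b # restr es g)" if gb: "g \<in> hom E Z Y" "b \<in> hom E Z B" for Z g b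
  proof (rule forces_IffI)
    fix V k assume k: "k \<in> hom E V Z"
    have "(c \<cdot> b) \<cdot> k = c \<cdot> b \<cdot> k"
      using c gb(2) k by (simp add: hom_def)
    then show "forces M \<phi> V (restr (c \<cdot> b # restr es g) k) \<longleftrightarrow> forces M \<psi> V (restr (c \<cdot> b # restr es g) k)"
      using \<open>?R\<close> comp_hom[OF k gb(1)] comp_hom[OF k gb(2)]
      unfolding list.map restr_restr[OF es gb(1) k] by simp
  qed
  then show ?L by blast
qed

lemma forces_Forall_Iff:
  assumes es: "env_in (carrier M) Y n es"
  shows "forces M (Forall (Iff \<phi> \<psi>)) Y es \<longleftrightarrow>
    (\<forall>Z. \<forall>g \<in> hom E Z Y. \<forall>b \<in> hom E Z (carrier M).
      forces M \<phi> Z (b # restr es g) \<longleftrightarrow> forces M \<psi> Z (b # restr es g))"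
  using forces_Iff_family[OF es Idm_hom[OF env_in_Ob(2)[OF es]], of M \<phi> \<psi>]
  by (simp add: hom_def)

lemma valid_ImplI:
  assumes "\<And>Y es. env_in (carrier M) Y n es \<Longrightarrow> forces M \<phi> Y es \<Longrightarrow> forces M \<psi> Y es"
  shows "valid M n (Impl \<phi> \<psi>)"
  unfolding valid_def forces.simps using assms env_in_restr by blast

lemma valid_IffI:
  assumes "\<And>Y es. env_in (carrier M) Y n es \<Longrightarrow> forces M \<phi> Y es \<longleftrightarrow> forces M \<psi> Y es"
  shows "valid M n (Iff \<phi> \<psi>)"
  unfolding valid_def using forces_IffI assms env_in_restr by blast

lemma forces_ImplD:
  assumes "forces M (Impl \<phi> \<psi>) Y es" "env_in A Y n es" "forces M \<phi> Y es"
  shows "forces M \<psi> Y es"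
  using assms(1,3) restr_Idm[OF assms(2)] Idm_hom[OF env_in_Ob(1)[OF assms(2)]]
  unfolding forces.simps by metis

lemma tm_at_cong:
  "(\<And>i. i \<in> fv_tm t \<Longrightarrow> es ! i = es' ! i) \<Longrightarrow> tm_at M Y es t = tm_at M Y es' t"
proof (induction t)
  case (Fun f ts)
  have "map (tm_at M Y es) ts = map (tm_at M Y es') ts"
    by (rule map_cong[OF refl], rule Fun.IH) (use Fun.prems in auto)
  then show ?case by (simp cong: map_cong)
qed simp

text \<open>
  Only the values of the free variables matter, which is how the condition that a variable is not free
  in a formula is used.
\<close>

lemma forces_cong:
  "length es = length es' \<Longrightarrow> fv \<phi> \<subseteq> {..<length es} \<Longrightarrow> (\<And>i. i \<in> fv \<phi> \<Longrightarrow> es ! i = es' ! i) \<Longrightarrow>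
    forces M \<phi> Y es \<longleftrightarrow> forces M \<phi> Y es'"
proof (induction \<phi> arbitrary: Y es es')
  case (Equal t u)
  then show ?case using tm_at_cong[of t es es' M Y] tm_at_cong[of u es es' M Y] by simp
next
  case (Rel r ts)
  have "map (tm_at M Y es) ts = map (tm_at M Y es') ts"
    by (rule map_cong[OF refl], rule tm_at_cong) (use Rel in auto)
  then show ?case by (simp only: forces.simps)
next
  case (Disj \<phi> \<psi>)
  have "forces M \<phi> Z (restr es g) \<longleftrightarrow> forces M \<phi> Z (restr es' g)"
    "forces M \<psi> Z (restr es g) \<longleftrightarrow> forces M \<psi> Z (restr es' g)" for Z g
    using Disj.prems by (intro Disj.IH; force)+
  then show ?case by simp
next
  case (Impl \<phi> \<psi>)
  have "forces M \<phi> Z (restr es g) \<longleftrightarrow> forces M \<phi> Z (restr es' g)"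
    "forces M \<psi> Z (restr es g) \<longleftrightarrow> forces M \<psi> Z (restr es' g)" for Z g
    using Impl.prems by (intro Impl.IH; force)+
  then show ?case by simp
next
  case (Forall \<phi>)
  have *: "(\<forall>i \<in> fv \<phi>. (b # restr es g) ! i = (b # restr es' g) ! i) \<and> fv \<phi> \<subseteq> {..<Suc (length es)}" for b g
  proof -
    have "(b # restr es g) ! i = (b # restr es' g) ! i \<and> i < Suc (length es)" if "i \<in> fv \<phi>" for i
      using Forall.prems that by (cases i) force+
    then show ?thesis by blast
  qed
  have "forces M \<phi> Z (b # restr es g) \<longleftrightarrow> forces M \<phi> Z (b # restr es' g)" for Z g b
    by (rule Forall.IH) (use * Forall.prems(1) in simp_all)
  then show ?case by simp
next
  case (Exists \<phi>)
  have *: "(\<forall>i \<in> fv \<phi>. (b # restr es g) ! i = (b # restr es' g) ! i) \<and> fv \<phi> \<subseteq> {..<Suc (length es)}" for b g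
  proof -
    have "(b # restr es g) ! i = (b # restr es' g) ! i \<and> i < Suc (length es)" if "i \<in> fv \<phi>" for i
      using Exists.prems that by (cases i) force+
    then show ?thesis by blast
  qed
  have "forces M \<phi> Z (b # restr es g) \<longleftrightarrow> forces M \<phi> Z (b # restr es' g)" for Z g b
    by (rule Exists.IH) (use * Exists.prems(1) in simp_all)
  then show ?case by simp
next
  case (Conj \<phi> \<psi>)
  have "forces M \<phi> Y es \<longleftrightarrow> forces M \<phi> Y es'" "forces M \<psi> Y es \<longleftrightarrow> forces M \<psi> Y es'"
    using Conj.prems by (intro Conj.IH; force)+
  then show ?case by simp
qed simp

text \<open>
  A complement \<open>V\<close> of \<open>U\<close> is below \<open>U \<Rightarrow> \<bottom>\<close> because \<open>U \<and> V = \<bottom>\<close>.  Hence the join of \<open>U\<close> and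
  \<open>U \<Rightarrow> \<bottom>\<close> is above \<open>U \<or> V\<close>, which is maximal.
\<close>

lemma boolean_excluded_middle:
  assumes "boolean E" "is_struc E L M" "wf_fm L n \<phi>"
  shows "holds E M (univ_closure n (Disj \<phi> (Neg \<phi>)))"
proof -
  let ?A = "obj_pow E (carrier M) n"
  have A: "?A \<in> Ob E" using assms(2) by (simp add: is_struc_def)
  let ?U = "fm_sem E M n \<phi>"
  have wf: "wf_fm L n (Disj \<phi> (Neg \<phi>))" using assms(3) by (simp add: Neg_def)
  have U: "?U \<in> Sub E ?A" using fm_sem_forces[OF assms(2,3)] by blast
  then obtain V where V: "V \<in> Sub E ?A" "sub_meet E ?A ?U V = sub_bot E ?A" "sub_join E ?A ?U V = sub_top E ?A"
    using assms(1) A unfolding boolean_def by blast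
  note bot = sub_bot_props(1)[OF A]
  note I = sub_imp_props[OF U bot]
  have V_le: "h \<in>\<^sub>E sub_imp E ?A ?U (sub_bot E ?A)" if "h \<in>\<^sub>E V" "h \<in> into ?A" for h
    using that I(2)[of h] memb_comp[OF V(1), of h] sub_meet_props(2)[OF U V(1)] unfolding V(2) by auto
  have "h \<in>\<^sub>E sub_join E ?A ?U (sub_imp E ?A ?U (sub_bot E ?A))" if h: "h \<in> into ?A" for h
  proof -
    have "h \<in>\<^sub>E sub_join E ?A ?U V"
      unfolding V(3) using sub_top_props(2)[OF A] h by simp
    moreover have "h \<cdot> g \<cdot> k \<in>\<^sub>E sub_imp E ?A ?U (sub_bot E ?A)"
      if "h \<cdot> g \<cdot> k \<in>\<^sub>E V" "g \<in> into (Dom E h)" "k \<in> into (Dom E g)" for g k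
      using V_le[OF that(1)] that(2,3) h by simp
    ultimately show ?thesis
      using sub_join_props(2)[OF U V(1), of h] sub_join_props(2)[OF U I(1), of h] h by blast
  qed
  then have "valid M n (Disj \<phi> (Neg \<phi>))"
    unfolding valid_def using forces_memb[OF assms(2) wf] by (simp add: Neg_def)
  then show ?thesis
    using holds_univ_closure[OF assms(2) wf] by simp
qed

section \<open>Power objects over a model of the set theory\<close>

definition compr :: "'o \<Rightarrow> 'o \<Rightarrow> ('m \<Rightarrow> bool) \<Rightarrow> 'm" where
  "compr Y B P = (SOME X. X \<in> hom E Y (pow_ob B) \<and>
     (\<forall>Z. \<forall>g \<in> hom E Z Y. \<forall>b \<in> hom E Z B. isin B b (X \<cdot> g) \<longleftrightarrow> P (pairing E g b)))"

lemma compr: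
  assumes "definable (prd E Y B) P" "Y \<in> Ob E" "B \<in> Ob E"
  shows "compr Y B P \<in> hom E Y (pow_ob B)"
    and "g \<in> hom E Z Y \<Longrightarrow> b \<in> hom E Z B \<Longrightarrow> isin B b (compr Y B P \<cdot> g) \<longleftrightarrow> P (pairing E g b)"
proof -
  have "\<exists>X. X \<in> hom E Y (pow_ob B) \<and>
     (\<forall>Z. \<forall>g \<in> hom E Z Y. \<forall>b \<in> hom E Z B. isin B b (X \<cdot> g) \<longleftrightarrow> P (pairing E g b))"
    using power_comprehension[OF assms] by metis
  from someI_ex[OF this] show "compr Y B P \<in> hom E Y (pow_ob B)"
    "g \<in> hom E Z Y \<Longrightarrow> b \<in> hom E Z B \<Longrightarrow> isin B b (compr Y B P \<cdot> g) \<longleftrightarrow> P (pairing E g b)"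
    unfolding compr_def by blast+
qed

text \<open>
  The relations of the class structure are images of jointly monic families.  For such an image,
  membership is witnessed at the same stage (\<open>image_rel\<close>), whereas a general existential statement
  may have witnesses only at later stages.
\<close>

definition image_rel :: "'o \<Rightarrow> 'm list \<Rightarrow> 'm set" where
  "image_rel D ms = sub_class E (tuple E D ms)"

lemma image_rel:
  assumes ms: "env_in A D k ms"
    and cancel: "\<And>X f g. f \<in> hom E X D \<Longrightarrow> g \<in> hom E X D \<Longrightarrow> restr ms f = restr ms g \<Longrightarrow> f = g"
  shows "image_rel D ms \<in> Sub E (obj_pow E A k)"
    and "env_in A Y k es \<Longrightarrow> tuple E Y es \<in>\<^sub>E image_rel D ms \<longleftrightarrow> (\<exists>h \<in> hom E Y D. es = restr ms h)"
proof -
  have rms: "env_in A D k (rev ms)" using ms by simp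
  note e = env_Ar[OF rms]
  have comp: "env D (rev ms) \<cdot> f = env X (rev (restr ms f))" if "f \<in> hom E X D" for X f
    using env_restr[OF rms that] by (simp add: rev_map)
  have r: "env_in A X k (rev (restr ms f))" if "f \<in> hom E X D" for X f
    using env_in_restr[OF ms that] by simp
  have mono: "is_mono E (tuple E D ms)"
    unfolding is_mono_def tuple_env
  proof (intro conjI ballI impI)
    fix X f g assume "f \<in> hom E X (Dom E (env D (rev ms)))" "g \<in> hom E X (Dom E (env D (rev ms)))"
    then have fg: "f \<in> hom E X D" "g \<in> hom E X D" using e by simp_all
    assume "env D (rev ms) \<cdot> f = env D (rev ms) \<cdot> g"
    then have "rev (restr ms f) = rev (restr ms g)"
      using env_inject[OF r[OF fg(1)] r[OF fg(2)]] comp[OF fg(1)] comp[OF fg(2)] by simp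
    then show "f = g" using cancel[OF fg] by simp
  qed (rule e)
  have "Cod E (tuple E D ms) = obj_pow E A k"
    using e by (simp add: tuple_env)
  with sub_class_Sub[OF mono] show "image_rel D ms \<in> Sub E (obj_pow E A k)"
    by (simp add: image_rel_def)
  assume es: "env_in A Y k es"
  then have res: "env_in A Y k (rev es)" by simp
  have "tuple E Y es \<in>\<^sub>E image_rel D ms \<longleftrightarrow> (\<exists>h \<in> hom E Y D. env D (rev ms) \<cdot> h = env Y (rev es))"
    unfolding image_rel_def memb_sub_class[OF mono] unfolding tuple_env factors_def
    using e env_Ar[OF res] by simp
  also have "\<dots> \<longleftrightarrow> (\<exists>h \<in> hom E Y D. es = restr ms h)"
    using comp env_inject[OF r res] by (metis rev_rev_ident)
  finally show "tuple E Y es \<in>\<^sub>E image_rel D ms \<longleftrightarrow> (\<exists>h \<in> hom E Y D. es = restr ms h)" .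
qed

end

locale set_model = elementary_topos E for E :: "('o, 'm) cat" +
  fixes N :: "('o, 'm, set_fun, set_rel) struc"
  assumes model: "model E L_Set Set_INFU N"
begin

abbreviation "U \<equiv> carrier N"

definition elem :: "'o \<Rightarrow> 'm \<Rightarrow> 'm \<Rightarrow> bool" where
  "elem Y z x \<longleftrightarrow> tuple E Y [z, x] \<in>\<^sub>E rel_int N SMem"

definition sset :: "'o \<Rightarrow> 'm \<Rightarrow> bool" where
  "sset Y x \<longleftrightarrow> tuple E Y [x] \<in>\<^sub>E rel_int N SSet"

definition opair :: "'o \<Rightarrow> 'm \<Rightarrow> 'm \<Rightarrow> 'm" where
  "opair Y x y = fun_int N SPair \<cdot> tuple E Y [x, y]"

lemma struc: "is_struc E L_Set N"
  using model by (simp add: model_def)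

lemma U_Ob [simp]: "U \<in> Ob E"
  using struc by (simp add: is_struc_def)

lemma forces_atoms [simp]:
  "forces N (s_mem (Var i) (Var j)) Y es \<longleftrightarrow> elem Y (es ! i) (es ! j)"
  "forces N (s_set (Var i)) Y es \<longleftrightarrow> sset Y (es ! i)"
  "tm_at N Y es (s_pair (Var i) (Var j)) = opair Y (es ! i) (es ! j)"
  by (simp_all add: elem_def sset_def opair_def)

lemma rel_int_Sub:
  "rel_int N SMem \<in> Sub E (obj_pow E U 2)" "rel_int N SSet \<in> Sub E (obj_pow E U 1)"
  using struc by (simp_all add: is_struc_def L_Set_def split: set_rel.splits)

lemma fun_int_hom: "fun_int N SPair \<in> hom E (obj_pow E U 2) U"
  using struc by (simp add: is_struc_def L_Set_def)

lemma env2: "x \<in> hom E Y A \<Longrightarrow> y \<in> hom E Y A \<Longrightarrow> env_in A Y 2 [x, y]"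
  using hom_Ob by (fastforce simp: numeral_2_eq_2)

lemma env1: "x \<in> hom E Y A \<Longrightarrow> env_in A Y 1 [x]"
  using hom_Ob by fastforce

lemma env3: "x \<in> hom E Y A \<Longrightarrow> y \<in> hom E Y A \<Longrightarrow> z \<in> hom E Y A \<Longrightarrow> env_in A Y 3 [x, y, z]"
  using hom_Ob by (fastforce simp: numeral_3_eq_3)

lemma env4: "x \<in> hom E Y A \<Longrightarrow> y \<in> hom E Y A \<Longrightarrow> z \<in> hom E Y A \<Longrightarrow> w \<in> hom E Y A \<Longrightarrow> env_in A Y 4 [x, y, z, w]"
  using hom_Ob by (fastforce simp: eval_nat_numeral)

lemma elem_definable:
  assumes "z \<in> hom E Y U" "x \<in> hom E Y U"
  shows "definable Y (\<lambda>g. elem (Dom E g) (z \<cdot> g) (x \<cdot> g))"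
  using definable_memb_env[OF rel_int_Sub(1) env2[OF assms(2,1)]] by (simp add: elem_def tuple_env)

lemma sset_definable:
  assumes "x \<in> hom E Y U"
  shows "definable Y (\<lambda>g. sset (Dom E g) (x \<cdot> g))"
  using definable_memb_env[OF rel_int_Sub(2) env1[OF assms]] by (simp add: sset_def tuple_env)

lemma opair_hom: "x \<in> hom E Y U \<Longrightarrow> y \<in> hom E Y U \<Longrightarrow> opair Y x y \<in> hom E Y U"
  unfolding opair_def tuple_env using comp_hom[OF env_hom[OF env2] fun_int_hom] by simp

lemma opair_comp:
  assumes "x \<in> hom E Y U" "y \<in> hom E Y U" "g \<in> hom E Z Y"
  shows "opair Y x y \<cdot> g = opair Z (x \<cdot> g) (y \<cdot> g)"
proof -
  have *: "env_in U Y 2 [y, x]" using assms env2 by blast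
  have "opair Y x y \<cdot> g = fun_int N SPair \<cdot> (env Y [y, x] \<cdot> g)"
    unfolding opair_def tuple_env using fun_int_hom env_hom[OF *] assms(3)
    by (auto simp: hom_def simp del: env_simps)
  then show ?thesis
    unfolding env_restr[OF * assms(3)] by (simp add: opair_def tuple_env)
qed

lemma axiom_valid:
  "univ_closure n \<phi> \<in> Set_INFU \<Longrightarrow> wf_fm L_Set n \<phi> \<Longrightarrow> valid N n \<phi>"
  using model holds_univ_closure[OF struc] by (auto simp: model_def)

text \<open>
  The axiom of extensionality read at an arbitrary stage, where elements have to be
  compared with those of all later stages.
\<close>

lemma set_extensionality:
  assumes xy: "x \<in> hom E Y U" "y \<in> hom E Y U" and s: "sset Y x" "sset Y y"
    and eq: "\<And>Z g z. g \<in> hom E Z Y \<Longrightarrow> z \<in> hom E Z U \<Longrightarrow> elem Z z (x \<cdot> g) \<longleftrightarrow> elem Z z (y \<cdot> g)"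
  shows "x = y"
proof -
  let ?\<phi> = "Conj (s_set (Var 1)) (Conj (s_set (Var 0))
       (Forall (Iff (s_mem (Var 0) (Var 2)) (s_mem (Var 0) (Var 1)))))"
  have v: "valid N 2 (Impl ?\<phi> (Equal (Var 1) (Var 0)))"
    by (rule axiom_valid) (auto simp: Set_INFU_def set_ext_def L_Set_def Iff_def)
  have es: "env_in U Y 2 [y, x]" using env2 xy by blast
  have "forces N ?\<phi> Y [y, x]"
    using s eq by (simp add: forces_Forall_Iff[OF es] del: forces.simps(2,7))
  with v es have "forces N (Equal (Var 1) (Var 0)) Y [y, x]"
    using forces_ImplD[OF _ es] unfolding valid_def by blast
  then show ?thesis by simp
qed

lemma elem_sset:
  assumes "z \<in> hom E Y U" "x \<in> hom E Y U" "elem Y z x"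
  shows "sset Y x"
proof -
  have v: "valid N 2 (Impl (s_mem (Var 1) (Var 0)) (s_set (Var 0)))"
    by (rule axiom_valid) (auto simp: Set_INFU_def set_sethood_def L_Set_def)
  have es: "env_in U Y 2 [x, z]" using env2 assms by blast
  have "forces N (s_mem (Var 1) (Var 0)) Y [x, z]" using assms(3) by (simp del: forces.simps)
  with v es have "forces N (s_set (Var 0)) Y [x, z]"
    using forces_ImplD[OF _ es] unfolding valid_def by blast
  then show ?thesis by (simp del: forces.simps)
qed

lemma opair_inject:
  assumes h: "x \<in> hom E Y U" "y \<in> hom E Y U" "x' \<in> hom E Y U" "y' \<in> hom E Y U"
    and eq: "opair Y x y = opair Y x' y'"
  shows "x = x' \<and> y = y'"
proof -
  let ?\<phi> = "Equal (s_pair (Var 3) (Var 2)) (s_pair (Var 1) (Var 0))"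
  let ?\<psi> = "Conj (Equal (Var 3) (Var 1)) (Equal (Var 2) (Var 0))"
  have v: "valid N 4 (Impl ?\<phi> ?\<psi>)"
    by (rule axiom_valid) (auto simp: Set_INFU_def set_pair_inj_def L_Set_def)
  have es: "env_in U Y 4 [y', x', y, x]" using env4 h by blast
  have "forces N ?\<phi> Y [y', x', y, x]" using eq by (simp del: tm_at.simps)
  with v es have "forces N ?\<psi> Y [y', x', y, x]"
    using forces_ImplD[OF _ es] unfolding valid_def by blast
  then show ?thesis by simp
qed

abbreviation "PU \<equiv> pow_ob U"

text \<open>
  As maps to the power object, \<open>extension\<close> sends \<open>x\<close> to \<open>{z. z \<in> x}\<close>, \<open>singleton\<close> sends \<open>x\<close> to
  \<open>{x}\<close>, and \<open>codes\<close> sends \<open>X\<close> to the collection of sets with extension \<open>X\<close>.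
\<close>

definition "extension = compr U U (\<lambda>p. elem (Dom E p) (pr2 E U U \<cdot> p) (pr1 E U U \<cdot> p))"
definition "singleton = compr U U (\<lambda>p. pr2 E U U \<cdot> p = pr1 E U U \<cdot> p)"
definition "codes = compr PU U (\<lambda>p. sset (Dom E p) (pr2 E PU U \<cdot> p) \<and> (extension \<cdot> pr2 E PU U) \<cdot> p = pr1 E PU U \<cdot> p)"

lemma extension:
  shows extension_hom: "extension \<in> hom E U PU"
    and isin_extension: "x \<in> hom E Y U \<Longrightarrow> z \<in> hom E Y U \<Longrightarrow> isin U z (extension \<cdot> x) \<longleftrightarrow> elem Y z x"
proof -
  have *: "definable (prd E U U) (\<lambda>p. elem (Dom E p) (pr2 E U U \<cdot> p) (pr1 E U U \<cdot> p))"
    by (rule elem_definable) (simp_all add: pr_hom)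
  note c = compr[OF this, folded extension_def]
  show "extension \<in> hom E U PU" using c(1) by simp
  show "x \<in> hom E Y U \<Longrightarrow> z \<in> hom E Y U \<Longrightarrow> isin U z (extension \<cdot> x) \<longleftrightarrow> elem Y z x"
    using c(2)[of x Y z] by (simp add: hom_def)
qed

lemma singleton:
  shows singleton_hom: "singleton \<in> hom E U PU"
    and isin_singleton: "x \<in> hom E Y U \<Longrightarrow> z \<in> hom E Y U \<Longrightarrow> isin U z (singleton \<cdot> x) \<longleftrightarrow> z = x"
proof -
  have *: "definable (prd E U U) (\<lambda>p. pr2 E U U \<cdot> p = pr1 E U U \<cdot> p)"
    by (rule definable_eq[of _ _ U]) (simp_all add: pr_hom)
  note c = compr[OF this, folded singleton_def]
  show "singleton \<in> hom E U PU" using c(1) by simp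
  show "x \<in> hom E Y U \<Longrightarrow> z \<in> hom E Y U \<Longrightarrow> isin U z (singleton \<cdot> x) \<longleftrightarrow> z = x"
    using c(2)[of x Y z] by (simp add: hom_def)
qed

lemma codes:
  shows codes_hom: "codes \<in> hom E PU PU"
    and isin_codes: "X \<in> hom E Y PU \<Longrightarrow> z \<in> hom E Y U \<Longrightarrow> isin U z (codes \<cdot> X) \<longleftrightarrow> sset Y z \<and> extension \<cdot> z = X"
proof -
  have 1: "definable (prd E PU U) (\<lambda>p. sset (Dom E p) (pr2 E PU U \<cdot> p))"
    by (rule sset_definable) (simp add: pr_hom)
  have 2: "definable (prd E PU U) (\<lambda>p. (extension \<cdot> pr2 E PU U) \<cdot> p = pr1 E PU U \<cdot> p)"
    by (rule definable_eq[of _ _ PU]) (use comp_hom[OF pr_hom(2) extension_hom] in \<open>simp_all add: pr_hom\<close>)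
  note c = compr[OF definable_conj[OF 1 2], folded codes_def]
  show "codes \<in> hom E PU PU" using c(1) by simp
  show "X \<in> hom E Y PU \<Longrightarrow> z \<in> hom E Y U \<Longrightarrow> isin U z (codes \<cdot> X) \<longleftrightarrow> sset Y z \<and> extension \<cdot> z = X"
    using c(2)[of X Y z] extension_hom by (simp add: hom_def)
qed

text \<open>
  The first component of \<open>kappa X\<close> is \<open>X\<close> and the second component of \<open>iota x\<close> is \<open>{x}\<close>, so both are
  monic.  The other two components make \<open>iota\<close> and \<open>kappa\<close> agree on the sets and their extensions.
\<close>

definition "C = prd E PU PU"
definition "iota = pairing E extension singleton"
definition "kappa = pairing E (Idm E PU) codes"

lemma C_Ob [simp]: "C \<in> Ob E"
  by (simp add: C_def)

lemma iota_hom: "iota \<in> hom E U C"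
  unfolding iota_def C_def by (rule pairing_hom[OF extension_hom singleton_hom])

lemma kappa_hom: "kappa \<in> hom E PU C"
  unfolding kappa_def C_def by (rule pairing_hom[OF Idm_hom codes_hom]) simp

lemma iota_comp: "x \<in> hom E Y U \<Longrightarrow> iota \<cdot> x = pairing E (extension \<cdot> x) (singleton \<cdot> x)"
  unfolding iota_def using extension_hom singleton_hom by (simp add: hom_def)

lemma kappa_comp: "X \<in> hom E Y PU \<Longrightarrow> kappa \<cdot> X = pairing E X (codes \<cdot> X)"
  unfolding kappa_def using codes_hom by (simp add: hom_def)

lemma iota_inject:
  assumes "x \<in> hom E Y U" "y \<in> hom E Y U" "iota \<cdot> x = iota \<cdot> y"
  shows "x = y"
proof -
  have "singleton \<cdot> x = singleton \<cdot> y"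
    using assms extension_hom singleton_hom by (auto simp: iota_comp hom_def)
  then show ?thesis
    using isin_singleton[OF assms(1,1)] isin_singleton[OF assms(2,1)] by simp
qed

lemma kappa_inject:
  assumes "X \<in> hom E Y PU" "X' \<in> hom E Y PU" "kappa \<cdot> X = kappa \<cdot> X'"
  shows "X = X'"
  using assms codes_hom by (auto simp: kappa_comp hom_def)

text \<open>
  If \<open>{x}\<close> is the collection of sets with extension \<open>X\<close>, then \<open>x\<close> is one of these.  Conversely, if \<open>x\<close> is a set with
  extension \<open>X\<close>, then by extensionality, applied at all later stages, it is the only one.
\<close>

lemma iota_eq_kappa_iff:
  assumes x: "x \<in> hom E Y U" and X: "X \<in> hom E Y PU"
  shows "iota \<cdot> x = kappa \<cdot> X \<longleftrightarrow> sset Y x \<and> extension \<cdot> x = X"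
proof -
  have "iota \<cdot> x = kappa \<cdot> X \<longleftrightarrow> extension \<cdot> x = X \<and> singleton \<cdot> x = codes \<cdot> X"
    unfolding iota_comp[OF x] kappa_comp[OF X]
    using x X extension_hom singleton_hom codes_hom by (simp add: hom_def)
  also have "\<dots> \<longleftrightarrow> sset Y x \<and> extension \<cdot> x = X"
  proof (intro iffI conjI; elim conjE)
    assume "extension \<cdot> x = X" "singleton \<cdot> x = codes \<cdot> X"
    then have "isin U x (codes \<cdot> X)" using isin_singleton[OF x x] by simp
    then show "sset Y x" using isin_codes[OF X x] by simp
  next
    assume sx: "sset Y x" and ex: "extension \<cdot> x = X"
    show "singleton \<cdot> x = codes \<cdot> X"
    proof (rule power_ext[OF comp_hom[OF x singleton_hom] comp_hom[OF X codes_hom] U_Ob])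
      fix Z g z assume g: "g \<in> hom E Z Y" and z: "z \<in> hom E Z U"
      have xg: "x \<cdot> g \<in> hom E Z U" and Xg: "X \<cdot> g \<in> hom E Z PU"
        using comp_hom g x X by blast+
      have eg: "extension \<cdot> x \<cdot> g = X \<cdot> g"
        unfolding ex[symmetric] using x g extension_hom by (simp add: hom_def)
      have sxg: "sset Z (x \<cdot> g)"
        using definable_persistent[OF sset_definable[OF x], of "Idm E Y" g] sx x g hom_Ob[OF g]
        by (simp add: hom_def)
      have "isin U z ((singleton \<cdot> x) \<cdot> g) \<longleftrightarrow> z = x \<cdot> g"
        using isin_singleton[OF xg z] x g singleton_hom by (simp add: hom_def)
      moreover have "isin U z ((codes \<cdot> X) \<cdot> g) \<longleftrightarrow> sset Z z \<and> extension \<cdot> z = X \<cdot> g"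
        using isin_codes[OF Xg z] X g codes_hom by (simp add: hom_def)
      moreover have "z = x \<cdot> g" if "sset Z z" "extension \<cdot> z = X \<cdot> g"
      proof (rule set_extensionality[OF z xg that(1) sxg])
        fix V k v assume k: "k \<in> hom E V Z" and v: "v \<in> hom E V U"
        have "extension \<cdot> z \<cdot> k = (extension \<cdot> z) \<cdot> k" using extension_hom z k by (simp add: hom_def)
        also have "\<dots> = (extension \<cdot> x \<cdot> g) \<cdot> k" using that eg by simp
        also have "\<dots> = extension \<cdot> (x \<cdot> g) \<cdot> k" using extension_hom xg k by (simp add: hom_def)
        finally show "elem V v (z \<cdot> k) \<longleftrightarrow> elem V v ((x \<cdot> g) \<cdot> k)"
          using isin_extension[OF comp_hom[OF k z] v] isin_extension[OF comp_hom[OF k xg] v] by simp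
      qed
      ultimately show "isin U z ((singleton \<cdot> x) \<cdot> g) \<longleftrightarrow> isin U z ((codes \<cdot> X) \<cdot> g)"
        using sxg eg by auto
    qed
  qed
  finally show ?thesis .
qed

lemma PU_Ob: "PU \<in> Ob E" by simp

section \<open>The class structure\<close>

definition memb_incl :: 'm where
  "memb_incl = (SOME m. is_mono E m \<and> Cod E m = prd E U PU \<and>
     (\<forall>p \<in> into (prd E U PU). factors E p m \<longleftrightarrow> isin U (pr1 E U PU \<cdot> p) (pr2 E U PU \<cdot> p)))"

lemma memb_incl:
  "is_mono E memb_incl" "Cod E memb_incl = prd E U PU"
  "p \<in> Ar E \<Longrightarrow> Cod E p = prd E U PU \<Longrightarrow> factors E p memb_incl \<longleftrightarrow> isin U (pr1 E U PU \<cdot> p) (pr2 E U PU \<cdot> p)"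
proof -
  have "definable (prd E U PU) (\<lambda>p. isin U (pr1 E U PU \<cdot> p) (pr2 E U PU \<cdot> p))"
    by (rule isin_definable) (simp_all add: pr_hom)
  then obtain W where W: "W \<in> Sub E (prd E U PU)"
    "\<And>p. p \<in> into (prd E U PU) \<Longrightarrow> p \<in>\<^sub>E W \<longleftrightarrow> isin U (pr1 E U PU \<cdot> p) (pr2 E U PU \<cdot> p)"
    using definable_Sub by blast
  then have "\<exists>m. is_mono E m \<and> Cod E m = prd E U PU \<and>
     (\<forall>p \<in> into (prd E U PU). factors E p m \<longleftrightarrow> isin U (pr1 E U PU \<cdot> p) (pr2 E U PU \<cdot> p))"
    by (elim SubE) auto
  from someI_ex[OF this, folded memb_incl_def] show "is_mono E memb_incl" "Cod E memb_incl = prd E U PU"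
    "p \<in> Ar E \<Longrightarrow> Cod E p = prd E U PU \<Longrightarrow> factors E p memb_incl \<longleftrightarrow> isin U (pr1 E U PU \<cdot> p) (pr2 E U PU \<cdot> p)"
    by auto
qed

lemma memb_incl_Ar [simp]: "memb_incl \<in> Ar E"
  using memb_incl(1) by (rule mono_Ar)

lemma iota_arr [simp]: "x \<in> hom E Y U \<Longrightarrow> iota \<cdot> x \<in> hom E Y C"
  by (rule comp_hom[OF _ iota_hom])

lemma kappa_arr [simp]: "X \<in> hom E Y PU \<Longrightarrow> kappa \<cdot> X \<in> hom E Y C"
  by (rule comp_hom[OF _ kappa_hom])

definition "setom_rel = image_rel U [iota]"
definition "class_rel = image_rel PU [kappa]"
definition "mem_rel = image_rel (Dom E memb_incl) [iota \<cdot> pr1 E U PU \<cdot> memb_incl, kappa \<cdot> pr2 E U PU \<cdot> memb_incl]"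
definition "pair_rel = image_rel (prd E U U)
  [iota \<cdot> pr1 E U U, iota \<cdot> pr2 E U U, iota \<cdot> opair (prd E U U) (pr1 E U U) (pr2 E U U)]"

lemma setom_rel:
  shows "setom_rel \<in> Sub E (obj_pow E C 1)"
    and "a \<in> hom E Y C \<Longrightarrow> tuple E Y [a] \<in>\<^sub>E setom_rel \<longleftrightarrow> (\<exists>x \<in> hom E Y U. a = iota \<cdot> x)"
proof -
  note i = image_rel[OF env1[OF iota_hom], folded setom_rel_def]
  have cancel: "f = g" if "f \<in> hom E X U" "g \<in> hom E X U" "restr [iota] f = restr [iota] g" for X f g
    using iota_inject[OF that(1,2)] that(3) by simp
  show "setom_rel \<in> Sub E (obj_pow E C 1)"
    by (rule i(1)[OF cancel])
  assume "a \<in> hom E Y C"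
  from i(2)[OF cancel env1[OF this]]
  show "tuple E Y [a] \<in>\<^sub>E setom_rel \<longleftrightarrow> (\<exists>x \<in> hom E Y U. a = iota \<cdot> x)"
    by simp
qed

lemma class_rel:
  shows "class_rel \<in> Sub E (obj_pow E C 1)"
    and "a \<in> hom E Y C \<Longrightarrow> tuple E Y [a] \<in>\<^sub>E class_rel \<longleftrightarrow> (\<exists>X \<in> hom E Y PU. a = kappa \<cdot> X)"
proof -
  note i = image_rel[OF env1[OF kappa_hom], folded class_rel_def]
  have cancel: "f = g" if "f \<in> hom E X PU" "g \<in> hom E X PU" "restr [kappa] f = restr [kappa] g" for X f g
    using kappa_inject[OF that(1,2)] that(3) by simp
  show "class_rel \<in> Sub E (obj_pow E C 1)"
    by (rule i(1)[OF cancel])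
  assume "a \<in> hom E Y C"
  from i(2)[OF cancel env1[OF this]]
  show "tuple E Y [a] \<in>\<^sub>E class_rel \<longleftrightarrow> (\<exists>X \<in> hom E Y PU. a = kappa \<cdot> X)"
    by simp
qed

lemma mem_rel:
  shows "mem_rel \<in> Sub E (obj_pow E C 2)"
    and "a \<in> hom E Y C \<Longrightarrow> b \<in> hom E Y C \<Longrightarrow> tuple E Y [a, b] \<in>\<^sub>E mem_rel \<longleftrightarrow>
      (\<exists>x \<in> hom E Y U. \<exists>X \<in> hom E Y PU. a = iota \<cdot> x \<and> b = kappa \<cdot> X \<and> isin U x X)"
proof -
  let ?p = "pr1 E U PU" let ?q = "pr2 E U PU" let ?m = memb_incl
  have m: "?m \<in> hom E (Dom E ?m) (prd E U PU)"
    using memb_incl(2) by (simp add: hom_def)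
  have p1: "?p \<cdot> ?m \<in> hom E (Dom E ?m) U" and p2: "?q \<cdot> ?m \<in> hom E (Dom E ?m) PU"
    using comp_hom[OF m] pr_hom by simp_all
  have r: "restr [iota \<cdot> ?p \<cdot> ?m, kappa \<cdot> ?q \<cdot> ?m] f =
      [iota \<cdot> ?p \<cdot> ?m \<cdot> f, kappa \<cdot> ?q \<cdot> ?m \<cdot> f]"
    and c: "?p \<cdot> ?m \<cdot> f \<in> hom E X U" "?q \<cdot> ?m \<cdot> f \<in> hom E X PU" if "f \<in> hom E X (Dom E ?m)" for X f
    using that m iota_hom kappa_hom by (simp_all add: hom_def)
  note i = image_rel[OF env2[OF iota_arr[OF p1] kappa_arr[OF p2]], folded mem_rel_def]
  have cancel: "f = g" if fg: "f \<in> hom E X (Dom E ?m)" "g \<in> hom E X (Dom E ?m)"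
    and eq: "restr [iota \<cdot> ?p \<cdot> ?m, kappa \<cdot> ?q \<cdot> ?m] f =
      restr [iota \<cdot> ?p \<cdot> ?m, kappa \<cdot> ?q \<cdot> ?m] g" for X f g
  proof -
    note eq' = eq[unfolded r[OF fg(1)] r[OF fg(2)] list.inject]
    have "?p \<cdot> ?m \<cdot> f = ?p \<cdot> ?m \<cdot> g"
      by (rule iota_inject[OF c(1)[OF fg(1)] c(1)[OF fg(2)] eq'[THEN conjunct1]])
    moreover have "?q \<cdot> ?m \<cdot> f = ?q \<cdot> ?m \<cdot> g"
      by (rule kappa_inject[OF c(2)[OF fg(1)] c(2)[OF fg(2)] eq'[THEN conjunct2, THEN conjunct1]])
    moreover have "?m \<cdot> f \<in> hom E X (prd E U PU)" "?m \<cdot> g \<in> hom E X (prd E U PU)"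
      using comp_hom m fg by blast+
    ultimately have "?m \<cdot> f = ?m \<cdot> g"
      by (rule prd_hom_ext[OF _ _ U_Ob PU_Ob, rotated 2])
    then show "f = g"
      by (rule mono_cancel[OF memb_incl(1), rotated 4]) (use fg in \<open>simp_all add: hom_def\<close>)
  qed
  show "mem_rel \<in> Sub E (obj_pow E C 2)"
    by (rule i(1)[OF cancel])
  assume ab: "a \<in> hom E Y C" "b \<in> hom E Y C"
  have "tuple E Y [a, b] \<in>\<^sub>E mem_rel \<longleftrightarrow>
      (\<exists>h \<in> hom E Y (Dom E ?m). a = iota \<cdot> ?p \<cdot> ?m \<cdot> h \<and> b = kappa \<cdot> ?q \<cdot> ?m \<cdot> h)"
    using i(2)[OF cancel env2[OF ab]] r by simp
  also have "\<dots> \<longleftrightarrow> (\<exists>x \<in> hom E Y U. \<exists>X \<in> hom E Y PU. a = iota \<cdot> x \<and> b = kappa \<cdot> X \<and> isin U x X)"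
  proof
    assume "\<exists>h \<in> hom E Y (Dom E ?m). a = iota \<cdot> ?p \<cdot> ?m \<cdot> h \<and> b = kappa \<cdot> ?q \<cdot> ?m \<cdot> h"
    then obtain h where h: "h \<in> hom E Y (Dom E ?m)" "a = iota \<cdot> ?p \<cdot> ?m \<cdot> h" "b = kappa \<cdot> ?q \<cdot> ?m \<cdot> h"
      by blast
    have "factors E (?m \<cdot> h) ?m"
      unfolding factors_def using h(1) m by (auto simp: hom_def)
    then have "isin U (?p \<cdot> ?m \<cdot> h) (?q \<cdot> ?m \<cdot> h)"
      using memb_incl(3)[of "?m \<cdot> h"] h(1) m by (simp add: hom_def)
    with h c[OF h(1)] show "\<exists>x \<in> hom E Y U. \<exists>X \<in> hom E Y PU. a = iota \<cdot> x \<and> b = kappa \<cdot> X \<and> isin U x X"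
      by blast
  next
    assume "\<exists>x \<in> hom E Y U. \<exists>X \<in> hom E Y PU. a = iota \<cdot> x \<and> b = kappa \<cdot> X \<and> isin U x X"
    then obtain x X where x: "x \<in> hom E Y U" "X \<in> hom E Y PU" "a = iota \<cdot> x" "b = kappa \<cdot> X" "isin U x X"
      by blast
    have pp: "?p \<cdot> pairing E x X = x" "?q \<cdot> pairing E x X = X"
      using x(1,2) by (simp_all add: hom_def)
    then have "factors E (pairing E x X) ?m"
      using memb_incl(3)[of "pairing E x X"] x(1,2,5) by (simp add: hom_def)
    then obtain h where h: "h \<in> hom E (Dom E (pairing E x X)) (Dom E ?m)" "?m \<cdot> h = pairing E x X"
      unfolding factors_def by blast
    then have "h \<in> hom E Y (Dom E ?m)" using x by (simp add: hom_def)
    with h(2) pp x show "\<exists>h \<in> hom E Y (Dom E ?m). a = iota \<cdot> ?p \<cdot> ?m \<cdot> h \<and> b = kappa \<cdot> ?q \<cdot> ?m \<cdot> h"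
      by (intro bexI[of _ h]) simp_all
  qed
  finally show "tuple E Y [a, b] \<in>\<^sub>E mem_rel \<longleftrightarrow>
      (\<exists>x \<in> hom E Y U. \<exists>X \<in> hom E Y PU. a = iota \<cdot> x \<and> b = kappa \<cdot> X \<and> isin U x X)" .
qed

lemma pair_rel:
  shows "pair_rel \<in> Sub E (obj_pow E C 3)"
    and "a \<in> hom E Y C \<Longrightarrow> b \<in> hom E Y C \<Longrightarrow> c \<in> hom E Y C \<Longrightarrow> tuple E Y [a, b, c] \<in>\<^sub>E pair_rel \<longleftrightarrow>
      (\<exists>x \<in> hom E Y U. \<exists>y \<in> hom E Y U. a = iota \<cdot> x \<and> b = iota \<cdot> y \<and> c = iota \<cdot> opair Y x y)"
proof -
  let ?D = "prd E U U" let ?p = "pr1 E U U" let ?q = "pr2 E U U"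
  have p: "?p \<in> hom E ?D U" "?q \<in> hom E ?D U" by (simp_all add: pr_hom)
  let ?ms = "[iota \<cdot> ?p, iota \<cdot> ?q, iota \<cdot> opair ?D ?p ?q]"
  have r: "restr ?ms f = [iota \<cdot> ?p \<cdot> f, iota \<cdot> ?q \<cdot> f, iota \<cdot> opair X (?p \<cdot> f) (?q \<cdot> f)]"
    if "f \<in> hom E X ?D" for X f
    using that p iota_hom opair_hom[OF p] opair_comp[OF p that] by (simp add: hom_def)
  have c: "?p \<cdot> f \<in> hom E X U" "?q \<cdot> f \<in> hom E X U" if "f \<in> hom E X ?D" for X f
    using comp_hom[OF that] p by simp_all
  note i = image_rel[OF env3[OF iota_arr[OF p(1)] iota_arr[OF p(2)] iota_arr[OF opair_hom[OF p]]], folded pair_rel_def]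
  have cancel: "f = g" if fg: "f \<in> hom E X ?D" "g \<in> hom E X ?D" and eq: "restr ?ms f = restr ?ms g" for X f g
  proof -
    note eq' = eq[unfolded r[OF fg(1)] r[OF fg(2)] list.inject]
    have "?p \<cdot> f = ?p \<cdot> g"
      by (rule iota_inject[OF c(1)[OF fg(1)] c(1)[OF fg(2)] eq'[THEN conjunct1]])
    moreover have "?q \<cdot> f = ?q \<cdot> g"
      by (rule iota_inject[OF c(2)[OF fg(1)] c(2)[OF fg(2)] eq'[THEN conjunct2, THEN conjunct1]])
    ultimately show "f = g"
      by (rule prd_hom_ext[OF fg U_Ob U_Ob])
  qed
  show "pair_rel \<in> Sub E (obj_pow E C 3)"
    by (rule i(1)[OF cancel])
  assume abc: "a \<in> hom E Y C" "b \<in> hom E Y C" "c \<in> hom E Y C"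
  have "tuple E Y [a, b, c] \<in>\<^sub>E pair_rel \<longleftrightarrow>
      (\<exists>h \<in> hom E Y ?D. a = iota \<cdot> ?p \<cdot> h \<and> b = iota \<cdot> ?q \<cdot> h \<and> c = iota \<cdot> opair Y (?p \<cdot> h) (?q \<cdot> h))"
    using i(2)[OF cancel env3[OF abc]] r by simp
  also have "\<dots> \<longleftrightarrow> (\<exists>x \<in> hom E Y U. \<exists>y \<in> hom E Y U. a = iota \<cdot> x \<and> b = iota \<cdot> y \<and> c = iota \<cdot> opair Y x y)"
  proof
    assume "\<exists>x \<in> hom E Y U. \<exists>y \<in> hom E Y U. a = iota \<cdot> x \<and> b = iota \<cdot> y \<and> c = iota \<cdot> opair Y x y"
    then obtain x y where xy: "x \<in> hom E Y U" "y \<in> hom E Y U" "a = iota \<cdot> x" "b = iota \<cdot> y" "c = iota \<cdot> opair Y x y"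
      by blast
    have "?p \<cdot> pairing E x y = x" "?q \<cdot> pairing E x y = y" "pairing E x y \<in> hom E Y ?D"
      using xy(1,2) by (simp_all add: hom_def)
    with xy show "\<exists>h \<in> hom E Y ?D. a = iota \<cdot> ?p \<cdot> h \<and> b = iota \<cdot> ?q \<cdot> h \<and> c = iota \<cdot> opair Y (?p \<cdot> h) (?q \<cdot> h)"
      by (intro bexI[of _ "pairing E x y"]) simp_all
  qed (use c in blast)
  finally show "tuple E Y [a, b, c] \<in>\<^sub>E pair_rel \<longleftrightarrow>
      (\<exists>x \<in> hom E Y U. \<exists>y \<in> hom E Y U. a = iota \<cdot> x \<and> b = iota \<cdot> y \<and> c = iota \<cdot> opair Y x y)" .
qed

text \<open>
  Membership is defined between setoms and classes only.  Sets have members because they are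
  classes as well.
\<close>

definition Cstruc :: "('o, 'm, unit, class_rel) struc" where
  "Cstruc = \<lparr>carrier = C, fun_int = (\<lambda>_. Idm E C),
    rel_int = (\<lambda>r. case r of CMem \<Rightarrow> mem_rel | CSet \<Rightarrow> sub_meet E (obj_pow E C 1) setom_rel class_rel
      | CClass \<Rightarrow> class_rel | CSetom \<Rightarrow> setom_rel | CPair \<Rightarrow> pair_rel)\<rparr>"

lemma carrier_Cstruc [simp]: "carrier Cstruc = C"
  by (simp add: Cstruc_def)

lemma is_struc_Cstruc: "is_struc E L_Class Cstruc"
  using mem_rel(1) setom_rel(1) class_rel(1) pair_rel(1) sub_meet_props(1)[OF setom_rel(1) class_rel(1)]
  by (auto simp: is_struc_def L_Class_def Cstruc_def split: class_rel.splits)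

definition Setom :: "'o \<Rightarrow> 'm \<Rightarrow> bool" where
  "Setom Y a \<longleftrightarrow> (\<exists>x \<in> hom E Y U. a = iota \<cdot> x)"

definition Cls :: "'o \<Rightarrow> 'm \<Rightarrow> bool" where
  "Cls Y a \<longleftrightarrow> (\<exists>X \<in> hom E Y PU. a = kappa \<cdot> X)"

definition cmem :: "'o \<Rightarrow> 'm \<Rightarrow> 'm \<Rightarrow> bool" where
  "cmem Y a b \<longleftrightarrow> (\<exists>x \<in> hom E Y U. \<exists>X \<in> hom E Y PU. a = iota \<cdot> x \<and> b = kappa \<cdot> X \<and> isin U x X)"

definition cpair :: "'o \<Rightarrow> 'm \<Rightarrow> 'm \<Rightarrow> 'm \<Rightarrow> bool" where
  "cpair Y a b c \<longleftrightarrow> (\<exists>x \<in> hom E Y U. \<exists>y \<in> hom E Y U. a = iota \<cdot> x \<and> b = iota \<cdot> y \<and> c = iota \<cdot> opair Y x y)"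

lemma set_rel_iff:
  assumes "a \<in> hom E Y C"
  shows "tuple E Y [a] \<in>\<^sub>E sub_meet E (obj_pow E C 1) setom_rel class_rel \<longleftrightarrow> Setom Y a \<and> Cls Y a"
proof -
  have "tuple E Y [a] \<in> Ar E \<and> Cod E (tuple E Y [a]) = obj_pow E C 1"
    using env_hom[OF env1[OF assms]] by (simp add: tuple_env hom_def)
  then show ?thesis
    using sub_meet_props(2)[OF setom_rel(1) class_rel(1)] setom_rel(2)[OF assms] class_rel(2)[OF assms]
    by (simp add: Setom_def Cls_def)
qed

lemma forces_class_atoms [simp]:
  assumes "es ! i \<in> hom E Y C"
  shows "forces Cstruc (c_setom (Var i)) Y es \<longleftrightarrow> Setom Y (es ! i)"
    and "forces Cstruc (c_class (Var i)) Y es \<longleftrightarrow> Cls Y (es ! i)"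
    and "forces Cstruc (c_set (Var i)) Y es \<longleftrightarrow> Setom Y (es ! i) \<and> Cls Y (es ! i)"
    and "es ! j \<in> hom E Y C \<Longrightarrow> forces Cstruc (c_mem (Var i) (Var j)) Y es \<longleftrightarrow> cmem Y (es ! i) (es ! j)"
    and "es ! j \<in> hom E Y C \<Longrightarrow> es ! k \<in> hom E Y C \<Longrightarrow>
      forces Cstruc (c_pair (Var i) (Var j) (Var k)) Y es \<longleftrightarrow> cpair Y (es ! i) (es ! j) (es ! k)"
  using assms set_rel_iff setom_rel(2) class_rel(2) mem_rel(2) pair_rel(2)
  by (simp_all add: Setom_def Cls_def cmem_def cpair_def Cstruc_def)

lemma Setom_iota [simp]: "x \<in> hom E Y U \<Longrightarrow> Setom Y (iota \<cdot> x)"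
  by (auto simp: Setom_def)

lemma Cls_kappa [simp]: "X \<in> hom E Y PU \<Longrightarrow> Cls Y (kappa \<cdot> X)"
  by (auto simp: Cls_def)

lemma Cls_iota [simp]:
  assumes "x \<in> hom E Y U"
  shows "Cls Y (iota \<cdot> x) \<longleftrightarrow> sset Y x"
  unfolding Cls_def using iota_eq_kappa_iff[OF assms] comp_hom[OF assms extension_hom] by auto

lemma cmem_kappa [simp]:
  assumes "z \<in> hom E Y U" "X \<in> hom E Y PU"
  shows "cmem Y (iota \<cdot> z) (kappa \<cdot> X) \<longleftrightarrow> isin U z X"
  unfolding cmem_def using iota_inject[OF assms(1)] kappa_inject[OF assms(2)] assms by blast

text \<open>
  The setom \<open>iota x\<close> is a class only through its extension, and if \<open>x\<close> has an element then it is a set.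
\<close>

lemma cmem_iota [simp]:
  assumes z: "z \<in> hom E Y U" and x: "x \<in> hom E Y U"
  shows "cmem Y (iota \<cdot> z) (iota \<cdot> x) \<longleftrightarrow> elem Y z x"
proof -
  have "cmem Y (iota \<cdot> z) (iota \<cdot> x) \<longleftrightarrow> (\<exists>X \<in> hom E Y PU. sset Y x \<and> extension \<cdot> x = X \<and> isin U z X)"
    unfolding cmem_def using iota_inject[OF z] iota_eq_kappa_iff[OF x] z by blast
  also have "\<dots> \<longleftrightarrow> elem Y z x"
    using comp_hom[OF x extension_hom] isin_extension[OF x z] elem_sset[OF z x] by auto
  finally show ?thesis .
qed

lemma cpair_iota [simp]:
  assumes "x \<in> hom E Y U" "y \<in> hom E Y U" "z \<in> hom E Y U"
  shows "cpair Y (iota \<cdot> x) (iota \<cdot> y) (iota \<cdot> z) \<longleftrightarrow> opair Y x y = z"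
proof
  assume "cpair Y (iota \<cdot> x) (iota \<cdot> y) (iota \<cdot> z)"
  then obtain x' y' where xy: "x' \<in> hom E Y U" "y' \<in> hom E Y U" "iota \<cdot> x = iota \<cdot> x'"
    "iota \<cdot> y = iota \<cdot> y'" "iota \<cdot> z = iota \<cdot> opair Y x' y'"
    unfolding cpair_def by blast
  then have "x = x'" "y = y'" "z = opair Y x' y'"
    using iota_inject opair_hom assms by blast+
  then show "opair Y x y = z" by simp
qed (use assms in \<open>auto simp: cpair_def\<close>)

end

section \<open>From class formulas to set formulas\<close>

fun set_tm_of :: "unit tm \<Rightarrow> set_fun tm" where
  "set_tm_of (Var i) = Var i"
| "set_tm_of (Fun f ts) = Var 0"

text \<open>
  On setoms, sethood and classhood are the same, \<open>Setom\<close> is trivially true, and the pairing relation is the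
  graph of the pairing function.  The lists have the length prescribed by the arity, so that \<open>hd\<close> and
  indexing are safe.
\<close>

fun set_rel_fm :: "class_rel \<Rightarrow> set_fun tm list \<Rightarrow> set_fm" where
  "set_rel_fm CMem ts = Rel SMem ts"
| "set_rel_fm CSet ts = Rel SSet ts"
| "set_rel_fm CClass ts = Rel SSet ts"
| "set_rel_fm CSetom ts = Equal (hd ts) (hd ts)"
| "set_rel_fm CPair ts = Equal (s_pair (ts ! 0) (ts ! 1)) (ts ! 2)"

text \<open>
  A quantifier bounded to \<open>Setom\<close> becomes a quantifier guarded by a trivial equation.  Leaving these guards in
  place makes the translation a plain recursion over all formulas.
\<close>

primrec set_fm_of :: "class_fm \<Rightarrow> set_fm" where
  "set_fm_of (Equal t u) = Equal (set_tm_of t) (set_tm_of u)"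
| "set_fm_of (Rel r ts) = set_rel_fm r (map set_tm_of ts)"
| "set_fm_of Falsum = Falsum"
| "set_fm_of (Conj \<phi> \<psi>) = Conj (set_fm_of \<phi>) (set_fm_of \<psi>)"
| "set_fm_of (Disj \<phi> \<psi>) = Disj (set_fm_of \<phi>) (set_fm_of \<psi>)"
| "set_fm_of (Impl \<phi> \<psi>) = Impl (set_fm_of \<phi>) (set_fm_of \<psi>)"
| "set_fm_of (Forall \<phi>) = Forall (set_fm_of \<phi>)"
| "set_fm_of (Exists \<phi>) = Exists (set_fm_of \<phi>)"

lemma wf_tm_L_Class: "wf_tm L_Class n t \<longleftrightarrow> (\<exists>i < n. t = Var i)"
  by (cases t) (auto simp: L_Class_def)

lemma length_cases:
  "length xs = Suc 0 \<longleftrightarrow> (\<exists>a. xs = [a])"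
  "length xs = 2 \<longleftrightarrow> (\<exists>a b. xs = [a, b])"
  "length xs = 3 \<longleftrightarrow> (\<exists>a b c. xs = [a, b, c])"
  "length xs = 4 \<longleftrightarrow> (\<exists>a b c d. xs = [a, b, c, d])"
  by (auto simp: length_Suc_conv eval_nat_numeral)

lemma wf_Rel_cases:
  assumes "wf_fm L_Class n (Rel r ts)"
  obtains (mem) i j where "r = CMem" "ts = [Var i, Var j]" "i < n" "j < n"
  | (set) i where "r = CSet" "ts = [Var i]" "i < n"
  | (cls) i where "r = CClass" "ts = [Var i]" "i < n"
  | (setom) i where "r = CSetom" "ts = [Var i]" "i < n"
  | (pair) i j k where "r = CPair" "ts = [Var i, Var j, Var k]" "i < n" "j < n" "k < n"
proof -
  have ts: "\<forall>t \<in> set ts. wf_tm L_Class n t"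
    using assms by simp
  have len: "Some (length ts) = (case r of CMem \<Rightarrow> Some 2 | CSet \<Rightarrow> Some 1 | CClass \<Rightarrow> Some 1
                    | CSetom \<Rightarrow> Some 1 | CPair \<Rightarrow> Some 3)"
    using assms by (simp add: L_Class_def)
  show thesis
    using ts len that by (cases r) (auto simp: length_cases wf_tm_L_Class)
qed

lemma wf_set_fm_of: "wf_fm L_Class n \<phi> \<Longrightarrow> wf_fm L_Set n (set_fm_of \<phi>)"
proof (induction \<phi> arbitrary: n)
  case (Equal t u)
  then show ?case by (auto simp: wf_tm_L_Class)
next
  case (Rel r ts)
  then show ?case by (cases rule: wf_Rel_cases) (auto simp: L_Set_def)
qed auto

lemma fv_set_fm_of: "wf_fm L_Class n \<phi> \<Longrightarrow> fv (set_fm_of \<phi>) \<subseteq> fv \<phi>"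
proof (induction \<phi> arbitrary: n)
  case (Equal t u)
  then show ?case by (auto simp: wf_tm_L_Class)
next
  case (Rel r ts)
  then show ?case by (cases rule: wf_Rel_cases) auto
qed fastforce+

text \<open>
  The three arguments of the pairing relation have the same type, as have the pairing term and its
  arguments; so the types of the variables can be kept.
\<close>

lemma strat_set_fm_of:
  "wf_fm L_Class n \<phi> \<Longrightarrow> strat class_typing s \<phi> \<Longrightarrow> strat set_typing s (set_fm_of \<phi>)"
proof (induction \<phi> arbitrary: n s)
  case (Equal t u)
  then show ?case by (auto simp: wf_tm_L_Class)
next
  case (Rel r ts)
  from Rel.prems(1) show ?case
    using Rel.prems(2) by (cases rule: wf_Rel_cases) (auto simp: list_all2_Cons1)
next
  case (Forall \<phi>)
  then show ?case by simp blast
next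
  case (Exists \<phi>)
  then show ?case by simp blast
qed auto

lemma wf_closure_setom: "wf_fm L_Class m (closure_setom n \<phi>) \<longleftrightarrow> wf_fm L_Class (m + n) \<phi>"
  unfolding closure_setom_def by (induction n arbitrary: m) (auto simp: Forall_setom_def L_Class_def)

context set_model begin

abbreviation iotas :: "'m list \<Rightarrow> 'm list" where
  "iotas xs \<equiv> map (\<lambda>x. iota \<cdot> x) xs"

lemma iotas_env: "env_in U Y n xs \<Longrightarrow> env_in C Y n (iotas xs)"
  by (rule env_in_map) (auto simp: env_in_Ob(1))

lemma restr_iotas:
  assumes "env_in U Y n xs" "g \<in> hom E Z Y"
  shows "restr (iotas xs) g = iotas (restr xs g)"
  using assms iota_hom by (auto simp: env_in_def hom_def)

text \<open>
  By the definition of setoms as an image, a quantifier bounded to them is a quantifier over the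
  elements of \<open>U\<close>.
\<close>

lemma forces_Forall_setom:
  assumes es: "env_in C Y n es"
  shows "forces Cstruc (Forall_setom \<phi>) Y es \<longleftrightarrow>
    (\<forall>Z. \<forall>g \<in> hom E Z Y. \<forall>x \<in> hom E Z U. forces Cstruc \<phi> Z (iota \<cdot> x # restr es g))"
proof (rule iffI, intro allI ballI)
  fix Z g x assume *: "forces Cstruc (Forall_setom \<phi>) Y es" and g: "g \<in> hom E Z Y" and x: "x \<in> hom E Z U"
  have "forces Cstruc (Impl (c_setom (Var 0)) \<phi>) Z (iota \<cdot> x # restr es g)"
    using * g x unfolding Forall_setom_def by (simp del: forces.simps(6))
  moreover have "env_in C Z (Suc n) (iota \<cdot> x # restr es g)"
    using env_in_restr[OF es g] x by simp
  ultimately show "forces Cstruc \<phi> Z (iota \<cdot> x # restr es g)"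
    by (rule forces_ImplD) (use x in \<open>simp del: forces.simps\<close>)
next
  assume R: "\<forall>Z. \<forall>g \<in> hom E Z Y. \<forall>x \<in> hom E Z U. forces Cstruc \<phi> Z (iota \<cdot> x # restr es g)"
  have "forces Cstruc \<phi> V (restr (b # restr es g) k)"
    if g: "g \<in> hom E Z Y" and b: "b \<in> hom E Z C" and k: "k \<in> hom E V Z"
      and s: "forces Cstruc (c_setom (Var 0)) V (restr (b # restr es g) k)" for Z g b V k
  proof -
    have "Setom V (b \<cdot> k)"
      using s comp_hom[OF k b] by (simp del: forces.simps)
    then obtain x where "x \<in> hom E V U" "b \<cdot> k = iota \<cdot> x"
      by (auto simp: Setom_def)
    then show ?thesis
      using R comp_hom[OF k g] unfolding list.map restr_restr[OF es g k] by simp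
  qed
  then show "forces Cstruc (Forall_setom \<phi>) Y es"
    unfolding Forall_setom_def forces.simps(6,7) carrier_Cstruc by blast
qed

lemma forces_Forall_setom_Iff:
  assumes es: "env_in C Y n es"
  shows "forces Cstruc (Forall_setom (Iff \<phi> \<psi>)) Y es \<longleftrightarrow>
    (\<forall>Z. \<forall>g \<in> hom E Z Y. \<forall>x \<in> hom E Z U.
      forces Cstruc \<phi> Z (iota \<cdot> x # restr es g) \<longleftrightarrow> forces Cstruc \<psi> Z (iota \<cdot> x # restr es g))"
  unfolding forces_Forall_setom[OF es] by (rule forces_Iff_family[OF es iota_hom])

lemma forces_closure_setom:
  assumes "\<And>Y xs. env_in U Y (m + n) xs \<Longrightarrow> forces Cstruc \<phi> Y (iotas xs)" "env_in U Y m xs"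
  shows "forces Cstruc (closure_setom n \<phi>) Y (iotas xs)"
  using assms
proof (induction n arbitrary: m Y xs)
  case 0
  then show ?case by (simp add: closure_setom_def)
next
  case (Suc n)
  have "forces Cstruc (closure_setom n \<phi>) Z (iota \<cdot> x # restr (iotas xs) g)"
    if "g \<in> hom E Z Y" "x \<in> hom E Z U" for Z g x
    using Suc.IH[of "Suc m" Z "x # restr xs g"] Suc.prems(1) that env_in_restr[OF Suc.prems(2) that(1)]
      restr_iotas[OF Suc.prems(2) that(1)] by (simp del: map_map)
  then have "forces Cstruc (Forall_setom (closure_setom n \<phi>)) Y (iotas xs)"
    unfolding forces_Forall_setom[OF iotas_env[OF Suc.prems(2)]] by blast
  then show ?case by (simp add: closure_setom_def)
qed

lemma holds_closure_setom:
  assumes "wf_fm L_Class n \<phi>" "\<And>Y xs. env_in U Y n xs \<Longrightarrow> forces Cstruc \<phi> Y (iotas xs)"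
  shows "holds E Cstruc (closure_setom n \<phi>)"
proof -
  have wf: "wf_fm L_Class 0 (closure_setom n \<phi>)"
    using assms(1) by (simp add: wf_closure_setom)
  show ?thesis
    unfolding holds_iff_valid[OF is_struc_Cstruc wf] valid_def
    using forces_closure_setom[of 0 n \<phi> _ "[]"] assms(2) by (auto simp: env_in_0)
qed

text \<open>
  Atomic formulas about setoms have the same meaning in both structures, and quantifiers bounded to setoms
  range over the elements of \<open>U\<close>; so the two forcing relations have the same clauses.
\<close>

lemma forces_set_fm_of:
  "setom_bounded \<phi> \<Longrightarrow> wf_fm L_Class n \<phi> \<Longrightarrow> env_in U Y n xs \<Longrightarrow>
    forces Cstruc \<phi> Y (iotas xs) \<longleftrightarrow> forces N (set_fm_of \<phi>) Y xs"
proof (induction arbitrary: n Y xs rule: setom_bounded.induct)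
  case (1 t u)
  then obtain i j where ij: "t = Var i" "u = Var j" "i < n" "j < n"
    by (auto simp: wf_tm_L_Class)
  have len: "length xs = n" using 1 by (simp add: env_in_def)
  have "xs ! i \<in> hom E Y U" "xs ! j \<in> hom E Y U"
    using env_in_nth[OF 1(2)] ij by auto
  then show ?case
    using iota_inject[of "xs ! i" Y "xs ! j"] ij len by auto
next
  case (2 r ts)
  have len: "length xs = n" using 2 by (simp add: env_in_def)
  have x: "xs ! i \<in> hom E Y U" if "i < n" for i
    using env_in_nth[OF 2(2) that] .
  have c: "iota \<cdot> xs ! i \<in> hom E Y C" if "i < n" for i
    using x[OF that] by simp
  from 2(1) show ?case
    by (cases rule: wf_Rel_cases) (use x c len in \<open>simp_all del: forces.simps(2) tm_at.simps(2)\<close>)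
next
  case 3
  then show ?case by simp
next
  case (4 \<phi> \<psi>)
  then show ?case using 4(3)[of n Y xs] 4(4)[of n Y xs] by simp
next
  case (5 \<phi> \<psi>)
  have *: "forces Cstruc \<phi> V (restr (iotas xs) g) \<longleftrightarrow> forces N (set_fm_of \<phi>) V (restr xs g)"
    "forces Cstruc \<psi> V (restr (iotas xs) g) \<longleftrightarrow> forces N (set_fm_of \<psi>) V (restr xs g)"
    if "g \<in> hom E V Y" for V g
    using 5(3)[of n V "restr xs g"] 5(4)[of n V "restr xs g"] 5(5) env_in_restr[OF 5(6) that] restr_iotas[OF 5(6) that] by (simp_all del: map_map)
  show ?case
    unfolding set_fm_of.simps forces.simps
    by (rule all_cong1, rule ball_cong[OF refl], rule ball_cong[OF refl], rule imp_cong[OF _ refl],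
        rule all_cong1, rule ball_cong[OF refl]) (use * comp_hom in blast)
next
  case (6 \<phi> \<psi>)
  have *: "forces Cstruc \<phi> V (restr (iotas xs) g) \<longleftrightarrow> forces N (set_fm_of \<phi>) V (restr xs g)"
    "forces Cstruc \<psi> V (restr (iotas xs) g) \<longleftrightarrow> forces N (set_fm_of \<psi>) V (restr xs g)"
    if "g \<in> hom E V Y" for V g
    using 6(3)[of n V "restr xs g"] 6(4)[of n V "restr xs g"] 6(5) env_in_restr[OF 6(6) that] restr_iotas[OF 6(6) that] by (simp_all del: map_map)
  show ?case
    unfolding set_fm_of.simps forces.simps
    by (rule all_cong1, rule ball_cong[OF refl]) (use * in blast)
next
  case (7 \<phi>)
  have wf: "wf_fm L_Class (Suc n) \<phi>" using 7 by (simp add: Forall_setom_def)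
  have *: "forces Cstruc \<phi> Z (iota \<cdot> x # restr (iotas xs) g) \<longleftrightarrow> forces N (set_fm_of \<phi>) Z (x # restr xs g)"
    if "g \<in> hom E Z Y" "x \<in> hom E Z U" for Z g x
    using 7(2)[OF wf, of Z "x # restr xs g"] that env_in_restr[OF 7(4) that(1)] restr_iotas[OF 7(4) that(1)]
    by (simp del: map_map)
  have **: "forces N (Impl (Equal (Var 0) (Var 0)) (set_fm_of \<phi>)) Z (x # restr xs g) \<longleftrightarrow> forces N (set_fm_of \<phi>) Z (x # restr xs g)"
    if "g \<in> hom E Z Y" "x \<in> hom E Z U" for Z g x
  proof -
    have e: "env_in U Z (Suc n) (x # restr xs g)"
      using that env_in_restr[OF 7(4) that(1)] by simp
    show ?thesis
      using forces_ImplD[OF _ e, of N "Equal (Var 0) (Var 0)" "set_fm_of \<phi>"]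
        forces_restr[OF struc wf_set_fm_of[OF wf] e] by auto
  qed
  show ?case
    unfolding forces_Forall_setom[OF iotas_env[OF 7(4)]]
    using * ** by (simp add: Forall_setom_def del: forces.simps(6))
next
  case (8 \<phi>)
  have wf: "wf_fm L_Class (Suc n) \<phi>" using 8 by (simp add: Exists_setom_def)
  have *: "forces Cstruc \<phi> Z (iota \<cdot> x # restr (iotas xs) g) \<longleftrightarrow> forces N (set_fm_of \<phi>) Z (x # restr xs g)"
    if "g \<in> hom E Z Y" "x \<in> hom E Z U" for Z g x
    using 8(2)[OF wf, of Z "x # restr xs g"] that env_in_restr[OF 8(4) that(1)] restr_iotas[OF 8(4) that(1)]
    by (simp del: map_map)
  have **: "(\<forall>b \<in> hom E V C. forces Cstruc (Conj (c_setom (Var 0)) \<phi>) V (b # restr (iotas xs) g) \<longrightarrow> R) \<longleftrightarrow>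
     (\<forall>x \<in> hom E V U. forces N (Conj (Equal (Var 0) (Var 0)) (set_fm_of \<phi>)) V (x # restr xs g) \<longrightarrow> R)"
    if "g \<in> hom E V Y" for V g R
  proof -
    have "(\<forall>b \<in> hom E V C. forces Cstruc (Conj (c_setom (Var 0)) \<phi>) V (b # restr (iotas xs) g) \<longrightarrow> R) \<longleftrightarrow>
      (\<forall>b \<in> hom E V C. Setom V b \<and> forces Cstruc \<phi> V (b # restr (iotas xs) g) \<longrightarrow> R)"
      by (simp del: forces.simps(2))
    also have "\<dots> \<longleftrightarrow> (\<forall>x \<in> hom E V U. forces Cstruc \<phi> V (iota \<cdot> x # restr (iotas xs) g) \<longrightarrow> R)"
      unfolding Setom_def using iota_arr by blast
    finally show ?thesis using * that by simp
  qed
  show ?case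
    unfolding Exists_setom_def set_fm_of.simps set_rel_fm.simps list.map set_tm_of.simps list.sel forces.simps(8) carrier_Cstruc
    by (rule all_cong1, rule ball_cong[OF refl], rule ball_cong[OF refl], rule imp_cong[OF _ refl],
        rule all_cong1, rule ball_cong[OF refl], rule **, rule comp_hom)
qed

section \<open>Comprehension\<close>

lemma wf_class_set_comprehension:
  "wf_fm L_Class (n + 2) \<phi> \<Longrightarrow> wf_fm L_Class n (class_set_comprehension \<phi>)"
  by (simp add: class_set_comprehension_def Forall_setom_def Iff_def L_Class_def)

text \<open>
  The set \<open>x\<close> given by comprehension in \<open>N\<close> for the translated formula may exist only at later
  stages, and there \<open>iota x\<close> is a witness for the class structure.
\<close>

lemma holds_stratified_comprehension:
  assumes wf: "wf_fm L_Class (n + 2) \<phi>" and fv: "1 \<notin> fv \<phi>" and st: "class_stratified \<phi>" and sb: "setom_bounded \<phi>"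
  shows "holds E Cstruc (closure_setom n (class_set_comprehension \<phi>))"
proof (rule holds_closure_setom)
  let ?K = "Conj (c_set (Var 0)) (Forall_setom (Iff (c_mem (Var 0) (Var 1)) \<phi>))"
  let ?L = "Conj (s_set (Var 0)) (Forall (Iff (s_mem (Var 0) (Var 1)) (set_fm_of \<phi>)))"
  show wfn: "wf_fm L_Class n (class_set_comprehension \<phi>)"
    by (rule wf_class_set_comprehension[OF wf])
  have wfK: "wf_fm L_Class (Suc n) ?K"
    using wfn by (simp add: class_set_comprehension_def)
  fix Y xs assume xs: "env_in U Y n xs"
  have "valid N n (set_comprehension (set_fm_of \<phi>))"
  proof (rule axiom_valid)
    have "wf_fm L_Set (n + 2) (set_fm_of \<phi>)" by (rule wf_set_fm_of[OF wf])
    moreover have "1 \<notin> fv (set_fm_of \<phi>)" using fv_set_fm_of[OF wf] fv by blast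
    moreover have "set_stratified (set_fm_of \<phi>)"
      using st strat_set_fm_of[OF wf] unfolding class_stratified_def set_stratified_def by blast
    ultimately show "univ_closure n (set_comprehension (set_fm_of \<phi>)) \<in> Set_INFU"
      unfolding Set_INFU_def by blast
    show "wf_fm L_Set n (set_comprehension (set_fm_of \<phi>))"
      using wf_set_fm_of[OF wf] by (simp add: set_comprehension_def Iff_def L_Set_def)
  qed
  with xs have "forces N (Exists ?L) Y xs"
    unfolding valid_def set_comprehension_def by blast
  then have "(\<lambda>g. forces Cstruc (Exists ?K) (Dom E g) (restr (iotas xs) g)) (Idm E Y)"
  proof (rule forces_ExistsE)
    show "definable Y (\<lambda>g. forces Cstruc (Exists ?K) (Dom E g) (restr (iotas xs) g))"
      by (rule forces_definable[OF is_struc_Cstruc]) (use wfn iotas_env[OF xs] in \<open>simp_all add: class_set_comprehension_def\<close>)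
    fix Z g x assume g: "g \<in> hom E Z Y" and x: "x \<in> hom E Z U" and L: "forces N ?L Z (x # restr xs g)"
    note rx = env_in_restr[OF xs g]
    have e: "env_in U Z (Suc n) (x # restr xs g)" using rx x by simp
    have sx: "sset Z x" and mx: "elem V z (x \<cdot> k) \<longleftrightarrow> forces N (set_fm_of \<phi>) V (z # x \<cdot> k # restr xs (g \<cdot> k))"
      if "k \<in> hom E V Z" "z \<in> hom E V U" for V k z
      using L that restr_restr[OF xs g that(1)] unfolding forces.simps(4) forces_Forall_Iff[OF e]
      by (auto simp del: forces.simps map_map)
    show "forces Cstruc (Exists ?K) (Dom E g) (restr (iotas xs) g)"
    proof -
      have ec: "env_in C Z (Suc n) (iota \<cdot> x # iotas (restr xs g))" using iotas_env[OF e] by simp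
      have "forces Cstruc ?K Z (iota \<cdot> x # iotas (restr xs g))"
        unfolding forces.simps(4) forces_Forall_setom_Iff[OF ec]
      proof (intro conjI allI ballI)
        show "forces Cstruc (c_set (Var 0)) Z (iota \<cdot> x # iotas (restr xs g))"
          using sx x hom_Ob[OF x] Idm_hom[of Z] by (auto simp del: forces.simps)
        fix V k z assume k: "k \<in> hom E V Z" and z: "z \<in> hom E V U"
        have xk: "x \<cdot> k \<in> hom E V U" using comp_hom[OF k x] .
        have e': "env_in U V (n + 2) (z # x \<cdot> k # restr xs (g \<cdot> k))"
          using z xk env_in_restr[OF xs comp_hom[OF k g]] by simp
        have r: "restr (iota \<cdot> x # iotas (restr xs g)) k = iotas (x \<cdot> k # restr xs (g \<cdot> k))"
          using restr_iotas[OF e k] restr_restr[OF xs g k] by (simp del: map_map)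
        show "forces Cstruc (c_mem (Var 0) (Var 1)) V (iota \<cdot> z # restr (iota \<cdot> x # iotas (restr xs g)) k) \<longleftrightarrow>
            forces Cstruc \<phi> V (iota \<cdot> z # restr (iota \<cdot> x # iotas (restr xs g)) k)"
          unfolding r using forces_set_fm_of[OF sb wf e'] mx[OF k z] z xk
          by (simp del: forces.simps map_map)
      qed
      then have "forces Cstruc (Exists ?K) Z (iotas (restr xs g))"
        by (intro forces_ExistsI[OF is_struc_Cstruc wfK, of Z _ "iota \<cdot> x"]) (use iotas_env[OF rx] x in simp_all)
      then show ?thesis
        using restr_iotas[OF xs g] g by (simp add: hom_def del: forces.simps map_map)
    qed
  qed
  then show "forces Cstruc (class_set_comprehension \<phi>) Y (iotas xs)"
    using restr_Idm[OF iotas_env[OF xs]] env_in_Ob(1)[OF xs] by (simp add: class_set_comprehension_def del: forces.simps map_map)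
qed

text \<open>
  The subobject defined by the formula in the product of the stage with \<open>U\<close> is named by an element \<open>X\<close> of
  the power object, and \<open>kappa X\<close> is the required class.
\<close>

lemma holds_class_comprehension:
  assumes wf: "wf_fm L_Class (n + 2) \<phi>" and fv: "1 \<notin> fv \<phi>"
  shows "holds E Cstruc (univ_closure n (class_comprehension \<phi>))"
proof -
  let ?K = "Conj (c_class (Var 0)) (Forall_setom (Iff (c_mem (Var 0) (Var 1)) \<phi>))"
  have wfn: "wf_fm L_Class n (class_comprehension \<phi>)"
    using wf by (simp add: class_comprehension_def Forall_setom_def Iff_def L_Class_def)
  then have wfK: "wf_fm L_Class (Suc n) ?K"
    by (simp add: class_comprehension_def)
  have "forces Cstruc (Exists ?K) Y es" if es: "env_in C Y n es" for Y es
  proof -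
    note Y = env_in_Ob(1)[OF es]
    let ?P = "prd E Y U"
    let ?q = "iota \<cdot> pr2 E Y U"
    have pr: "pr1 E Y U \<in> hom E ?P Y" "pr2 E Y U \<in> hom E ?P U"
      using Y by (simp_all add: pr_hom)
    \<comment> \<open>Variable 1 stands for the class to be found, which is not available yet.  It is not free in the
      formula, so any value will do; it is given the value of variable 0.\<close>
    have e1: "env_in C ?P (n + 2) (?q # ?q # restr es (pr1 E Y U))"
      using env_in_restr[OF es pr(1)] pr(2) by simp
    have "definable ?P (\<lambda>p. forces Cstruc \<phi> (Dom E p) (restr (?q # ?q # restr es (pr1 E Y U)) p))"
      by (rule forces_definable[OF is_struc_Cstruc wf]) (use e1 in simp)
    from power_comprehension[OF this Y U_Ob] obtain X where X: "X \<in> hom E Y PU"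
      "\<And>Z g b. g \<in> hom E Z Y \<Longrightarrow> b \<in> hom E Z U \<Longrightarrow> isin U b (X \<cdot> g) \<longleftrightarrow>
        forces Cstruc \<phi> (Dom E (pairing E g b)) (restr (?q # ?q # restr es (pr1 E Y U)) (pairing E g b))"
      by blast
    have isin_X: "isin U z (X \<cdot> g) \<longleftrightarrow> forces Cstruc \<phi> Z (iota \<cdot> z # iota \<cdot> z # restr es g)"
      if g: "g \<in> hom E Z Y" and z: "z \<in> hom E Z U" for Z g z
    proof -
      have gz: "pairing E g z \<in> hom E Z ?P" by (rule pairing_hom[OF g z])
      have p: "pr1 E Y U \<cdot> pairing E g z = g" "pr2 E Y U \<cdot> pairing E g z = z"
        using g z by (simp_all add: hom_def)
      have "?q \<cdot> pairing E g z = iota \<cdot> pr2 E Y U \<cdot> pairing E g z"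
        using gz pr(2) iota_hom by (simp add: hom_def)
      then have "restr (?q # ?q # restr es (pr1 E Y U)) (pairing E g z) = iota \<cdot> z # iota \<cdot> z # restr es g"
        unfolding list.map restr_restr[OF es pr(1) gz] p by simp
      moreover have "Dom E (pairing E g z) = Z" using gz by (simp add: hom_def)
      ultimately show ?thesis using X(2)[OF g z] by (simp only:)
    qed
    have ek: "env_in C Y (Suc n) (kappa \<cdot> X # es)" using es X(1) by simp
    have "forces Cstruc ?K Y (kappa \<cdot> X # es)"
      unfolding forces.simps(4) forces_Forall_setom_Iff[OF ek]
    proof (intro conjI allI ballI)
      show "forces Cstruc (c_class (Var 0)) Y (kappa \<cdot> X # es)"
        using X(1) by (simp del: forces.simps)
      fix Z g z assume g: "g \<in> hom E Z Y" and z: "z \<in> hom E Z U"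
      note Xg = comp_hom[OF g X(1)]
      have kg: "(kappa \<cdot> X) \<cdot> g = kappa \<cdot> X \<cdot> g"
        using kappa_hom X(1) g by (simp add: hom_def)
      have "forces Cstruc \<phi> Z (iota \<cdot> z # iota \<cdot> z # restr es g) \<longleftrightarrow> forces Cstruc \<phi> Z (iota \<cdot> z # kappa \<cdot> X \<cdot> g # restr es g)"
      proof (rule forces_cong)
        show "fv \<phi> \<subseteq> {..<length (iota \<cdot> z # iota \<cdot> z # restr es g)}"
          using wf_fm_fv[OF wf] es by (simp add: env_in_def)
        fix i assume "i \<in> fv \<phi>"
        then have "i \<noteq> 1" using fv by blast
        then show "(iota \<cdot> z # iota \<cdot> z # restr es g) ! i = (iota \<cdot> z # kappa \<cdot> X \<cdot> g # restr es g) ! i"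
          by (auto simp: nth_Cons split: nat.splits)
      qed simp
      then show "forces Cstruc (c_mem (Var 0) (Var 1)) Z (iota \<cdot> z # restr (kappa \<cdot> X # es) g) \<longleftrightarrow>
          forces Cstruc \<phi> Z (iota \<cdot> z # restr (kappa \<cdot> X # es) g)"
        using isin_X[OF g z] z Xg by (simp add: kg del: forces.simps)
    qed
    then show ?thesis
      by (intro forces_ExistsI[OF is_struc_Cstruc wfK, of Y _ "kappa \<cdot> X"]) (use es X(1) in simp_all)
  qed
  then have "valid Cstruc n (class_comprehension \<phi>)"
    by (simp add: valid_def class_comprehension_def del: forces.simps)
  then show ?thesis
    using holds_univ_closure[OF is_struc_Cstruc wfn] by blast
qed

section \<open>The remaining axioms of the class theory\<close>

lemma env_in_cases:
  "env_in A Y (Suc 0) es \<Longrightarrow> \<exists>a. es = [a] \<and> a \<in> hom E Y A"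
  "env_in A Y 2 es \<Longrightarrow> \<exists>a b. es = [a, b] \<and> a \<in> hom E Y A \<and> b \<in> hom E Y A"
  "env_in A Y 3 es \<Longrightarrow> \<exists>a b c. es = [a, b, c] \<and> a \<in> hom E Y A \<and> b \<in> hom E Y A \<and> c \<in> hom E Y A"
  "env_in A Y 4 es \<Longrightarrow> \<exists>a b c d. es = [a, b, c, d] \<and> a \<in> hom E Y A \<and> b \<in> hom E Y A \<and> c \<in> hom E Y A \<and> d \<in> hom E Y A"
  by (auto simp: env_in_def length_cases)

lemma class_axiomI:
  "wf_fm L_Class n \<phi> \<Longrightarrow> valid Cstruc n \<phi> \<Longrightarrow> holds E Cstruc (univ_closure n \<phi>)"
  using holds_univ_closure[OF is_struc_Cstruc] by blast

lemma holds_class_mem_class: "holds E Cstruc class_mem_class"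
  unfolding class_mem_class_def
proof (rule class_axiomI[OF _ valid_ImplI])
  fix Y es assume e: "env_in (carrier Cstruc) Y 2 es" and m: "forces Cstruc (c_mem (Var 1) (Var 0)) Y es"
  obtain b a where es: "es = [b, a]" "a \<in> hom E Y C" "b \<in> hom E Y C"
    using env_in_cases(2)[OF e] by auto
  with m have "cmem Y a b" by (simp del: forces.simps)
  then have "Cls Y b" by (auto simp: cmem_def)
  with es show "forces Cstruc (c_class (Var 0)) Y es" by (simp del: forces.simps)
qed (simp add: L_Class_def)

lemma holds_class_mem_setom: "holds E Cstruc class_mem_setom"
  unfolding class_mem_setom_def
proof (rule class_axiomI[OF _ valid_ImplI])
  fix Y es assume e: "env_in (carrier Cstruc) Y 2 es" and m: "forces Cstruc (c_mem (Var 1) (Var 0)) Y es"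
  obtain b a where es: "es = [b, a]" "a \<in> hom E Y C" "b \<in> hom E Y C"
    using env_in_cases(2)[OF e] by auto
  with m have "cmem Y a b" by (simp del: forces.simps)
  then have "Setom Y a" by (auto simp: cmem_def)
  with es show "forces Cstruc (c_setom (Var 1)) Y es" by (simp del: forces.simps)
qed (simp add: L_Class_def)

text \<open>
  Classes are compared by their setoms, so the equality of \<open>kappa X\<close> and \<open>kappa X'\<close> is extensionality of the power object.
\<close>

lemma holds_class_ext: "holds E Cstruc class_ext"
  unfolding class_ext_def
proof (rule class_axiomI[OF _ valid_ImplI])
  let ?\<phi> = "Forall (Iff (c_mem (Var 0) (Var 2)) (c_mem (Var 0) (Var 1)))"
  fix Y es assume e: "env_in (carrier Cstruc) Y 2 es"
    and h: "forces Cstruc (Conj (c_class (Var 1)) (Conj (c_class (Var 0)) ?\<phi>)) Y es"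
  obtain b a where es: "es = [b, a]" "a \<in> hom E Y C" "b \<in> hom E Y C"
    using env_in_cases(2)[OF e] by auto
  have "Cls Y a" "Cls Y b" using h es by (simp_all del: forces.simps(2,7))
  then obtain X X' where X: "X \<in> hom E Y PU" "X' \<in> hom E Y PU" "a = kappa \<cdot> X" "b = kappa \<cdot> X'"
    by (auto simp: Cls_def)
  have "X = X'"
  proof (rule power_ext[OF X(1,2) U_Ob])
    fix Z g z assume g: "g \<in> hom E Z Y" and z: "z \<in> hom E Z U"
    have k: "(kappa \<cdot> X) \<cdot> g = kappa \<cdot> X \<cdot> g" "(kappa \<cdot> X') \<cdot> g = kappa \<cdot> X' \<cdot> g"
      using kappa_hom X(1,2) g by (simp_all add: hom_def)
    have Xg: "X \<cdot> g \<in> hom E Z PU" "X' \<cdot> g \<in> hom E Z PU"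
      using comp_hom g X by blast+
    have "forces Cstruc ?\<phi> Y es" using h by (simp only: forces.simps(4))
    then have "forces Cstruc (c_mem (Var 0) (Var 2)) Z (iota \<cdot> z # restr es g) \<longleftrightarrow>
        forces Cstruc (c_mem (Var 0) (Var 1)) Z (iota \<cdot> z # restr es g)"
      using g z unfolding forces_Forall_Iff[OF e] by (simp del: forces.simps)
    then show "isin U z (X \<cdot> g) \<longleftrightarrow> isin U z (X' \<cdot> g)"
      using z Xg by (simp add: es X(3,4) k del: forces.simps)
  qed
  with X es show "forces Cstruc (Equal (Var 1) (Var 0)) Y es" by simp
qed (simp add: L_Class_def Iff_def)

lemma holds_class_pair_sort: "holds E Cstruc class_pair_sort"
  unfolding class_pair_sort_def
proof (rule class_axiomI[OF _ valid_ImplI])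
  fix Y es assume e: "env_in (carrier Cstruc) Y 3 es" and p: "forces Cstruc (c_pair (Var 2) (Var 1) (Var 0)) Y es"
  obtain c b a where es: "es = [c, b, a]" "a \<in> hom E Y C" "b \<in> hom E Y C" "c \<in> hom E Y C"
    using env_in_cases(3)[OF e] by auto
  with p have "cpair Y a b c" by (simp del: forces.simps)
  then have "Setom Y a" "Setom Y b" "Setom Y c" using opair_hom by (auto simp: cpair_def)
  with es show "forces Cstruc (Conj (c_setom (Var 2)) (Conj (c_setom (Var 1)) (c_setom (Var 0)))) Y es"
    by (simp del: forces.simps(2))
qed (simp add: L_Class_def)

lemma holds_class_pair_functional: "holds E Cstruc class_pair_functional"
  unfolding class_pair_functional_def
proof (rule class_axiomI[OF _ valid_ImplI])
  fix Y es assume e: "env_in (carrier Cstruc) Y 4 es"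
    and p: "forces Cstruc (Conj (c_pair (Var 3) (Var 2) (Var 1)) (c_pair (Var 3) (Var 2) (Var 0))) Y es"
  obtain d c b a where es: "es = [d, c, b, a]" "a \<in> hom E Y C" "b \<in> hom E Y C" "c \<in> hom E Y C" "d \<in> hom E Y C"
    using env_in_cases(4)[OF e] by auto
  with p have "cpair Y a b c" "cpair Y a b d" by (simp_all del: forces.simps(2))
  then obtain x y x' y' where xy: "x \<in> hom E Y U" "y \<in> hom E Y U" "x' \<in> hom E Y U" "y' \<in> hom E Y U"
    "a = iota \<cdot> x" "b = iota \<cdot> y" "c = iota \<cdot> opair Y x y"
    "a = iota \<cdot> x'" "b = iota \<cdot> y'" "d = iota \<cdot> opair Y x' y'"
    unfolding cpair_def by blast
  then have "x = x'" "y = y'" by (metis iota_inject)+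
  with xy es show "forces Cstruc (Equal (Var 1) (Var 0)) Y es" by simp
qed (simp add: L_Class_def)

lemma holds_class_sethood: "holds E Cstruc class_sethood"
  unfolding class_sethood_def
proof (rule class_axiomI[OF _ valid_IffI])
  fix Y es assume e: "env_in (carrier Cstruc) Y 1 es"
  obtain a where es: "es = [a]" "a \<in> hom E Y C"
    using env_in_cases(1)[OF e[unfolded One_nat_def]] by auto
  then show "forces Cstruc (c_set (Var 0)) Y es \<longleftrightarrow> forces Cstruc (Conj (c_setom (Var 0)) (c_class (Var 0))) Y es"
    by (simp del: forces.simps(2))
qed (simp add: L_Class_def Iff_def)

lemma holds_class_pair_total: "holds E Cstruc class_pair_total"
  unfolding class_pair_total_def
proof (rule holds_closure_setom)
  show "wf_fm L_Class 2 (Exists (c_pair (Var 2) (Var 1) (Var 0)))"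
    by (simp add: L_Class_def)
  then have wf: "wf_fm L_Class (Suc 2) (c_pair (Var 2) (Var 1) (Var 0))" by simp
  fix Y xs assume e: "env_in U Y 2 xs"
  obtain y x where xs: "xs = [y, x]" "x \<in> hom E Y U" "y \<in> hom E Y U"
    using env_in_cases(2)[OF e] by auto
  have "forces Cstruc (c_pair (Var 2) (Var 1) (Var 0)) Y (iota \<cdot> opair Y x y # iotas xs)"
    using xs opair_hom[OF xs(2,3)] by (simp del: forces.simps)
  then show "forces Cstruc (Exists (c_pair (Var 2) (Var 1) (Var 0))) Y (iotas xs)"
    by (intro forces_ExistsI[OF is_struc_Cstruc wf, of Y _ "iota \<cdot> opair Y x y"])
      (use iotas_env[OF e] opair_hom[OF xs(2,3)] in simp_all)
qed

text \<open>
  The existential quantifier in the axiom may have witnesses only at later stages; the equations to be proved from it are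
  definable, hence can be proved there.
\<close>

lemma holds_class_pair_inj: "holds E Cstruc class_pair_inj"
  unfolding class_pair_inj_def
proof (rule holds_closure_setom)
  let ?K = "Conj (c_pair (Var 4) (Var 3) (Var 0)) (c_pair (Var 2) (Var 1) (Var 0))"
  let ?\<psi> = "Conj (Equal (Var 3) (Var 1)) (Equal (Var 2) (Var 0)) :: class_fm"
  show wf: "wf_fm L_Class 4 (Iff (Exists ?K) ?\<psi>)"
    by (simp add: L_Class_def Iff_def)
  have wfK: "wf_fm L_Class (Suc 4) ?K"
    by (simp add: L_Class_def)
  fix Y xs assume e: "env_in U Y 4 xs"
  show "forces Cstruc (Iff (Exists ?K) ?\<psi>) Y (iotas xs)"
  proof (rule forces_IffI)
    fix Z g assume g: "g \<in> hom E Z Y"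
    note e' = env_in_restr[OF e g]
    obtain y' x' y x where xs: "restr xs g = [y', x', y, x]" "x \<in> hom E Z U" "y \<in> hom E Z U"
      "x' \<in> hom E Z U" "y' \<in> hom E Z U"
      using env_in_cases(4)[OF e'] by auto
    note ec = iotas_env[OF e', unfolded xs(1)]
    have o: "opair Z x y \<in> hom E Z U" using opair_hom xs by blast
    have "forces Cstruc (Exists ?K) Z (iotas [y', x', y, x]) \<longleftrightarrow> x = x' \<and> y = y'"
    proof
      assume "forces Cstruc (Exists ?K) Z (iotas [y', x', y, x])"
      then have "(\<lambda>h. x \<cdot> h = x' \<cdot> h \<and> y \<cdot> h = y' \<cdot> h) (Idm E Z)"
      proof (rule forces_ExistsE)
        show "definable Z (\<lambda>h. x \<cdot> h = x' \<cdot> h \<and> y \<cdot> h = y' \<cdot> h)"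
          by (rule definable_conj[OF definable_eq definable_eq]) (use xs in simp_all)
        fix V k b assume k: "k \<in> hom E V Z" and b: "b \<in> hom E V (carrier Cstruc)"
          and K: "forces Cstruc ?K V (b # restr (iotas [y', x', y, x]) k)"
        have h: "x \<cdot> k \<in> hom E V U" "y \<cdot> k \<in> hom E V U" "x' \<cdot> k \<in> hom E V U" "y' \<cdot> k \<in> hom E V U"
          using comp_hom[OF k] xs by blast+
        have i: "(iota \<cdot> v) \<cdot> k = iota \<cdot> v \<cdot> k" if "v \<in> hom E Z U" for v
          using that iota_hom k by (simp add: hom_def)
        have "cpair V (iota \<cdot> x \<cdot> k) (iota \<cdot> y \<cdot> k) b" "cpair V (iota \<cdot> x' \<cdot> k) (iota \<cdot> y' \<cdot> k) b"
          using K b h by (simp_all add: i xs(2-5) del: forces.simps(2))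
        then obtain u v u' v' where uv: "u \<in> hom E V U" "v \<in> hom E V U" "u' \<in> hom E V U" "v' \<in> hom E V U"
          "iota \<cdot> x \<cdot> k = iota \<cdot> u" "iota \<cdot> y \<cdot> k = iota \<cdot> v" "b = iota \<cdot> opair V u v"
          "iota \<cdot> x' \<cdot> k = iota \<cdot> u'" "iota \<cdot> y' \<cdot> k = iota \<cdot> v'" "b = iota \<cdot> opair V u' v'"
          unfolding cpair_def by blast
        have "x \<cdot> k = u" by (rule iota_inject[OF h(1) uv(1,5)])
        moreover have "y \<cdot> k = v" by (rule iota_inject[OF h(2) uv(2,6)])
        moreover have "x' \<cdot> k = u'" by (rule iota_inject[OF h(3) uv(3,8)])
        moreover have "y' \<cdot> k = v'" by (rule iota_inject[OF h(4) uv(4,9)])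
        moreover have "opair V u v = opair V u' v'"
          by (rule iota_inject[OF opair_hom[OF uv(1,2)] opair_hom[OF uv(3,4)]]) (use uv(7,10) in simp)
        ultimately show "x \<cdot> k = x' \<cdot> k \<and> y \<cdot> k = y' \<cdot> k"
          using opair_inject[OF uv(1-4)] by simp
      qed
      then show "x = x' \<and> y = y'"
        using xs(2-5) hom_Ob[OF g] by (simp add: hom_def)
    next
      assume eq: "x = x' \<and> y = y'"
      have "forces Cstruc ?K Z (iota \<cdot> opair Z x y # iotas [y', x', y, x])"
        using eq xs(2-5) o by (simp del: forces.simps(2))
      then show "forces Cstruc (Exists ?K) Z (iotas [y', x', y, x])"
        by (intro forces_ExistsI[OF is_struc_Cstruc wfK, of Z _ "iota \<cdot> opair Z x y"])
          (use ec o in simp_all)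
    qed
    moreover have "forces Cstruc ?\<psi> Z (iotas [y', x', y, x]) \<longleftrightarrow> x = x' \<and> y = y'"
      using iota_inject[OF xs(2,4)] iota_inject[OF xs(3,5)] by auto
    ultimately show "forces Cstruc (Exists ?K) Z (restr (iotas xs) g) \<longleftrightarrow> forces Cstruc ?\<psi> Z (restr (iotas xs) g)"
      unfolding restr_iotas[OF e g] xs(1) by simp
  qed
qed

lemma class_model: "model E L_Class Class_IMLU Cstruc"
  unfolding model_def Class_IMLU_def
  using is_struc_Cstruc holds_class_mem_class holds_class_mem_setom holds_class_ext holds_class_pair_sort
    holds_class_pair_total holds_class_pair_functional holds_class_pair_inj holds_class_sethood
    holds_class_comprehension holds_stratified_comprehension
  by blast

lemma class_model_sets_only:
  assumes "holds E N (Forall (s_set (Var 0)))"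
  shows "model E L_Class Class_IML Cstruc"
proof -
  have "univ_closure 1 (s_set (Var 0)) = Forall (s_set (Var 0))"
    by (simp add: univ_closure_def)
  moreover have "wf_fm L_Set 1 (s_set (Var 0))"
    by (simp add: L_Set_def)
  ultimately have v: "valid N 1 (s_set (Var 0))"
    using holds_univ_closure[OF struc] assms by metis
  have "holds E Cstruc (closure_setom 1 (c_set (Var 0)))"
  proof (rule holds_closure_setom)
    fix Y xs assume e: "env_in U Y 1 xs"
    then obtain x where x: "xs = [x]" "x \<in> hom E Y U" using env_in_cases(1)[OF e[unfolded One_nat_def]] by auto
    have "forces N (s_set (Var 0)) Y xs" using v e unfolding valid_def by blast
    then have "sset Y x" using x by (simp del: forces.simps)
    then show "forces Cstruc (c_set (Var 0)) Y (iotas xs)"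
      using x by (simp del: forces.simps)
  qed (simp add: L_Class_def)
  then have "holds E Cstruc (Forall_setom (c_set (Var 0)))"
    by (simp add: closure_setom_def)
  with class_model show ?thesis
    by (auto simp: model_def Class_IML_def)
qed

end

lemma (in elementary_topos) model_classical:
  assumes "boolean E" "model E L T M"
  shows "model E L (classical L T) M"
  using assms boolean_excluded_middle[OF assms(1)] unfolding model_def classical_def by blast

theorem theorem6p2p6:
  fixes E :: "('o, 'm) cat"
  assumes "topos E"
  shows "((\<exists>M. model E L_Set Set_INFU M) \<longrightarrow> (\<exists>M. model E L_Class Class_IMLU M)) \<and>
    ((\<exists>M. model E L_Set Set_INF M) \<longrightarrow> (\<exists>M. model E L_Class Class_IML M)) \<and>
    (boolean E \<longrightarrow>
      ((\<exists>M. model E L_Set Set_NFU M) \<longrightarrow> (\<exists>M. model E L_Class Class_MLU M)) \<and>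
      ((\<exists>M. model E L_Set Set_NF M) \<longrightarrow> (\<exists>M. model E L_Class Class_ML M)))"
proof -
  interpret elementary_topos E
    by unfold_locales (rule assms)
  have U: "\<exists>M. model E L_Class Class_IMLU M" if "model E L_Set Set_INFU N" for N
  proof -
    interpret set_model E N by unfold_locales (rule that)
    show ?thesis using class_model by blast
  qed
  have noU: "\<exists>M. model E L_Class Class_IML M" if "model E L_Set Set_INF N" for N
  proof -
    interpret set_model E N
      by unfold_locales (use that in \<open>simp add: model_def Set_INF_def\<close>)
    have "holds E N (Forall (s_set (Var 0)))"
      using that by (simp add: model_def Set_INF_def)
    then show ?thesis using class_model_sets_only by blast
  qed
  have sub: "model E L_Set T N" if "model E L_Set (classical L_Set T) N" for T N
    using that by (simp add: model_def classical_def)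
  show ?thesis
    using U noU sub model_classical
    unfolding Set_NFU_def Set_NF_def Class_MLU_def Class_ML_def by meson
qed

end
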